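(* For every positive integer $m$ let $\mathfrak{P}_m$ be a prime ideal of $\mathcal{O}_{K_m}$, where $K_m=\mathbb{Q}[\zeta_m]$, lying over a prime number that does not divide $m$, and let $q_m=|\mathcal{O}_{K_m}/\mathfrak{P}_m|$. Let $\mathcal{L}_{\mathcal{C},m}$ be the associated family of lattices in $(K_m\otimes_{\mathbb{Q}}\mathbb{R})^2\cong\mathbb{R}^{2\phi(m)}$ defined in the context. Assume that $\phi(m)^2 m=o\big(q_m^{1/\phi(m)}\big)$ as $m\to\infty$. Then for every $0<\varepsilon<1$ and all $m$ big enough, the family $\mathcal{L}_{\mathcal{C},m}$ contains a lattice $\Lambda\subset\mathbb{R}^{2\phi(m)}$ satisfying $$\Delta(\Lambda)>\frac{(1-\varepsilon)m}{2^{2\phi(m)}}.$$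
   Context: $\phi$ is Euler's totient function, $\zeta_m$ a primitive $m$-th root of unity, $K=\mathbb{Q}[\zeta_m]$ with ring of integers $\mathcal{O}_K$, and $K_{\mathbb{R}}=K\otimes_{\mathbb{Q}}\mathbb{R}$ is a Euclidean space of dimension $\phi(m)$ for the scalar product $\langle x,y\rangle=\mathrm{tr}(x\overline{y})$ induced by the trace form of $K/\mathbb{Q}$ and complex conjugation. $E=K_{\mathbb{R}}^2$ carries the scalar product $\langle x,y\rangle=\langle x_1,y_1\rangle+\langle x_2,y_2\rangle$ and is identified isometrically with $\mathbb{R}^{2\phi(m)}$. Let $\mathfrak{P}$ be a prime ideal of $\mathcal{O}_K$ over a prime number not dividing $m$, $F=\mathcal{O}_K/\mathfrak{P}$, $q=|F|$. Put $\Lambda_0=\mathcal{O}_K^2\subset E$ and let $\pi:\Lambda_0\to\Lambda_0/\mathfrak{P}\Lambda_0= F^2$ be the canonical surjection. $\mathcal{C}$ is the set of the $q+1$ one-dimensional $F$-subspaces of $F^2$; for $C\in\mathcal{C}$, $\Lambda_C=\pi^{-1}(C)$; and $\mathcal{L}_{\mathcal{C}}=\{\Lambda_C : C\in\mathcal{C}\}$. $\mathcal{L}_{\mathcal{C},m}$ denotes this family for the given $m$ and $\mathfrak{P}=\mathfrak{P}_m$. For a lattice $\Lambda$ in an $n$-dimensional Euclidean space, $\mathrm{Vol}(\Lambda)$ is the volume of a fundamental region, $\mu_\Lambda=\min\{\|x\|:x\in\Lambda\setminus\{0\}\}$, $B(r)$ is the closed ball of radius $r$ centered at $0$, and $\Delta(\Lambda)=\frac{\mathrm{Vol}(B(\mu_\Lambda))}{2^n\mathrm{Vol}(\Lambda)}$.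 *)

theory Defs
  imports
    "HOL-Analysis.Analysis"
    "HOL-Library.Landau_Symbols"
    "HOL-Computational_Algebra.Polynomial"
    "HOL-Algebra.QuotRing"
    "HOL-Number_Theory.Totient"
begin

section \<open>Lattices in \<open>\<real>\<^sup>n\<close>, for a natural number \<open>n\<close>\<close>

text \<open>
  The dimension varies with the parameter \<open>m\<close>, so it cannot be a type: a point of \<open>\<real>\<^sup>n\<close> is an
  extensional function on \<open>{..<n}\<close>, and \<open>\<real>\<^sup>n\<close> carries the product Lebesgue measure.
\<close>

definition Rn :: "nat \<Rightarrow> (nat \<Rightarrow> real) set" where
  "Rn n = (\<Pi>\<^sub>E i\<in>{..<n}. UNIV)"

definition lborel_Rn :: "nat \<Rightarrow> (nat \<Rightarrow> real) measure" where
  "lborel_Rn n = (\<Pi>\<^sub>M i\<in>{..<n}. lborel)"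

definition zero_Rn :: "nat \<Rightarrow> nat \<Rightarrow> real" where
  "zero_Rn n = (\<lambda>i\<in>{..<n}. 0)"

definition norm_Rn :: "nat \<Rightarrow> (nat \<Rightarrow> real) \<Rightarrow> real" where
  "norm_Rn n x = L2_set x {..<n}"

definition cball_Rn :: "nat \<Rightarrow> real \<Rightarrow> (nat \<Rightarrow> real) set" where
  "cball_Rn n r = {x \<in> Rn n. norm_Rn n x \<le> r}"

text \<open>A fundamental region is a Borel set containing exactly one point of each class modulo \<open>\<Lambda>\<close>.\<close>

definition fundamental_region :: "nat \<Rightarrow> (nat \<Rightarrow> real) set \<Rightarrow> (nat \<Rightarrow> real) set \<Rightarrow> bool" where
  "fundamental_region n \<Lambda> D \<longleftrightarrow>
     D \<in> sets (lborel_Rn n) \<and>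
     (\<forall>x\<in>Rn n. \<exists>!l. l \<in> \<Lambda> \<and> (\<lambda>i\<in>{..<n}. x i - l i) \<in> D)"

definition lattice_Vol :: "nat \<Rightarrow> (nat \<Rightarrow> real) set \<Rightarrow> real" where
  "lattice_Vol n \<Lambda> = (THE v. \<exists>D. fundamental_region n \<Lambda> D \<and> v = measure (lborel_Rn n) D)"

definition lattice_min :: "nat \<Rightarrow> (nat \<Rightarrow> real) set \<Rightarrow> real" where
  "lattice_min n \<Lambda> = (LEAST r. r \<in> norm_Rn n ` (\<Lambda> - {zero_Rn n}))"

definition packing_density :: "nat \<Rightarrow> (nat \<Rightarrow> real) set \<Rightarrow> real" where
  "packing_density n \<Lambda> =
     measure (lborel_Rn n) (cball_Rn n (lattice_min n \<Lambda>)) / (2 ^ n * lattice_Vol n \<Lambda>)"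


section \<open>Cyclotomic fields, their integers and their residue fields\<close>

definition zeta :: "nat \<Rightarrow> complex" where
  "zeta m = cis (2 * pi / real m)"

definition cyc_field :: "nat \<Rightarrow> complex set" where
  "cyc_field m = {poly (map_poly of_rat p) (zeta m) | p :: rat poly. True}"

definition cyc_int_ring :: "nat \<Rightarrow> complex ring" where
  "cyc_int_ring m =
     \<lparr>carrier = {x \<in> cyc_field m. algebraic_int x}, mult = (*), one = 1, zero = 0, add = (+)\<rparr>"

definition lies_over :: "complex set \<Rightarrow> nat \<Rightarrow> bool" where
  "lies_over P p \<longleftrightarrow> {z :: int. of_int z \<in> P} = {int p * k | k. True}"

definition residue_card :: "nat \<Rightarrow> complex set \<Rightarrow> nat" where
  "residue_card m P = card (carrier (cyc_int_ring m Quot P))"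

interpretation rat_complex: vector_space "\<lambda>(a::rat) (x::complex). of_rat a * x"
  by unfold_locales (auto simp: algebra_simps of_rat_add of_rat_mult)

text \<open>
  The trace of \<open>K/\<rat>\<close>: the trace of the \<open>\<rat>\<close>-linear map \<open>y \<mapsto> x * y\<close> of \<open>K\<close>, read off in a basis of
  \<open>K\<close>; it does not depend on the basis.
\<close>

definition cyc_trace :: "nat \<Rightarrow> complex \<Rightarrow> rat" where
  "cyc_trace m x =
     (let B = (SOME B. rat_complex.independent B \<and> rat_complex.span B = cyc_field m)
      in \<Sum>b\<in>B. rat_complex.representation B (x * b) b)"


section \<open>The Euclidean spaces \<open>K \<otimes> \<real>\<close> and \<open>E = (K \<otimes> \<real>)\<^sup>2\<close>\<close>

text \<open>
  Two formal sums \<open>\<Sum> x\<^sub>i \<otimes> r\<^sub>i\<close> are equal in \<open>K \<otimes>\<^sub>\<rat> \<real>\<close> iff every \<open>\<rat>\<close>-linear \<open>f : K \<rightarrow> \<real>\<close> takes the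
  same value \<open>\<Sum> r\<^sub>i f(x\<^sub>i)\<close> on them.  So a tensor is represented by the functional
  \<open>f \<mapsto> \<Sum> r\<^sub>i f(x\<^sub>i)\<close> on \<open>Hom\<^sub>\<rat>(K, \<real>)\<close>, set to 0 outside of it; sums and real multiples of tensors
  are pointwise.
\<close>

definition cyc_Hom :: "nat \<Rightarrow> (complex \<Rightarrow> real) set" where
  "cyc_Hom m = {f. (\<forall>x\<in>cyc_field m. \<forall>y\<in>cyc_field m. f (x + y) = f x + f y) \<and>
                   (\<forall>a::rat. \<forall>x\<in>cyc_field m. f (of_rat a * x) = of_rat a * f x)}"

type_synonym tensor = "(complex \<Rightarrow> real) \<Rightarrow> real"

definition pure_tensor :: "nat \<Rightarrow> complex \<Rightarrow> real \<Rightarrow> tensor" where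
  "pure_tensor m x r = (\<lambda>f. if f \<in> cyc_Hom m then r * f x else 0)"

definition cyc_KR :: "nat \<Rightarrow> tensor set" where
  "cyc_KR m = {\<lambda>f. \<Sum>x\<in>S. pure_tensor m x (c x) f | S c. finite S \<and> S \<subseteq> cyc_field m}"

text \<open>
  The \<open>\<real>\<close>-bilinear extension of \<open>\<langle>x, y\<rangle> = tr (x * cnj y)\<close>; see \<open>KR_inner_pure_tensor\<close> below.
\<close>

definition KR_inner :: "nat \<Rightarrow> tensor \<Rightarrow> tensor \<Rightarrow> real" where
  "KR_inner m t u = t (\<lambda>x. u (\<lambda>y. of_rat (cyc_trace m (x * cnj y))))"

definition cyc_E :: "nat \<Rightarrow> (tensor \<times> tensor) set" where
  "cyc_E m = cyc_KR m \<times> cyc_KR m"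

definition E_inner :: "nat \<Rightarrow> tensor \<times> tensor \<Rightarrow> tensor \<times> tensor \<Rightarrow> real" where
  "E_inner m v w = KR_inner m (fst v) (fst w) + KR_inner m (snd v) (snd w)"

definition E_add :: "tensor \<times> tensor \<Rightarrow> tensor \<times> tensor \<Rightarrow> tensor \<times> tensor" where
  "E_add v w = (\<lambda>f. fst v f + fst w f, \<lambda>f. snd v f + snd w f)"

definition E_scale :: "real \<Rightarrow> tensor \<times> tensor \<Rightarrow> tensor \<times> tensor" where
  "E_scale a v = (\<lambda>f. a * fst v f, \<lambda>f. a * snd v f)"

definition E_isometry :: "nat \<Rightarrow> (tensor \<times> tensor \<Rightarrow> nat \<Rightarrow> real) \<Rightarrow> bool" where
  "E_isometry m \<iota> \<longleftrightarrow>
     bij_betw \<iota> (cyc_E m) (Rn (2 * totient m)) \<and>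
     (\<forall>v\<in>cyc_E m. \<forall>w\<in>cyc_E m. \<iota> (E_add v w) = (\<lambda>i\<in>{..<2 * totient m}. \<iota> v i + \<iota> w i)) \<and>
     (\<forall>a. \<forall>v\<in>cyc_E m. \<iota> (E_scale a v) = (\<lambda>i\<in>{..<2 * totient m}. a * \<iota> v i)) \<and>
     (\<forall>v\<in>cyc_E m. \<forall>w\<in>cyc_E m. (\<Sum>i<2 * totient m. \<iota> v i * \<iota> w i) = E_inner m v w)"

text \<open>
  The identification of \<open>E\<close> with \<open>\<real>\<^bsup>2\<phi>(m)\<^esup>\<close>.  Two choices differ by an orthogonal map, which
  preserves the packing density of lattices.
\<close>

definition E_to_Rn :: "nat \<Rightarrow> tensor \<times> tensor \<Rightarrow> nat \<Rightarrow> real" where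
  "E_to_Rn m = (SOME \<iota>. E_isometry m \<iota>)"


section \<open>The family of lattices\<close>

definition F2_lines :: "('a, 'b) ring_scheme \<Rightarrow> ('a \<times> 'a) set set" where
  "F2_lines F = {{(c \<otimes>\<^bsub>F\<^esub> a, c \<otimes>\<^bsub>F\<^esub> b) | c. c \<in> carrier F} | a b.
                   a \<in> carrier F \<and> b \<in> carrier F \<and> (a, b) \<noteq> (\<zero>\<^bsub>F\<^esub>, \<zero>\<^bsub>F\<^esub>)}"

text \<open>\<open>\<pi>\<^sup>-\<^sup>1(C)\<close>, as a subset of \<open>K\<^sup>2\<close>\<close>

definition code_preimage :: "nat \<Rightarrow> complex set \<Rightarrow> (complex set \<times> complex set) set
    \<Rightarrow> (complex \<times> complex) set" where
  "code_preimage m P C =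
     {(x, y). x \<in> carrier (cyc_int_ring m) \<and> y \<in> carrier (cyc_int_ring m) \<and>
              (P +>\<^bsub>cyc_int_ring m\<^esub> x, P +>\<^bsub>cyc_int_ring m\<^esub> y) \<in> C}"

text \<open>Here \<open>K\<^sup>2\<close> is embedded in \<open>E\<close> by \<open>x \<mapsto> x \<otimes> 1\<close>.\<close>

definition code_lattice :: "nat \<Rightarrow> complex set \<Rightarrow> (complex set \<times> complex set) set
    \<Rightarrow> (nat \<Rightarrow> real) set" where
  "code_lattice m P C =
     (\<lambda>(x, y). E_to_Rn m (pure_tensor m x 1, pure_tensor m y 1)) ` code_preimage m P C"

definition code_lattices :: "nat \<Rightarrow> complex set \<Rightarrow> (nat \<Rightarrow> real) set set" where
  "code_lattices m P = code_lattice m P ` F2_lines (cyc_int_ring m Quot P)"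


section \<open>The scalar product on pure tensors\<close>

lemma poly_mem_cyc_field: "poly (map_poly of_rat p) (zeta m) \<in> cyc_field m"
  unfolding cyc_field_def by blast

lemma cyc_field_add: "x + y \<in> cyc_field m" if xy: "x \<in> cyc_field m" "y \<in> cyc_field m"
proof -
  obtain p q where "x = poly (map_poly of_rat p) (zeta m)" "y = poly (map_poly of_rat q) (zeta m)"
    using xy unfolding cyc_field_def by blast
  moreover have "map_poly of_rat (p + q) = map_poly of_rat p + map_poly (of_rat :: rat \<Rightarrow> complex) q"
    by (rule poly_eqI) (simp add: coeff_map_poly of_rat_add)
  ultimately show ?thesis
    using poly_mem_cyc_field[of "p + q" m] by simp
qed

lemma cyc_field_mult: "x * y \<in> cyc_field m" if xy: "x \<in> cyc_field m" "y \<in> cyc_field m"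
proof -
  obtain p q where "x = poly (map_poly of_rat p) (zeta m)" "y = poly (map_poly of_rat q) (zeta m)"
    using xy unfolding cyc_field_def by blast
  moreover have "map_poly of_rat (p * q) = map_poly of_rat p * map_poly (of_rat :: rat \<Rightarrow> complex) q"
    by (rule poly_eqI) (simp add: coeff_map_poly coeff_mult of_rat_sum of_rat_mult)
  ultimately show ?thesis
    using poly_mem_cyc_field[of "p * q" m] by simp
qed

lemma cyc_field_of_rat: "of_rat a \<in> cyc_field m"
  using poly_mem_cyc_field[of "[:a:]" m] by (simp add: map_poly_pCons)

lemma cyc_field_zeta: "zeta m \<in> cyc_field m"
  using poly_mem_cyc_field[of "[:0, 1:]" m] by (simp add: map_poly_pCons)

lemma cyc_field_power: "x ^ k \<in> cyc_field m" if "x \<in> cyc_field m"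
  by (induction k) (use cyc_field_of_rat[of 1 m] that cyc_field_mult in auto)

lemma cyc_field_sum: "(\<Sum>i\<in>A. f i) \<in> cyc_field m" if "\<And>i. i \<in> A \<Longrightarrow> f i \<in> cyc_field m"
  using that cyc_field_of_rat[of 0 m]
  by (induction A rule: infinite_finite_induct) (auto intro: cyc_field_add)

lemma cnj_of_rat: "cnj (of_rat a) = of_rat a"
  by (cases a) (simp add: of_rat_rat)

lemma cyc_field_cnj: "cnj x \<in> cyc_field m" if m: "m > 0" and x: "x \<in> cyc_field m"
proof -
  obtain p where p: "x = poly (map_poly of_rat p) (zeta m)"
    using x unfolding cyc_field_def by blast
  have "zeta m * zeta m ^ (m - 1) = 1"
    using m Complex.DeMoivre[of "2 * pi / real m" m]
    by (simp add: zeta_def power_eq_if[of _ m])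
  moreover have "zeta m * cnj (zeta m) = 1"
    by (simp add: zeta_def cis_cnj cis_mult)
  moreover have "zeta m \<noteq> 0"
    by (simp add: zeta_def)
  ultimately have "cnj (zeta m) = zeta m ^ (m - 1)"
    by (metis mult_cancel_left)
  hence *: "cnj (zeta m) \<in> cyc_field m"
    by (simp add: cyc_field_power cyc_field_zeta)
  show ?thesis
    unfolding p poly_altdef
    by (auto simp: coeff_map_poly cnj_of_rat intro!: cyc_field_sum cyc_field_mult cyc_field_of_rat
        cyc_field_power *)
qed

lemma cyc_field_subspace: "rat_complex.subspace (cyc_field m)"
  using cyc_field_of_rat[of 0 m]
  by (auto simp: rat_complex.subspace_def intro: cyc_field_add cyc_field_mult cyc_field_of_rat)

lemma cyc_trace_add: "cyc_trace m (x + y) = cyc_trace m x + cyc_trace m y"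
  and cyc_trace_scale: "cyc_trace m (of_rat a * x) = a * cyc_trace m x"
  if "x \<in> cyc_field m" "y \<in> cyc_field m"
proof -
  define B where "B = (SOME B. rat_complex.independent B \<and> rat_complex.span B = cyc_field m)"
  have "\<exists>B. rat_complex.independent B \<and> rat_complex.span B = cyc_field m"
    using rat_complex.maximal_independent_subset[of "cyc_field m"] cyc_field_subspace
    by (metis rat_complex.span_minimal subset_antisym)
  hence B: "rat_complex.independent B" "rat_complex.span B = cyc_field m"
    unfolding B_def by (metis (mono_tags, lifting) someI_ex)+
  have mem: "b \<in> B \<Longrightarrow> z \<in> cyc_field m \<Longrightarrow> z * b \<in> rat_complex.span B" for b z
    using B rat_complex.span_base cyc_field_mult by metis
  show "cyc_trace m (x + y) = cyc_trace m x + cyc_trace m y"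
    unfolding cyc_trace_def B_def[symmetric] Let_def
    by (simp add: ring_distribs rat_complex.representation_add[OF B(1) mem mem] that
        flip: sum.distrib cong: sum.cong)
  show "cyc_trace m (of_rat a * x) = a * cyc_trace m x"
    unfolding cyc_trace_def B_def[symmetric] Let_def
    by (simp add: mult.assoc rat_complex.representation_scale[OF B(1) mem] that sum_distrib_left
        cong: sum.cong)
qed

lemma pure_tensor_balanced:
  "pure_tensor m (of_rat a * x) r = pure_tensor m x (of_rat a * r)" if "x \<in> cyc_field m"
  using that by (auto simp: pure_tensor_def cyc_Hom_def)

lemma KR_inner_pure_tensor:
  assumes "m > 0" "x \<in> cyc_field m" "y \<in> cyc_field m"
  shows "KR_inner m (pure_tensor m x r) (pure_tensor m y s) = r * s * of_rat (cyc_trace m (x * cnj y))"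
proof -
  have right: "(\<lambda>v. of_rat (cyc_trace m (u * cnj v))) \<in> cyc_Hom m" if "u \<in> cyc_field m" for u
    unfolding cyc_Hom_def
  proof safe
    fix v w assume "v \<in> cyc_field m" "w \<in> cyc_field m"
    thus "real_of_rat (cyc_trace m (u * cnj (v + w))) =
            of_rat (cyc_trace m (u * cnj v)) + of_rat (cyc_trace m (u * cnj w))"
      by (simp add: ring_distribs cyc_trace_add cyc_field_mult cyc_field_cnj assms that of_rat_add)
  next
    fix a v assume v: "v \<in> cyc_field m"
    have "u * cnj (of_rat a * v) = of_rat a * (u * cnj v)"
      by (simp add: cnj_of_rat)
    thus "real_of_rat (cyc_trace m (u * cnj (of_rat a * v))) =
            of_rat a * of_rat (cyc_trace m (u * cnj v))"
      using v that assms(1)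
      by (simp only: cyc_trace_scale[OF cyc_field_mult cyc_field_mult] cyc_field_cnj of_rat_mult)
  qed
  have val: "pure_tensor m y s (\<lambda>v. of_rat (cyc_trace m (u * cnj v))) =
                 s * of_rat (cyc_trace m (u * cnj y))" if "u \<in> cyc_field m" for u
    using right[OF that] by (simp add: pure_tensor_def)
  have y: "cnj y \<in> cyc_field m"
    by (simp add: cyc_field_cnj assms)
  have left: "(\<lambda>u. pure_tensor m y s (\<lambda>v. of_rat (cyc_trace m (u * cnj v)))) \<in> cyc_Hom m"
    unfolding cyc_Hom_def
  proof safe
    fix u w assume "u \<in> cyc_field m" "w \<in> cyc_field m"
    thus "pure_tensor m y s (\<lambda>v. of_rat (cyc_trace m ((u + w) * cnj v))) =
            pure_tensor m y s (\<lambda>v. of_rat (cyc_trace m (u * cnj v))) +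
            pure_tensor m y s (\<lambda>v. of_rat (cyc_trace m (w * cnj v)))"
      by (simp only: val cyc_field_add)
        (simp add: ring_distribs cyc_field_mult y cyc_trace_add of_rat_add)
  next
    fix a u assume "u \<in> cyc_field m"
    thus "pure_tensor m y s (\<lambda>v. of_rat (cyc_trace m (of_rat a * u * cnj v))) =
            of_rat a * pure_tensor m y s (\<lambda>v. of_rat (cyc_trace m (u * cnj v)))"
      by (simp only: val cyc_field_mult cyc_field_of_rat)
        (simp add: mult.assoc cyc_field_mult y cyc_trace_scale[of "u * cnj y" m "u * cnj y"]
          of_rat_mult)
  qed
  show ?thesis
    using left val[OF assms(2)] unfolding KR_inner_def pure_tensor_def[of m x] by simp
qed

end

theory Submission
  imports Defs "HOL-Computational_Algebra.Fundamental_Theorem_Algebra"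
begin

text \<open>
  Let \<open>d = \<phi>(m)\<close>, \<open>n = 2d\<close> and \<open>Q = q\<^bsup>1/d\<^esup>\<close>.  Only the \<open>q\<close> lines through the points \<open>(1, y)\<close>
  are used; two of their lattices meet in \<open>\<PP>\<^sup>2\<close>, and each has volume at most \<open>q vol(\<Lambda>\<^sub>0)\<close>.  If each
  of them had a nonzero vector of norm at most \<open>r\<close>, where \<open>r\<close> is smaller than the minimum of
  \<open>\<PP>\<^sup>2\<close>, then multiplication by \<open>\<zeta>\<close> would produce \<open>mq\<close> points of \<open>\<Lambda>\<^sub>0\<close> in the ball of radius
  \<open>r\<close>.  For \<open>vol(B(r)) = (1 - \<epsilon>) m q vol(\<Lambda>\<^sub>0)\<close> this contradicts the upper bound
  \<open>vol(B(r + \<tau>)) / vol(\<Lambda>\<^sub>0)\<close>, provided that \<open>n\<tau>/r\<close> is small, where \<open>\<tau>\<close> is a bound for the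
  covering radius of \<open>\<Lambda>\<^sub>0\<close>.

  No discriminant is needed.  Randomized rounding in the vectors \<open>\<zeta>\<^sup>i\<close> gives \<open>\<tau>\<^sup>2 = d\<^sup>2/2\<close>, and the
  nonzero vectors of \<open>\<Lambda>\<^sub>0\<close> have norm at least \<open>\<surd>d\<close> by the inequality between the arithmetic and the
  geometric mean, since norms of algebraic integers are integers.  Packing and covering by balls
  turn this into bounds for \<open>vol(\<Lambda>\<^sub>0)\<close>.  For \<open>0 \<noteq> x \<in> \<PP>\<close>, rounding in the vectors \<open>x\<zeta>\<^sup>i\<close>
  bounds the volume \<open>q\<^sup>2 vol(\<Lambda>\<^sub>0)\<close> of \<open>\<PP>\<^sup>2\<close> in terms of the norm of \<open>x\<close>, so that this norm is at
  least \<open>Q/\<surd>8\<close>.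
\<close>

section \<open>Fundamental regions and lattice points in balls\<close>

text \<open>The growth hypothesis is used twice, and this fixes how sharp the estimates must be. Let
  V be the volume of the unit ball and vol that of \<Lambda>_0. From vol <= V \<tau>^n follows r^2
  <= m Q \<tau>^2 = m Q d^2 / 2, which stays below Q^2 / 8, the bound for the squared minimum over
  pairs from the prime ideal, as soon as 4 d^2 m < Q. From vol >= V (sqrt d / 4)^n follows, for
  large m, r^2 >= d Q / 16, so that (n \<tau> / r)^2 <= 32 d^3 / Q, which tends to 0 since d <= m.
  An n-th root is taken of every error in vol, and vol itself cancels in the density; hence crude
  packing and covering bounds are good enough. The algebra serves to identify the trace form, which
  is defined through an arbitrary basis, with a sum over the substitutions \<zeta> -> \<zeta>^k.
  That these are well defined on the field amounts to the irreducibility of the cyclotomic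
  polynomial.\<close>

abbreviation add_Rn :: "nat \<Rightarrow> (nat \<Rightarrow> real) \<Rightarrow> (nat \<Rightarrow> real) \<Rightarrow> nat \<Rightarrow> real" where
  "add_Rn n x y \<equiv> (\<lambda>i\<in>{..<n}. x i + y i)"

abbreviation sub_Rn :: "nat \<Rightarrow> (nat \<Rightarrow> real) \<Rightarrow> (nat \<Rightarrow> real) \<Rightarrow> nat \<Rightarrow> real" where
  "sub_Rn n x y \<equiv> (\<lambda>i\<in>{..<n}. x i - y i)"

lemma Rn_eqI: "x = y" if "x \<in> Rn n" "y \<in> Rn n" "\<And>i. i < n \<Longrightarrow> x i = y i"
  using that unfolding Rn_def by (intro PiE_ext[of x _ _ y]) auto

lemma restrict_in_Rn [simp]: "(\<lambda>i\<in>{..<n}. f i) \<in> Rn n"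
  by (simp add: Rn_def)

lemma norm_Rn_nonneg [simp]: "0 \<le> norm_Rn n x"
  by (simp add: norm_Rn_def)

lemma norm_Rn_square: "(norm_Rn n x)\<^sup>2 = (\<Sum>i<n. (x i)\<^sup>2)"
  by (simp add: norm_Rn_def L2_set_def sum_nonneg)

lemma norm_Rn_restrict: "norm_Rn n (\<lambda>i\<in>{..<n}. f i) = norm_Rn n f"
  by (simp add: norm_Rn_def L2_set_def)

lemma norm_add_Rn_le: "norm_Rn n (add_Rn n x y) \<le> norm_Rn n x + norm_Rn n y"
  unfolding norm_Rn_restrict by (simp add: norm_Rn_def L2_set_triangle_ineq)

lemma norm_zero_Rn [simp]: "norm_Rn n (zero_Rn n) = 0"
  by (simp add: norm_Rn_def zero_Rn_def L2_set_def)

lemma space_lborel_Rn [simp]: "space (lborel_Rn n) = Rn n"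
  by (simp add: lborel_Rn_def Rn_def space_PiM)

lemma component_measurable: "i < n \<Longrightarrow> (\<lambda>x. x i) \<in> borel_measurable (lborel_Rn n)"
  unfolding lborel_Rn_def using measurable_component_singleton[of i "{..<n}" "\<lambda>_. lborel"] by simp

lemma translation_measurable: "(\<lambda>x. sub_Rn n x a) \<in> lborel_Rn n \<rightarrow>\<^sub>M lborel_Rn n"
proof -
  have "(\<lambda>x. \<lambda>i\<in>{..<n}. x i - a i) \<in> lborel_Rn n \<rightarrow>\<^sub>M (\<Pi>\<^sub>M i\<in>{..<n}. lborel)"
    by (rule measurable_restrict) (auto intro!: borel_measurable_diff component_measurable)
  thus ?thesis by (simp add: lborel_Rn_def)
qed

text \<open>A product measure is determined by its values on boxes, where invariance reduces to that
  of Lebesgue measure on the line.\<close>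

lemma distr_translation: "distr (lborel_Rn n) (lborel_Rn n) (\<lambda>x. sub_Rn n x a) = lborel_Rn n"
proof -
  interpret product_sigma_finite "\<lambda>_::nat. lborel :: real measure" by standard
  have *: "emeasure lborel ((\<lambda>t. t - c) -` A) = emeasure lborel A" if "A \<in> sets lborel"
    for A and c :: real
  proof -
    have "emeasure lborel A = emeasure (distr lborel borel ((+) (- c))) A"
      by (simp add: lborel_distr_plus)
    also have "\<dots> = emeasure lborel ((\<lambda>t. t - c) -` A)"
      using that by (subst emeasure_distr) (auto intro!: arg_cong[where f="emeasure lborel"])
    finally show ?thesis ..
  qed
  show ?thesis
    unfolding lborel_Rn_def
  proof (rule PiM_eqI)
    fix A :: "nat \<Rightarrow> real set" assume A: "\<And>i. i \<in> {..<n} \<Longrightarrow> A i \<in> sets lborel"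
    have "emeasure (distr (\<Pi>\<^sub>M i\<in>{..<n}. lborel) (\<Pi>\<^sub>M i\<in>{..<n}. lborel) (\<lambda>x. sub_Rn n x a)) (Pi\<^sub>E {..<n} A)
       = emeasure (\<Pi>\<^sub>M i\<in>{..<n}. lborel) ((\<lambda>x. sub_Rn n x a) -` (Pi\<^sub>E {..<n} A) \<inter> space (\<Pi>\<^sub>M i\<in>{..<n}. lborel))"
      using A translation_measurable[where n=n and a=a]
        by (intro emeasure_distr) (auto simp: lborel_Rn_def intro!: sets_PiM_I_finite)
    also have "(\<lambda>x. sub_Rn n x a) -` (Pi\<^sub>E {..<n} A) \<inter> space (\<Pi>\<^sub>M i\<in>{..<n}. lborel)
       = Pi\<^sub>E {..<n} (\<lambda>i. (\<lambda>t. t - a i) -` A i)"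
      by (auto simp: space_PiM PiE_iff)
    also have "emeasure (\<Pi>\<^sub>M i\<in>{..<n}. lborel) \<dots> = (\<Prod>i<n. emeasure lborel ((\<lambda>t. t - a i) -` A i))"
      by (rule emeasure_PiM) (use A in \<open>auto intro!: borel_measurable_diff measurable_sets_borel[where M=borel]\<close>)
    also have "\<dots> = (\<Prod>i<n. emeasure lborel (A i))"
      using A by (intro prod.cong) (simp_all add: * del: sets_lborel)
    finally show "emeasure (distr (\<Pi>\<^sub>M i\<in>{..<n}. lborel) (\<Pi>\<^sub>M i\<in>{..<n}. lborel) (\<lambda>x. sub_Rn n x a)) (Pi\<^sub>E {..<n} A)
       = (\<Prod>i<n. emeasure lborel (A i))" .
  qed auto
qed

lemma translate_sets:
  "{x \<in> Rn n. sub_Rn n x a \<in> S} \<in> sets (lborel_Rn n)" if "S \<in> sets (lborel_Rn n)"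
  using measurable_sets[OF translation_measurable that, of a]
  by (simp add: vimage_def Int_def conj_commute)

lemma emeasure_translate:
  "emeasure (lborel_Rn n) {x \<in> Rn n. sub_Rn n x a \<in> S} = emeasure (lborel_Rn n) S"
  if "S \<in> sets (lborel_Rn n)"
proof -
  have "emeasure (lborel_Rn n) S
      = emeasure (distr (lborel_Rn n) (lborel_Rn n) (\<lambda>x. sub_Rn n x a)) S"
    by (simp only: distr_translation)
  also have "\<dots> = emeasure (lborel_Rn n) {x \<in> Rn n. sub_Rn n x a \<in> S}"
    using that translation_measurable[where n=n and a=a]
    by (subst emeasure_distr) (simp_all add: vimage_def Int_def conj_commute)
  finally show ?thesis ..
qed

lemma emeasure_cball_Rn:
  "emeasure (lborel_Rn n) (cball_Rn n r) = ennreal (unit_ball_vol (real n) * r ^ n)" if "r > 0"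
proof -
  have "cball_Rn n r = {f. sqrt (\<Sum>i\<in>{..<n}. (f i)\<^sup>2) \<le> r} \<inter> space (Pi\<^sub>M {..<n} (\<lambda>_. lborel))"
    by (auto simp: cball_Rn_def Rn_def norm_Rn_def L2_set_def space_PiM)
  thus ?thesis
    using emeasure_cball_aux[of "{..<n}" r] that by (simp add: lborel_Rn_def)
qed

lemma measure_cball_Rn:
  "measure (lborel_Rn n) (cball_Rn n r) = unit_ball_vol (real n) * r ^ n" if "r > 0"
  using emeasure_cball_Rn[OF that, of n] that by (simp add: measure_def)

lemma cball_Rn_sets: "cball_Rn n r \<in> sets (lborel_Rn n)"
proof -
  have "(\<lambda>x. norm_Rn n x) \<in> borel_measurable (lborel_Rn n)"
    unfolding norm_Rn_def L2_set_def
    by (intro measurable_compose[OF _ borel_measurable_continuous_onI[OF continuous_on_real_sqrt[OF continuous_on_id]]]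
        borel_measurable_sum borel_measurable_power component_measurable) auto
  moreover have "cball_Rn n r = (\<lambda>x. norm_Rn n x) -` {..r} \<inter> space (lborel_Rn n)"
    by (auto simp: cball_Rn_def)
  ultimately show ?thesis
    by (metis atMost_borel measurable_sets)
qed

section \<open>Packings, coverings and fundamental regions\<close>

definition covers_Rn :: "nat \<Rightarrow> (nat \<Rightarrow> real) set \<Rightarrow> (nat \<Rightarrow> real) set \<Rightarrow> bool" where
  "covers_Rn n \<Lambda> S \<longleftrightarrow> (\<forall>x\<in>Rn n. \<exists>l\<in>\<Lambda>. sub_Rn n x l \<in> S)"

text \<open>For a group \<Lambda> this means that its translates of \<open>S\<close> are disjoint. A
  fundamental region both packs and covers; treating the two halves separately bounds volumes from
  either side without exhibiting a region.\<close>

definition packs_Rn :: "nat \<Rightarrow> (nat \<Rightarrow> real) set \<Rightarrow> (nat \<Rightarrow> real) set \<Rightarrow> bool" where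
  "packs_Rn n \<Lambda> S \<longleftrightarrow> (\<forall>x\<in>S. \<forall>y\<in>S. sub_Rn n x y \<in> \<Lambda> \<longrightarrow> x = y)"

text \<open>Discreteness is quantified by \<delta>: countability, a measurable choice of
  representatives and the packing by small balls all come from this one bound.\<close>

locale discrete_lattice =
  fixes n :: nat and \<Lambda> :: "(nat \<Rightarrow> real) set" and \<delta> :: real
  assumes subset_Rn: "\<Lambda> \<subseteq> Rn n"
    and zero_mem: "zero_Rn n \<in> \<Lambda>"
    and sub_mem: "x \<in> \<Lambda> \<Longrightarrow> y \<in> \<Lambda> \<Longrightarrow> sub_Rn n x y \<in> \<Lambda>"
    and \<delta>_pos: "\<delta> > 0"
    and norm_ge: "x \<in> \<Lambda> \<Longrightarrow> x \<noteq> zero_Rn n \<Longrightarrow> \<delta> \<le> norm_Rn n x"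
begin

lemma sub_eq_zero_iff: "sub_Rn n x y = zero_Rn n \<longleftrightarrow> x = y" if "x \<in> Rn n" "y \<in> Rn n"
proof
  assume "sub_Rn n x y = zero_Rn n"
  hence e: "sub_Rn n x y i = zero_Rn n i" for i by simp
  have "x i = y i" if "i < n" for i using e[of i] that by (simp add: zero_Rn_def)
  thus "x = y" using that by (intro Rn_eqI[of x n y])
qed (auto simp: zero_Rn_def)

lemma add_mem: "add_Rn n x y \<in> \<Lambda>" if "x \<in> \<Lambda>" "y \<in> \<Lambda>"
proof -
  have "add_Rn n x y = sub_Rn n x (sub_Rn n (zero_Rn n) y)"
    by (auto simp: zero_Rn_def)
  thus ?thesis using that zero_mem sub_mem by presburger
qed

text \<open>Cubes of side \<delta> / (n + 1) have diameter sqrt n * \<delta> / (n + 1) <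
  \<delta>.\<close>

definition grid_scale :: real where "grid_scale = (real n + 1) / \<delta>"

text \<open>The integer vector indexing a cube is encoded as a natural number, so that among the
  cubes met by a class there is a least one.\<close>

definition cell :: "(nat \<Rightarrow> real) \<Rightarrow> nat" where
  "cell x = to_nat (map (\<lambda>i. \<lfloor>grid_scale * x i\<rfloor>) [0..<n])"

lemma cell_inj:
  assumes "x \<in> Rn n" "y \<in> Rn n" "sub_Rn n x y \<in> \<Lambda>" "cell x = cell y"
  shows "x = y"
proof (rule ccontr)
  assume "x \<noteq> y"
  hence "\<delta> \<le> norm_Rn n (sub_Rn n x y)"
    using norm_ge[OF assms(3)] sub_eq_zero_iff[OF assms(1,2)] by blast
  hence "\<delta>\<^sup>2 \<le> (\<Sum>i<n. (x i - y i)\<^sup>2)"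
    using \<delta>_pos by (metis norm_Rn_restrict norm_Rn_square power_mono less_imp_le)
  moreover have "(\<Sum>i<n. (x i - y i)\<^sup>2) < \<delta>\<^sup>2"
  proof (cases "n = 0")
    case False
    have N: "grid_scale > 0" using \<delta>_pos by (simp add: grid_scale_def)
    have "(x i - y i)\<^sup>2 \<le> (1 / grid_scale)\<^sup>2" if "i < n" for i
    proof -
      have "\<lfloor>grid_scale * x i\<rfloor> = \<lfloor>grid_scale * y i\<rfloor>"
        using assms(4) that unfolding cell_def by (auto simp: list_eq_iff_nth_eq)
      hence "\<bar>grid_scale * x i - grid_scale * y i\<bar> \<le> 1" by linarith
      also have "grid_scale * x i - grid_scale * y i = grid_scale * (x i - y i)"
        by (simp add: algebra_simps)
      finally have "grid_scale * \<bar>x i - y i\<bar> \<le> 1" using N by (simp only: abs_mult abs_of_pos)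
      hence "\<bar>x i - y i\<bar> \<le> 1 / grid_scale"
        using N by (simp add: pos_le_divide_eq mult.commute)
      thus ?thesis using power_mono[of "\<bar>x i - y i\<bar>" "1 / grid_scale" 2] by simp
    qed
    hence "(\<Sum>i<n. (x i - y i)\<^sup>2) \<le> real n * (1 / grid_scale)\<^sup>2"
      using sum_bounded_above[of "{..<n}" "\<lambda>i. (x i - y i)\<^sup>2" "(1 / grid_scale)\<^sup>2"] by simp
    also have "\<dots> = \<delta>\<^sup>2 * (real n / (real n + 1)\<^sup>2)"
      by (simp add: grid_scale_def power_divide)
    also have "\<dots> < \<delta>\<^sup>2 * 1"
    proof (intro mult_strict_left_mono)
      have "real n < (real n + 1)\<^sup>2"
        using zero_le_square[of "real n"] unfolding power2_eq_square distrib_left distrib_right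
        by linarith
      thus "real n / (real n + 1)\<^sup>2 < 1" by simp
    qed (use \<delta>_pos in simp)
    finally show ?thesis by simp
  qed (use \<delta>_pos in simp)
  ultimately show False by simp
qed

lemma countable_lattice: "countable \<Lambda>"
proof (rule countableI')
  show "inj_on cell \<Lambda>"
    using cell_inj subset_Rn sub_mem by (intro inj_onI) blast
qed

lemma cell_measurable: "cell \<in> lborel_Rn n \<rightarrow>\<^sub>M count_space UNIV"
proof -
  have "(\<lambda>x. map (\<lambda>i. \<lfloor>grid_scale * x i\<rfloor>) [0..<n]) \<in> lborel_Rn n \<rightarrow>\<^sub>M count_space UNIV"
  proof (subst measurable_count_space_eq2_countable, safe)
    fix L :: "int list"
    show "(\<lambda>x. map (\<lambda>i. \<lfloor>grid_scale * x i\<rfloor>) [0..<n]) -` {L} \<inter> space (lborel_Rn n)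
        \<in> sets (lborel_Rn n)"
    \<comment> \<open>The intersection over all coordinates is taken with
      \<open>sets.sets_Collect_finite_All'\<close>, which asks for a nonempty index set.\<close>
    proof (cases "n = 0")
      case False
    have "(\<lambda>x. map (\<lambda>i. \<lfloor>grid_scale * x i\<rfloor>) [0..<n]) -` {L} \<inter> space (lborel_Rn n) =
       {x \<in> space (lborel_Rn n). length L = n \<and> (\<forall>i\<in>{..<n}. \<lfloor>grid_scale * x i\<rfloor> = L ! i)}"
    proof -
      have "map f [0..<n] = L \<longleftrightarrow> length L = n \<and> (\<forall>i\<in>{..<n}. f i = L ! i)" for f
        unfolding list_eq_iff_nth_eq by auto
      thus ?thesis by (simp add: vimage_def Int_def conj_commute)
    qed
    also have "\<dots> \<in> sets (lborel_Rn n)"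
    proof (intro sets.sets_Collect_conj sets.sets_Collect_const sets.sets_Collect_finite_All')
      fix i assume "i \<in> {..<n}"
      hence [measurable]: "(\<lambda>x. x i) \<in> borel_measurable (lborel_Rn n)"
        by (simp add: component_measurable)
      show "{x \<in> space (lborel_Rn n). \<lfloor>grid_scale * x i\<rfloor> = L ! i} \<in> sets (lborel_Rn n)"
        by measurable
    qed (use False in auto)
    finally show ?thesis .
    qed (cases "L = []", auto simp flip: space_lborel_Rn)
  qed auto
  thus ?thesis unfolding cell_def by measurable
qed

text \<open>
  Choose in every class the point of \<open>S\<close> in the first possible cell of a grid that is so fine that no
  cell contains two points of a class.
\<close>

lemma fundamental_region_in_covering:
  assumes S: "S \<in> sets (lborel_Rn n)" and cov: "covers_Rn n \<Lambda> S"
  obtains D where "fundamental_region n \<Lambda> D" "D \<subseteq> S"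
proof -
  define D where "D = {x \<in> Rn n. x \<in> S \<and> (\<forall>l\<in>\<Lambda>. sub_Rn n x l \<in> S \<longrightarrow> cell x \<le> cell (sub_Rn n x l))}"
  have "D \<in> sets (lborel_Rn n)"
  proof -
    have [measurable]: "cell \<in> lborel_Rn n \<rightarrow>\<^sub>M count_space UNIV" "(\<lambda>x. sub_Rn n x a)
        \<in> lborel_Rn n \<rightarrow>\<^sub>M lborel_Rn n" for a
      by (rule cell_measurable translation_measurable)+
    have "{x \<in> space (lborel_Rn n). x \<in> S \<and> (\<forall>l\<in>\<Lambda>. sub_Rn n x l \<in> S \<longrightarrow> cell x
        \<le> cell (sub_Rn n x l))} \<in> sets (lborel_Rn n)"
    proof (intro sets.sets_Collect_conj sets.sets_Collect_countable_All' countable_lattice)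
      show "{x \<in> space (lborel_Rn n). sub_Rn n x l \<in> S \<longrightarrow> cell x \<le> cell (sub_Rn n x l)}
          \<in> sets (lborel_Rn n)" for l
        using S by measurable
      show "{x \<in> space (lborel_Rn n). x \<in> S} \<in> sets (lborel_Rn n)"
        using S by measurable
    qed
    thus ?thesis by (simp add: D_def)
  qed
  moreover have "\<exists>!l. l \<in> \<Lambda> \<and> sub_Rn n x l \<in> D" if x: "x \<in> Rn n" for x
  proof -
    obtain l0 where "l0 \<in> \<Lambda> \<and> sub_Rn n x l0 \<in> S" using cov x by (auto simp: covers_Rn_def)
    then obtain l where l: "l \<in> \<Lambda>" "sub_Rn n x l \<in> S"
      and lm: "\<And>l'. l' \<in> \<Lambda> \<Longrightarrow> sub_Rn n x l' \<in> S \<Longrightarrow> cell (sub_Rn n x l) \<le> cell (sub_Rn n x l')"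
      using ex_has_least_nat[of "\<lambda>l. l \<in> \<Lambda> \<and> sub_Rn n x l \<in> S" l0 "\<lambda>l. cell (sub_Rn n x l)"]
        by blast
    have shift: "sub_Rn n (sub_Rn n x a) b = sub_Rn n x (add_Rn n a b)" for a b
      by (rule Rn_eqI[of _ n]) auto
    have "sub_Rn n x l \<in> D"
      unfolding D_def mem_Collect_eq shift using lm[OF add_mem[OF l(1)]] l(2)
      by (blast intro: restrict_in_Rn)
    moreover have "l' = l" if l': "l' \<in> \<Lambda>" "sub_Rn n x l' \<in> D" for l'
    proof -
      \<comment> \<open>Uniqueness: each of the two representatives is a lattice translate of the
        other, so neither cell is larger, and equal cells force equal points by
        \<open>cell_inj\<close>.\<close>
      have e: "sub_Rn n x l = sub_Rn n (sub_Rn n x l') (sub_Rn n l l')" by auto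
      have "sub_Rn n (sub_Rn n x l') (sub_Rn n l l') \<in> S" using l(2) by (subst e[symmetric])
      hence "cell (sub_Rn n x l') \<le> cell (sub_Rn n (sub_Rn n x l') (sub_Rn n l l'))"
        using l'(2) sub_mem[OF l(1) l'(1)] unfolding D_def by blast
      hence "cell (sub_Rn n x l') \<le> cell (sub_Rn n x l)" by (subst (asm) e[symmetric])
      moreover have "cell (sub_Rn n x l) \<le> cell (sub_Rn n x l')"
        using lm l' by (simp add: D_def)
      moreover have "sub_Rn n (sub_Rn n x l') (sub_Rn n x l) = sub_Rn n l l'" by auto
      ultimately have "sub_Rn n x l' = sub_Rn n x l"
        using cell_inj[of "sub_Rn n x l'" "sub_Rn n x l"] sub_mem[OF l(1) l'(1)] by simp
      hence "\<forall>i<n. l' i = l i"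
        by (metis (no_types, lifting) diff_left_imp_eq lessThan_iff restrict_apply')
      thus ?thesis using l l' subset_Rn by (intro Rn_eqI[of l' n l]) auto
    qed
    ultimately show ?thesis using l by blast
  qed
  ultimately have "fundamental_region n \<Lambda> D" by (simp add: fundamental_region_def)
  thus thesis using that[of D] by (auto simp: D_def)
qed

text \<open>If \<open>x\<close> and \<open>y\<close> in \<open>D\<close> differ by a lattice vector,
  then subtracting 0 and subtracting x - y both leave \<open>x\<close> in \<open>D\<close>, and
  uniqueness gives x - y = 0.\<close>

lemma fundamental_region_packs: "packs_Rn n \<Lambda> D" if "fundamental_region n \<Lambda> D"
  unfolding packs_Rn_def
proof (intro ballI impI)
  fix x y assume xy: "x \<in> D" "y \<in> D" "sub_Rn n x y \<in> \<Lambda>"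
  have D: "D \<subseteq> Rn n"
    using that sets.sets_into_space[of D "lborel_Rn n"] by (simp add: fundamental_region_def)
  have "x = sub_Rn n x (zero_Rn n)" "y = sub_Rn n x (sub_Rn n x y)"
    using D xy by (auto intro!: Rn_eqI simp: zero_Rn_def)
  hence "sub_Rn n x y = zero_Rn n"
    using that xy zero_mem D unfolding fundamental_region_def by (metis subsetD)
  thus "x = y" using sub_eq_zero_iff D xy by blast
qed

text \<open>Cut \<open>S\<close> along the translates of \<open>D\<close> and move each piece back
  into \<open>D\<close>. The moved pieces stay disjoint because \<open>S\<close> packs, and
  countable additivity compares the volumes.\<close>

lemma emeasure_packs_le_fundamental_region:
  assumes S: "S \<in> sets (lborel_Rn n)" "packs_Rn n \<Lambda> S" and D: "fundamental_region n \<Lambda> D"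
  shows "emeasure (lborel_Rn n) S \<le> emeasure (lborel_Rn n) D"
proof -
  have SR: "S \<subseteq> Rn n" using S(1) sets.sets_into_space by force
  have Ds: "D \<in> sets (lborel_Rn n)" and Du: "\<And>x. x \<in> Rn n \<Longrightarrow> \<exists>!l. l \<in> \<Lambda> \<and> sub_Rn n x l \<in> D"
    using D by (auto simp: fundamental_region_def)
  define A where "A l = S \<inter> {x \<in> Rn n. sub_Rn n x l \<in> D}" for l
  \<comment> \<open>\<open>sub_Rn n (zero_Rn n) l\<close> is -l, so \<open>B l\<close> is the piece
    \<open>A l\<close> shifted by -l into \<open>D\<close>.\<close>
  define B where "B l = D \<inter> {x \<in> Rn n. sub_Rn n x (sub_Rn n (zero_Rn n) l) \<in> S}" for l
  have As: "A l \<in> sets (lborel_Rn n)" for l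
    unfolding A_def using S Ds translate_sets by blast
  have Bs: "B l \<in> sets (lborel_Rn n)" for l
    unfolding B_def using S Ds translate_sets by blast
  have disjA: "disjoint_family_on A \<Lambda>"
    unfolding disjoint_family_on_def A_def using Du by blast
  have disjB: "disjoint_family_on B \<Lambda>"
    unfolding disjoint_family_on_def
  proof (intro ballI impI, rule ccontr)
    fix l l' assume l: "l \<in> \<Lambda>" "l' \<in> \<Lambda>" "l \<noteq> l'" "B l \<inter> B l' \<noteq> {}"
    then obtain y
      where y: "sub_Rn n y (sub_Rn n (zero_Rn n) l) \<in> S" "sub_Rn n y (sub_Rn n (zero_Rn n) l') \<in> S"
      by (auto simp: B_def)
    have "sub_Rn n (sub_Rn n y (sub_Rn n (zero_Rn n) l)) (sub_Rn n y (sub_Rn n (zero_Rn n) l'))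
        = sub_Rn n l l'"
      by (auto simp: zero_Rn_def)
    hence "sub_Rn n y (sub_Rn n (zero_Rn n) l) = sub_Rn n y (sub_Rn n (zero_Rn n) l')"
      using S(2)[unfolded packs_Rn_def, rule_format, OF y] sub_mem[OF l(1,2)] by simp
    hence "\<forall>i<n. l i = l' i"
      by (metis (no_types, lifting) diff_left_imp_eq lessThan_iff restrict_apply')
    hence "l = l'" using l subset_Rn by (intro Rn_eqI[of l n l']) auto
    thus False using l by simp
  qed
  have AB: "emeasure (lborel_Rn n) (A l) = emeasure (lborel_Rn n) (B l)" if "l \<in> \<Lambda>" for l
  proof -
    have "A l = {x \<in> Rn n. sub_Rn n x l \<in> B l}"
    proof -
      have "sub_Rn n (sub_Rn n x l) (sub_Rn n (zero_Rn n) l) = x" if "x \<in> Rn n" for x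
        using that by (intro Rn_eqI[of _ n]) (auto simp: zero_Rn_def)
      thus ?thesis using SR by (auto simp: A_def B_def)
    qed
    thus ?thesis using emeasure_translate[OF Bs] by simp
  qed
  have "S = (\<Union>l\<in>\<Lambda>. A l)"
  proof (intro equalityI subsetI)
    fix x assume x: "x \<in> S"
    then obtain l where "l \<in> \<Lambda>" "sub_Rn n x l \<in> D" using Du SR by (meson subsetD)
    thus "x \<in> (\<Union>l\<in>\<Lambda>. A l)" using x SR by (auto simp: A_def)
  qed (auto simp: A_def)
  hence "emeasure (lborel_Rn n) S = (\<integral>\<^sup>+l. emeasure (lborel_Rn n) (A l) \<partial>count_space \<Lambda>)"
    using emeasure_UN_countable[OF As countable_lattice disjA] by simp
  also have "\<dots> = (\<integral>\<^sup>+l. emeasure (lborel_Rn n) (B l) \<partial>count_space \<Lambda>)"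
    by (intro nn_integral_cong) (simp add: AB)
  also have "\<dots> = emeasure (lborel_Rn n) (\<Union>l\<in>\<Lambda>. B l)"
    using emeasure_UN_countable[OF Bs countable_lattice disjB] by simp
  also have "\<dots> \<le> emeasure (lborel_Rn n) D"
    using Ds by (intro emeasure_mono) (auto simp: B_def)
  finally show ?thesis .
qed

lemma emeasure_packs_le_covers:
  assumes "S \<in> sets (lborel_Rn n)" "packs_Rn n \<Lambda> S"
    and "T \<in> sets (lborel_Rn n)" "covers_Rn n \<Lambda> T"
  shows "emeasure (lborel_Rn n) S \<le> emeasure (lborel_Rn n) T"
proof -
  obtain D where "fundamental_region n \<Lambda> D" "D \<subseteq> T"
    using fundamental_region_in_covering assms by blast
  thus ?thesis
    using emeasure_packs_le_fundamental_region assms by (meson emeasure_mono order_trans)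
qed

text \<open>Two fundamental regions both pack, so each is at most as large as the other. This makes
  the definite description in \<open>lattice_Vol\<close> legitimate.\<close>

lemma lattice_Vol_eq: "lattice_Vol n \<Lambda> = measure (lborel_Rn n) D" if D: "fundamental_region n \<Lambda> D"
  unfolding lattice_Vol_def
proof (rule the_equality)
  fix v assume "\<exists>D'. fundamental_region n \<Lambda> D' \<and> v = measure (lborel_Rn n) D'"
  then obtain D' where D': "fundamental_region n \<Lambda> D'" "v = measure (lborel_Rn n) D'" by blast
  have "emeasure (lborel_Rn n) D' = emeasure (lborel_Rn n) D"
    using emeasure_packs_le_fundamental_region fundamental_region_packs D D'
    by (metis fundamental_region_def order_antisym)
  thus "v = measure (lborel_Rn n) D" by (simp add: D' measure_def)
qed (use D in blast)

lemma cball_packs: "packs_Rn n \<Lambda> (cball_Rn n s)" if "2 * s < \<delta>"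
  unfolding packs_Rn_def
proof (intro ballI impI)
  fix x y assume xy: "x \<in> cball_Rn n s" "y \<in> cball_Rn n s" "sub_Rn n x y \<in> \<Lambda>"
  have "norm_Rn n (sub_Rn n x y) \<le> norm_Rn n x + norm_Rn n y"
    using norm_add_Rn_le[of n x "\<lambda>i. - y i"] by (simp add: norm_Rn_def L2_set_def)
  also have "\<dots> < \<delta>" using xy that by (simp add: cball_Rn_def)
  finally show "x = y"
    using norm_ge[OF xy(3)] sub_eq_zero_iff[of x y] xy by (force simp: cball_Rn_def)
qed

end

section \<open>Sublattices and finite unions of translates\<close>

lemma emeasure_finite_translates:
  assumes "D \<in> sets (lborel_Rn n)" "packs_Rn n \<Lambda> D" "finite F" "F \<subseteq> Rn n"
    and "\<And>l l'. l \<in> F \<Longrightarrow> l' \<in> F \<Longrightarrow> sub_Rn n l l' \<in> \<Lambda>"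
  shows "emeasure (lborel_Rn n) (\<Union>l\<in>F. {x \<in> Rn n. sub_Rn n x l \<in> D})
      = of_nat (card F) * emeasure (lborel_Rn n) D"
proof -
  have "disjoint_family_on (\<lambda>l. {x \<in> Rn n. sub_Rn n x l \<in> D}) F"
    unfolding disjoint_family_on_def
  proof (intro ballI impI, rule ccontr)
    fix l l' assume l: "l \<in> F" "l' \<in> F" "l \<noteq> l'"
      "{x \<in> Rn n. sub_Rn n x l \<in> D} \<inter> {x \<in> Rn n. sub_Rn n x l' \<in> D} \<noteq> {}"
    then obtain x where x: "sub_Rn n x l \<in> D" "sub_Rn n x l' \<in> D" by blast
    moreover have "sub_Rn n (sub_Rn n x l) (sub_Rn n x l') = sub_Rn n l' l" by auto
    ultimately have "sub_Rn n x l = sub_Rn n x l'"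
      using assms(2)[unfolded packs_Rn_def, rule_format, OF x] assms(5)[OF l(2,1)] by simp
    hence "\<forall>i<n. l i = l' i"
      by (metis (no_types, lifting) diff_left_imp_eq lessThan_iff restrict_apply')
    hence "l = l'" using l assms(4) by (intro Rn_eqI[of l n l']) auto
    thus False using l by simp
  qed
  hence "emeasure (lborel_Rn n) (\<Union>l\<in>F. {x \<in> Rn n. sub_Rn n x l \<in> D}) =
     (\<Sum>l\<in>F. emeasure (lborel_Rn n) {x \<in> Rn n. sub_Rn n x l \<in> D})"
    using assms translate_sets by (intro sum_emeasure[symmetric]) auto
  also have "\<dots> = of_nat (card F) * emeasure (lborel_Rn n) D"
    by (simp add: emeasure_translate[OF assms(1)])
  finally show ?thesis .
qed

text \<open>Together with \<open>finite_translates_cover\<close> this takes the place of the index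
  formula for volumes: pairwise inequivalent vectors bound the volume of the sublattice from below,
  representatives of all classes bound it from above.\<close>

lemma finite_translates_pack:
  assumes "packs_Rn n \<Lambda> D" "discrete_lattice n \<Lambda> \<delta>" "\<Lambda>' \<subseteq> \<Lambda>" "F \<subseteq> \<Lambda>"
    and F: "\<And>l l'. l \<in> F \<Longrightarrow> l' \<in> F \<Longrightarrow> sub_Rn n l l' \<in> \<Lambda>' \<Longrightarrow> l = l'"
  shows "packs_Rn n \<Lambda>' (\<Union>l\<in>F. {x \<in> Rn n. sub_Rn n x l \<in> D})"
  unfolding packs_Rn_def
proof (intro ballI impI)
  interpret discrete_lattice n \<Lambda> \<delta> by fact
  fix x y assume "x \<in> (\<Union>l\<in>F. {x \<in> Rn n. sub_Rn n x l \<in> D})" "y \<in> (\<Union>l\<in>F. {x \<in> Rn n. sub_Rn n x l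
      \<in> D})"
    and xy: "sub_Rn n x y \<in> \<Lambda>'"
  then obtain l l'
    where l: "l \<in> F" "l' \<in> F" "x \<in> Rn n" "y \<in> Rn n" "sub_Rn n x l \<in> D" "sub_Rn n y l' \<in> D"
    by blast
  have e: "sub_Rn n (sub_Rn n x l) (sub_Rn n y l') = sub_Rn n (sub_Rn n x y) (sub_Rn n l l')"
    by (rule Rn_eqI[of _ n]) auto
  have "sub_Rn n x y \<in> \<Lambda>" "l \<in> \<Lambda>" "l' \<in> \<Lambda>" using xy l assms(3,4) by blast+
  hence "sub_Rn n (sub_Rn n x y) (sub_Rn n l l') \<in> \<Lambda>" by (rule sub_mem[OF _ sub_mem])
  hence eq: "sub_Rn n x l = sub_Rn n y l'"
    using assms(1)[unfolded packs_Rn_def, rule_format, OF l(5,6)] by (simp only: e)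
  have c: "x i - l i = y i - l' i" if "i < n" for i
    using fun_cong[OF eq, of i] that by simp
  have "sub_Rn n l l' = sub_Rn n x y"
    by (rule Rn_eqI[of _ n]) (use c in \<open>auto simp: algebra_simps\<close>)
  hence "l = l'" using F[OF l(1,2)] xy by simp
  thus "x = y" using c l by (intro Rn_eqI[of x n y]) auto
qed

lemma finite_translates_cover:
  assumes "covers_Rn n \<Lambda> D"
    and F: "\<And>l. l \<in> \<Lambda> \<Longrightarrow> \<exists>l'\<in>F. sub_Rn n l l' \<in> \<Lambda>'"
  shows "covers_Rn n \<Lambda>' (\<Union>l\<in>F. {x \<in> Rn n. sub_Rn n x l \<in> D})"
  unfolding covers_Rn_def
proof
  fix x assume x: "x \<in> Rn n"
  then obtain l where l: "l \<in> \<Lambda>" "sub_Rn n x l \<in> D" using assms(1) by (auto simp: covers_Rn_def)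
  obtain l' where l': "l' \<in> F" "sub_Rn n l l' \<in> \<Lambda>'" using F[OF l(1)] by blast
  have "sub_Rn n (sub_Rn n x (sub_Rn n l l')) l' = sub_Rn n x l"
    by (rule Rn_eqI[of _ n]) auto
  thus "\<exists>k\<in>\<Lambda>'. sub_Rn n x k \<in> (\<Union>l\<in>F. {x \<in> Rn n. sub_Rn n x l \<in> D})"
    using l(2) l'
      by (intro bexI[OF _ l'(2)] UN_I[OF l'(1)] CollectI conjI restrict_in_Rn) (simp only:)
qed

section \<open>Counting lattice points in balls, and the minimum\<close>

context discrete_lattice
begin

text \<open>The translates of \<open>D\<close> by the points of \<open>F\<close> are disjoint and
  stay in the ball of radius r + \<tau>.\<close>

lemma count_in_cball:
  assumes D: "D \<in> sets (lborel_Rn n)" "packs_Rn n \<Lambda> D" "D \<subseteq> cball_Rn n \<tau>"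
    and F: "finite F" "F \<subseteq> \<Lambda>" "F \<subseteq> cball_Rn n r" and pos: "r + \<tau> > 0"
  shows "real (card F) * measure (lborel_Rn n) D \<le> unit_ball_vol (real n) * (r + \<tau>) ^ n"
proof -
  have "of_nat (card F) * emeasure (lborel_Rn n) D
      = emeasure (lborel_Rn n) (\<Union>l\<in>F. {x \<in> Rn n. sub_Rn n x l \<in> D})"
    using F D subset_Rn sub_mem by (intro emeasure_finite_translates[symmetric, of D n \<Lambda>]) blast+
  also have "\<dots> \<le> emeasure (lborel_Rn n) (cball_Rn n (r + \<tau>))"
  proof (rule emeasure_mono[OF _ cball_Rn_sets], safe)
    fix x l assume l: "l \<in> F" "x \<in> Rn n" "sub_Rn n x l \<in> D"
    have "x = add_Rn n l (sub_Rn n x l)" by (rule Rn_eqI[of _ n]) (use l in auto)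
    hence "norm_Rn n x \<le> norm_Rn n l + norm_Rn n (sub_Rn n x l)" by (metis norm_add_Rn_le)
    also have "\<dots> \<le> r + \<tau>"
      using l(1,3) F(3) D(3) unfolding cball_Rn_def by (intro add_mono) auto
    finally show "x \<in> cball_Rn n (r + \<tau>)" using l by (simp add: cball_Rn_def)
  qed
  also have "\<dots> = ennreal (unit_ball_vol (real n) * (r + \<tau>) ^ n)" by (rule emeasure_cball_Rn[OF pos])
  finally have le: "of_nat (card F) * emeasure (lborel_Rn n) D
      \<le> ennreal (unit_ball_vol (real n) * (r + \<tau>) ^ n)" .
  show ?thesis
  \<comment> \<open>That \<open>D\<close> has finite measure is read off from \<open>le\<close>,
    which says something about \<open>D\<close> only if \<open>F\<close> is nonempty.\<close>
  proof (cases "card F = 0")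
    case False
    have "emeasure (lborel_Rn n) D \<noteq> \<infinity>"
    proof
      assume "emeasure (lborel_Rn n) D = \<infinity>"
      hence "of_nat (card F) * emeasure (lborel_Rn n) D = \<infinity>" using False
        by (simp add: ennreal_mult_eq_top_iff)
      thus False using le by (simp add: top_unique)
    qed
    hence "emeasure (lborel_Rn n) D = ennreal (measure (lborel_Rn n) D)"
      by (simp add: emeasure_eq_ennreal_measure)
    hence "ennreal (real (card F) * measure (lborel_Rn n) D)
        \<le> ennreal (unit_ball_vol (real n) * (r + \<tau>) ^ n)"
      using le by (simp add: ennreal_mult ennreal_of_nat_eq_real_of_nat)
    thus ?thesis using pos by (subst (asm) ennreal_le_iff) (auto intro!: mult_nonneg_nonneg)
  qed (use pos in simp)
qed

lemma finite_in_cball: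
  assumes D: "D
      \<in> sets (lborel_Rn n)" "packs_Rn n \<Lambda> D" "D \<subseteq> cball_Rn n \<tau>" "measure (lborel_Rn n) D > 0"
    and pos: "r + \<tau> > 0"
  shows "finite (\<Lambda> \<inter> cball_Rn n r)"
proof (rule conjunct1[OF finite_if_finite_subsets_card_bdd])
  fix F assume F: "F \<subseteq> \<Lambda> \<inter> cball_Rn n r" "finite F"
  have "real (card F) * measure (lborel_Rn n) D \<le> unit_ball_vol (real n) * (r + \<tau>) ^ n"
    using count_in_cball[OF D(1-3) F(2) _ _ pos] F by simp
  hence "real (card F) \<le> unit_ball_vol (real n) * (r + \<tau>) ^ n / measure (lborel_Rn n) D"
    using D(4) by (simp add: field_simps)
  thus "card F \<le> nat \<lceil>unit_ball_vol (real n) * (r + \<tau>) ^ n / measure (lborel_Rn n) D\<rceil>"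
    by linarith
qed

text \<open>\<open>LEAST\<close> on the reals is meaningful only if a minimum is attained. The
  finitely many lattice vectors no longer than \<open>v0\<close> provide one, and so the strict
  bound passes to the minimum.\<close>

lemma lattice_min_gt:
  assumes fin: "\<And>\<rho>. finite (\<Lambda> \<inter> cball_Rn n \<rho>)" and v0: "v0 \<in> \<Lambda>" "v0 \<noteq> zero_Rn n"
    and r: "\<And>v. v \<in> \<Lambda> \<Longrightarrow> v \<noteq> zero_Rn n \<Longrightarrow> norm_Rn n v > r"
  shows "lattice_min n \<Lambda> > r"
proof -
  define N where "N = norm_Rn n ` ((\<Lambda> \<inter> cball_Rn n (norm_Rn n v0)) - {zero_Rn n})"
  have N: "finite N" unfolding N_def using fin by blast
  have "norm_Rn n v0 \<in> N" using v0 subset_Rn by (auto simp: N_def cball_Rn_def)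
  hence min: "Min N \<in> N" "Min N \<le> norm_Rn n v0" using N Min_in[OF N] Min_le[OF N] by blast+
  have "lattice_min n \<Lambda> = Min N"
    unfolding lattice_min_def
  proof (rule Least_equality)
    show "Min N \<in> norm_Rn n ` (\<Lambda> - {zero_Rn n})" using min(1) by (auto simp: N_def)
    fix y assume "y \<in> norm_Rn n ` (\<Lambda> - {zero_Rn n})"
    then obtain v where v: "v \<in> \<Lambda>" "v \<noteq> zero_Rn n" "y = norm_Rn n v" by blast
    show "Min N \<le> y"
    proof (cases "y \<le> norm_Rn n v0")
      case True
      hence "y \<in> N" using v subset_Rn by (auto simp: N_def cball_Rn_def)
      thus ?thesis using N by simp
    qed (use min(2) in linarith)
  qed
  moreover obtain v where "v \<in> \<Lambda>" "v \<noteq> zero_Rn n" "Min N = norm_Rn n v"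
    using min(1) unfolding N_def by blast
  ultimately show ?thesis using r by metis
qed

end

text \<open>Rounding up or down at random, without bias, has at most this error on average.\<close>

lemma rounding_error:
  fixes e :: "'i \<Rightarrow> nat \<Rightarrow> real" and a :: "'i \<Rightarrow> real" and w :: "nat \<Rightarrow> real"
  assumes "finite I" and "\<And>i. i \<in> I \<Longrightarrow> (\<Sum>j<n. (e i j)\<^sup>2) \<le> E"
  shows "\<exists>k :: 'i \<Rightarrow> int. (\<Sum>j<n. (w j + (\<Sum>i\<in>I. (a i - of_int (k i)) * e i j))\<^sup>2)
            \<le> (\<Sum>j<n. (w j)\<^sup>2) + real (card I) * (E / 4)"
  using assms
proof (induction arbitrary: w)
  case (insert b I)
  define t where "t = frac (a b)"
  have t: "0 \<le> t" "t \<le> 1" by (simp_all add: t_def frac_ge_0 less_imp_le frac_lt_1)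
  define S where "S s = (\<Sum>j<n. (w j + s * e b j)\<^sup>2)" for s
  define W where "W = (\<Sum>j<n. (w j)\<^sup>2)"
  define F where "F = (\<Sum>j<n. (e b j)\<^sup>2)"
  define X where "X = (\<Sum>j<n. w j * e b j)"
  have S: "S s = W + 2 * s * X + s\<^sup>2 * F" for s
    unfolding S_def W_def X_def F_def
    by (simp add: power2_eq_square algebra_simps sum.distrib sum_distrib_left)
  have F: "F \<le> E" "0 \<le> F" using insert.prems by (auto simp: F_def sum_nonneg)
  \<comment> \<open>\<open>S t\<close> is the cost of rounding \<open>a b\<close> down and
    \<open>S (t - 1)\<close> that of rounding it up. With weights 1 - t and t the cross term
    \<open>X\<close> cancels, and the variance t (1 - t) is at most 1/4.\<close>
  have "(1 - t) * S t + t * S (t - 1) = W + t * (1 - t) * F"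
    unfolding S by (simp add: algebra_simps power2_eq_square)
  also have "t * (1 - t) \<le> 1 / 4"
    using zero_le_power2[of "t - 1/2"] by (simp add: power2_eq_square algebra_simps)
  hence "t * (1 - t) * F \<le> 1 / 4 * E" using F t by (intro mult_mono) auto
  finally have avg: "(1 - t) * S t + t * S (t - 1) \<le> W + E / 4" by simp
  have "\<exists>z::int. S (a b - z) \<le> W + E / 4"
  proof (rule ccontr)
    assume neg: "\<not> ?thesis"
    have "S t > W + E / 4" "S (t - 1) > W + E / 4"
      using neg[unfolded not_ex not_le, rule_format, of "\<lfloor>a b\<rfloor>"]
        neg[unfolded not_ex not_le, rule_format, of "\<lfloor>a b\<rfloor> + 1"]
      by (simp_all add: t_def frac_def algebra_simps)
    hence "(1 - t) * S t + t * S (t - 1) > W + E / 4"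
      using t convex_bound_lt[of "- S t" "- (W + E/4)" "- S (t - 1)" "1 - t" t]
      by (simp add: algebra_simps)
    thus False using avg by simp
  qed
  then obtain z :: int where z: "S (a b - z) \<le> W + E / 4" by blast
  obtain k :: "'i \<Rightarrow> int"
    where k: "(\<Sum>j<n. ((w j + (a b - z) * e b j) + (\<Sum>i\<in>I. (a i - of_int (k i)) * e i j))\<^sup>2)
            \<le> S (a b - z) + real (card I) * (E / 4)"
    using insert.IH[of "\<lambda>j. w j + (a b - z) * e b j"] insert.prems unfolding S_def by auto
  define k' where "k' = k(b := z)"
  have "(\<Sum>i\<in>I. (a i - of_int (k' i)) * e i j) = (\<Sum>i\<in>I. (a i - of_int (k i)) * e i j)" for j
    using insert.hyps by (intro sum.cong) (auto simp: k'_def)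
  hence "(\<Sum>j<n. (w j + (\<Sum>i\<in>insert b I. (a i - of_int (k' i)) * e i j))\<^sup>2)
      \<le> S (a b - z) + real (card I) * (E / 4)"
    using k insert.hyps by (simp add: k'_def add.assoc)
  also have "\<dots> \<le> W + real (card (insert b I)) * (E / 4)"
    using z insert.hyps by (simp add: algebra_simps add_divide_distrib)
  finally show ?case unfolding W_def by blast
qed auto

section \<open>Evaluation of integer and rational polynomials at complex numbers\<close>

abbreviation ipoly :: "int poly \<Rightarrow> complex \<Rightarrow> complex" where
  "ipoly p x \<equiv> poly (map_poly of_int p) x"

abbreviation rpoly :: "rat poly \<Rightarrow> complex \<Rightarrow> complex" where
  "rpoly p x \<equiv> poly (map_poly of_rat p) x"

lemma ipoly_0 [simp]: "ipoly 0 x = 0"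
  and ipoly_1 [simp]: "ipoly 1 x = 1"
  and ipoly_add [simp]: "ipoly (p + q) x = ipoly p x + ipoly q x"
  and ipoly_diff [simp]: "ipoly (p - q) x = ipoly p x - ipoly q x"
  and ipoly_pCons [simp]: "ipoly (pCons a p) x = of_int a + x * ipoly p x"
  and ipoly_smult [simp]: "ipoly (smult a p) x = of_int a * ipoly p x"
proof -
  have "map_poly of_int (p + q) = map_poly of_int p + (map_poly of_int q :: complex poly)"
       "map_poly of_int (p - q) = map_poly of_int p - (map_poly of_int q :: complex poly)"
       "map_poly of_int (smult a p) = smult (of_int a) (map_poly of_int p :: complex poly)"
    by (auto intro!: poly_eqI simp: coeff_map_poly)
  thus "ipoly (p + q) x = ipoly p x + ipoly q x" "ipoly (p - q) x = ipoly p x - ipoly q x"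
    "ipoly (smult a p) x = of_int a * ipoly p x"
    by simp_all
qed (simp_all add: map_poly_pCons)

lemma ipoly_mult [simp]: "ipoly (p * q) x = ipoly p x * ipoly q x"
  by (induction p) (simp_all add: algebra_simps)

lemma ipoly_monom [simp]: "ipoly (monom a k) x = of_int a * x ^ k"
  by (simp add: map_poly_monom poly_monom)

lemma ipoly_pcompose [simp]: "ipoly (pcompose p q) x = ipoly p (ipoly q x)"
  by (induction p) (simp_all add: pcompose_pCons)

lemma rpoly_0 [simp]: "rpoly 0 x = 0"
  and rpoly_add [simp]: "rpoly (p + q) x = rpoly p x + rpoly q x"
  and rpoly_diff [simp]: "rpoly (p - q) x = rpoly p x - rpoly q x"
  and rpoly_pCons [simp]: "rpoly (pCons a p) x = of_rat a + x * rpoly p x"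
  and rpoly_smult [simp]: "rpoly (smult a p) x = of_rat a * rpoly p x"
proof -
  have "map_poly of_rat (p + q) = map_poly of_rat p + (map_poly of_rat q :: complex poly)"
       "map_poly of_rat (p - q) = map_poly of_rat p - (map_poly of_rat q :: complex poly)"
       "map_poly of_rat (smult a p) = smult (of_rat a) (map_poly of_rat p :: complex poly)"
    by (auto intro!: poly_eqI simp: coeff_map_poly of_rat_add of_rat_diff of_rat_mult)
  thus "rpoly (p + q) x = rpoly p x + rpoly q x" "rpoly (p - q) x = rpoly p x - rpoly q x"
    "rpoly (smult a p) x = of_rat a * rpoly p x"
    by simp_all
qed (simp_all add: map_poly_pCons)

lemma rpoly_mult [simp]: "rpoly (p * q) x = rpoly p x * rpoly q x"
  by (induction p) (simp_all add: algebra_simps)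

lemma rpoly_monom [simp]: "rpoly (monom a k) x = of_rat a * x ^ k"
  by (simp add: map_poly_monom poly_monom)

lemma rpoly_pcompose [simp]: "rpoly (pcompose p q) x = rpoly p (rpoly q x)"
  by (induction p) (simp_all add: pcompose_pCons)

lemma cnj_rpoly: "cnj (rpoly p x) = rpoly p (cnj x)"
  by (induction p) (simp_all add: cnj_of_rat)

lemma rat_poly_clear_denominators:
  obtains N :: int and g where "N > 0" "\<And>x. of_int N * rpoly p x = ipoly g x"
proof -
  have "\<exists>N g. N > (0::int) \<and> (\<forall>x. of_int N * rpoly p x = ipoly g x)"
  proof (induction p)
    case (pCons a p)
    then obtain N g where Ng: "N > (0::int)" "\<And>x. of_int N * rpoly p x = ipoly g x" by blast
    obtain b c where q: "quotient_of a = (b, c)" by (cases "quotient_of a")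
    have c: "c > 0" "a = of_int b / of_int c"
      using quotient_of_denom_pos[OF q] quotient_of_div[OF q] by auto
    show ?case
    proof (intro exI conjI allI)
      show "N * c > 0" using c Ng by simp
      fix x :: complex
      have "of_int (N * c) * rpoly (pCons a p) x
          = of_int N * of_int b + of_int c * x * (of_int N * rpoly p x)"
        using c(1) unfolding c(2) by (simp add: of_rat_divide field_simps)
      also have "\<dots> = ipoly (pCons (N * b) (smult c g)) x"
        using Ng by simp
      finally show "of_int (N * c) * rpoly (pCons a p) x = ipoly (pCons (N * b) (smult c g)) x" .
    qed
  next
    case 0
    show ?case by (rule exI[of _ 1], rule exI[of _ 0]) simp
  qed
  thus thesis using that by blast
qed

section \<open>Minimal polynomials of roots of unity\<close>

text \<open>Gauss's lemma: \<open>f\<close> is the primitive part of an annihilating polynomial of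
  least degree. Pseudo-division gives a g = f q, and since \<open>f\<close> has content 1,
  \<open>a\<close> divides the content of \<open>q\<close> and cancels.\<close>

lemma min_int_poly_exists:
  fixes z :: complex
  assumes "h0 \<noteq> 0" "ipoly h0 z = 0"
  obtains f where "f \<noteq> 0" "ipoly f z = 0" "\<And>g. ipoly g z = 0 \<Longrightarrow> f dvd g"
proof -
  obtain h where h: "h \<noteq> 0" "ipoly h z = 0"
    and hmin: "\<And>g. g \<noteq> 0 \<Longrightarrow> ipoly g z = 0 \<Longrightarrow> degree h \<le> degree g"
    using ex_has_least_nat[of "\<lambda>h. h \<noteq> 0 \<and> ipoly h z = 0" h0 degree] assms by blast
  define f where "f = primitive_part h"
  have hf: "h = smult (content h) f" by (simp add: f_def)
  have f: "f \<noteq> 0" "content f = 1" using h by (simp_all add: f_def)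
  have "of_int (content h) * ipoly f z = 0"
    using h hf by (metis ipoly_smult)
  hence fz: "ipoly f z = 0" using h by simp
  show thesis
  proof (rule that[OF f(1) fz])
    fix g assume g: "ipoly g z = 0"
    obtain a q where a: "a \<noteq> 0" "smult a g = f * q + pseudo_mod g f"
      using pseudo_mod(1)[OF f(1)] by blast
    have "ipoly (smult a g) z = ipoly (f * q + pseudo_mod g f) z" using a by simp
    hence "ipoly (pseudo_mod g f) z = 0" using fz g by simp
    moreover have "degree f = degree h" using hf h by (metis content_eq_zero_iff degree_smult_eq)
    ultimately have "pseudo_mod g f = 0"
      using pseudo_mod(2)[OF f(1), of g] hmin by fastforce
    hence ag: "smult a g = f * q" using a by simp
    hence "content (smult a g) = content f * content q" by (simp only: content_mult)
    hence "\<bar>a\<bar> * content g = content q" using f by simp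
    hence "\<bar>a\<bar> dvd content q" by (metis dvd_triv_left)
    hence "a dvd content q" by simp
    hence "[:a:] dvd q" by (simp add: const_poly_dvd_iff_dvd_content)
    then obtain q' where "q = smult a q'" by (auto elim!: dvdE)
    hence "smult a g = smult a (f * q')" using ag by simp
    hence "smult a (g - f * q') = 0" by (simp only: smult_diff_right diff_self)
    hence "g = f * q'" using a(1) by simp
    thus "f dvd g" by simp
  qed
qed

text \<open>The minimal polynomial divides the monic X^m - 1 over the integers, so its leading
  coefficient is 1 or -1, and multiplying by this sign makes it monic.\<close>

lemma root_of_unity_min_poly:
  fixes z :: complex
  assumes "m > 0" "z ^ m = 1"
  obtains f where "lead_coeff f = 1" "ipoly f z = 0" "\<And>g. ipoly g z = 0 \<Longrightarrow> f dvd g"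
proof -
  define h :: "int poly" where "h = monom 1 m - 1"
  have deg: "degree (1 :: int poly) < degree (monom (1::int) m)"
    using assms by (simp add: degree_monom_eq)
  have "lead_coeff h = 1"
  proof -
    have "degree h = m" unfolding h_def diff_conv_add_uminus
      using deg by (subst degree_add_eq_left) (simp_all add: degree_monom_eq)
    thus ?thesis using assms by (simp add: h_def)
  qed
  moreover have hz: "ipoly h z = 0" using assms by (simp add: h_def)
  moreover have "h \<noteq> 0" using calculation by auto
  ultimately obtain f where f: "f \<noteq> 0" "ipoly f z = 0" "\<And>g. ipoly g z = 0 \<Longrightarrow> f dvd g"
    using min_int_poly_exists by blast
  obtain s where "h = f * s" using f(3)[OF hz] by (elim dvdE)
  hence "lead_coeff f * lead_coeff s = 1" using \<open>lead_coeff h = 1\<close> by (simp flip: lead_coeff_mult)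
  hence l: "lead_coeff f = 1 \<or> lead_coeff f = -1" using zmult_eq_1_iff by blast
  show thesis
  proof (rule that[of "smult (lead_coeff f) f"])
    show "lead_coeff (smult (lead_coeff f) f) = 1" using l by auto
    show "ipoly (smult (lead_coeff f) f) z = 0" using f by simp
    show "smult (lead_coeff f) f dvd g" if "ipoly g z = 0" for g
      using f(3)[OF that] l by auto
  qed
qed

text \<open>Pseudo-division scales \<open>g\<close> by a power of the leading coefficient, here 1,
  so that \<open>pseudo_mod\<close> is a true remainder over the integers.\<close>

lemma monic_int_division:
  fixes f g :: "int poly"
  assumes "lead_coeff f = 1"
  shows "f dvd g - pseudo_mod g f" "pseudo_mod g f = 0 \<or> degree (pseudo_mod g f) < degree f"
proof -
  have f: "f \<noteq> 0" using assms by auto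
  obtain q r where qr: "pseudo_divmod g f = (q, r)" by (cases "pseudo_divmod g f")
  have "g = f * q + r" using pseudo_divmod(1)[OF f qr] assms by simp
  thus "f dvd g - pseudo_mod g f" using qr by (simp add: pseudo_mod_def)
  show "pseudo_mod g f = 0 \<or> degree (pseudo_mod g f) < degree f" by (rule pseudo_mod(2)[OF f])
qed

lemma monic_int_remainder_unique:
  fixes f g r :: "int poly"
  assumes "lead_coeff f = 1" "f dvd g - r" "r = 0 \<or> degree r < degree f"
  shows "pseudo_mod g f = r"
proof (rule ccontr)
  assume neq: "pseudo_mod g f \<noteq> r"
  note d = monic_int_division[OF assms(1), of g]
  have "f dvd (g - r) - (g - pseudo_mod g f)" by (rule dvd_diff[OF assms(2) d(1)])
  hence "f dvd pseudo_mod g f - r" by simp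
  hence "degree f \<le> degree (pseudo_mod g f - r)" using neq by (intro dvd_imp_degree_le) auto
  also have "\<dots> \<le> max (degree (pseudo_mod g f)) (degree r)" by (rule degree_diff_le_max)
  finally have "degree f \<le> degree (pseudo_mod g f) \<or> degree f \<le> degree r" by linarith
  hence "degree f = 0" using d(2) assms(3) by auto
  hence "pseudo_mod g f = 0" "r = 0" using d(2) assms(3) by auto
  thus False using neq by simp
qed

lemma prime_dvd_binomial_power:
  fixes x y :: "'a :: comm_ring_1"
  assumes "prime p"
  shows "of_nat p dvd (x + y) ^ p - (x ^ p + y ^ p)"
proof -
  have p: "p > 1" by (rule prime_gt_1_nat[OF assms])
  have "(x + y) ^ p = (\<Sum>k\<le>p. of_nat (p choose k) * x ^ k * y ^ (p - k))"
    by (rule binomial_ring)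
  also have "{..p} = insert 0 (insert p {0<..<p})" using p by auto
  also have "(\<Sum>k\<in>\<dots>. of_nat (p choose k) * x ^ k * y ^ (p - k)) =
      y ^ p + x ^ p + (\<Sum>k\<in>{0<..<p}. of_nat (p choose k) * x ^ k * y ^ (p - k))"
    using p by (simp add: add.assoc)
  finally have "(x + y) ^ p - (x ^ p + y ^ p)
      = (\<Sum>k\<in>{0<..<p}. of_nat (p choose k) * x ^ k * y ^ (p - k))"
    by (simp add: algebra_simps)
  moreover have "of_nat p dvd (of_nat (p choose k) * x ^ k * y ^ (p - k) :: 'a)" if "k \<in> {0<..<p}"
    for k
  proof -
    have "p dvd (p choose k)" using dvd_choose_prime[of k p] that assms by auto
    then obtain c where "p choose k = p * c" by (elim dvdE)
    thus ?thesis by (simp add: mult.assoc)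
  qed
  ultimately show ?thesis by (metis (no_types, lifting) dvd_sum)
qed

lemma fermat_little_int: "int p dvd a ^ p - a" if p: "prime p"
proof (induction a rule: int_induct[where k = 0])
  case base
  show ?case using prime_gt_0_nat[OF p] by (simp add: zero_power)
next
  case (step1 i)
  have "int p dvd ((i + 1) ^ p - (i ^ p + 1 ^ p)) + (i ^ p - i)"
    using prime_dvd_binomial_power[OF p, of i 1] step1 by (intro dvd_add) auto
  thus ?case by (simp add: algebra_simps)
next
  case (step2 i)
  have "int p dvd (i ^ p - i) - (((i - 1) + 1) ^ p - ((i - 1) ^ p + 1 ^ p))"
    using prime_dvd_binomial_power[OF p, of "i - 1" 1] step2(2)
      by (intro dvd_diff[OF step2(2)]) simp
  thus ?case by (simp add: algebra_simps)
qed

text \<open>Modulo a prime p, taking p-th powers is additive and fixes integer coefficients by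
  Fermat, so it only replaces X by X^p.\<close>

lemma frobenius_int_poly: "[:int p:] dvd pcompose f (monom 1 p) - f ^ p" if p: "prime p"
proof (induction f)
  case 0
  show ?case using p by (simp add: prime_gt_0_nat zero_power)
next
  case (pCons a f)
  define X :: "int poly" where "X = [:0, 1:]"
  have X: "monom 1 p = X ^ p" by (simp add: X_def monom_altdef)
  have e: "pCons a f = [:a:] + X * f" by (simp add: X_def)
  have c: "of_nat p = [:int p:]" by (simp add: of_nat_poly)
  have "pcompose (pCons a f) (monom 1 p) - pCons a f ^ p =
     - ([:a:] ^ p - [:a:]) + X ^ p * (pcompose f (monom 1 p) - f ^ p)
     - ((([:a:] + X * f) ^ p) - ([:a:] ^ p + (X * f) ^ p))"
    unfolding pcompose_pCons X e[symmetric] by (simp add: power_mult_distrib algebra_simps)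
  moreover have "[:int p:] dvd [:a:] ^ p - [:a:]"
  proof -
    have "[:a:] ^ p - [:a:] = [:a ^ p - a:]" by (simp add: poly_const_pow)
    also have "[:int p:] dvd \<dots>" using fermat_little_int[OF p, of a] by (auto elim!: dvdE)
    finally show ?thesis .
  qed
  moreover have "[:int p:] dvd (([:a:] + X * f) ^ p) - ([:a:] ^ p + (X * f) ^ p)"
    using prime_dvd_binomial_power[OF p, of "[:a:]" "X * f"] by (simp only: c)
  ultimately show ?case
    using pCons.IH by (metis dvd_add dvd_diff dvd_minus_iff dvd_mult)
qed

text \<open>
  Landau's argument: the remainders of \<open>f(X\<^sup>k)\<close> modulo \<open>f\<close> take finitely many values, and for prime
  \<open>k = p\<close> the remainder is divisible by \<open>p\<close>, so it vanishes once \<open>p\<close> exceeds all coefficients.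
\<close>
lemma min_poly_dvd_power_substitution:
  fixes z :: complex
  assumes m: "m > 0" "z ^ m = 1"
    and f: "lead_coeff f = 1" "ipoly f z = 0" "\<And>g. ipoly g z = 0 \<Longrightarrow> f dvd g"
  obtains A where "\<And>p. prime p \<Longrightarrow> p > A \<Longrightarrow> f dvd pcompose f (monom 1 p)"
proof -
  define r where "r k = pseudo_mod (pcompose f (monom 1 k)) f" for k
  have per: "r k = r (k mod m)" for k
    unfolding r_def
  proof (rule monic_int_remainder_unique[OF f(1)])
    have "z ^ k = z ^ (k mod m)"
      using m by (metis mod_mult_div_eq mult.commute mult_1 power_add power_mult power_one)
    hence "f dvd pcompose f (monom 1 k) - pcompose f (monom 1 (k mod m))"
      by (intro f(3)) simp
    hence "f dvd (pcompose f (monom 1 k) - pcompose f (monom 1 (k mod m))) +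
       (pcompose f (monom 1 (k mod m)) - pseudo_mod (pcompose f (monom 1 (k mod m))) f)"
      using monic_int_division(1)[OF f(1)] by (intro dvd_add)
    thus "f dvd pcompose f (monom 1 k) - pseudo_mod (pcompose f (monom 1 (k mod m))) f" by simp
  qed (rule monic_int_division(2)[OF f(1)])
  define A where "A = (\<Sum>k<m. \<Sum>i\<le>degree (r k). nat \<bar>coeff (r k) i\<bar>)"
  have bound: "nat \<bar>coeff (r k) i\<bar> \<le> A" for k i
  proof (cases "i \<le> degree (r k)")
    case True
    have "nat \<bar>coeff (r (k mod m)) i\<bar> \<le> (\<Sum>i\<le>degree (r (k mod m)). nat \<bar>coeff (r (k mod m)) i\<bar>)"
      using True per[of k] by (intro member_le_sum) auto
    also have "\<dots> \<le> A"
      unfolding A_def using m by (intro member_le_sum[of "k mod m" "{..<m}"]) auto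
    finally show ?thesis using per[of k] by simp
  qed (simp add: coeff_eq_0)
  show thesis
  proof (rule that[of A])
    fix p :: nat assume p: "prime p" "p > A"
    obtain g where g: "pcompose f (monom 1 p) - f ^ p = smult (int p) g"
      using frobenius_int_poly[OF p(1), of f] by (auto elim!: dvdE)
    \<comment> \<open>In f(X^p) = f^p + p g the first summand vanishes modulo \<open>f\<close>,
      which leaves p times the remainder of \<open>g\<close>.\<close>
    have "r p = smult (int p) (pseudo_mod g f)"
      unfolding r_def
    proof (rule monic_int_remainder_unique[OF f(1)])
      have "f dvd f ^ p" using p by (simp add: prime_gt_0_nat dvd_power)
      moreover have "f dvd smult (int p) (g - pseudo_mod g f)"
        using monic_int_division(1)[OF f(1)] by (rule dvd_smult)
      ultimately have "f dvd f ^ p + smult (int p) (g - pseudo_mod g f)" by (rule dvd_add)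
      also have "f ^ p + smult (int p) (g - pseudo_mod g f)
          = pcompose f (monom 1 p) - smult (int p) (pseudo_mod g f)"
        using g by (simp add: smult_diff_right algebra_simps)
      finally show "f dvd pcompose f (monom 1 p) - smult (int p) (pseudo_mod g f)" .
      show "smult (int p) (pseudo_mod g f) = 0 \<or> degree (smult (int p) (pseudo_mod g f)) < degree f"
        using monic_int_division(2)[OF f(1), of g] by auto
    qed
    hence "coeff (r p) i = int p * coeff (pseudo_mod g f) i" for i by simp
    hence dv: "int p dvd coeff (r p) i" for i by simp
    have "coeff (r p) i = 0" for i
    proof (rule ccontr)
      assume "coeff (r p) i \<noteq> 0"
      hence "int p \<le> \<bar>coeff (r p) i\<bar>" using dv[of i] zdvd_imp_le[of "int p" "\<bar>coeff (r p) i\<bar>"]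
        by simp
      thus False using bound[of p i] p by linarith
    qed
    hence "r p = 0" by (intro poly_eqI) simp
    thus "f dvd pcompose f (monom 1 p)"
      using monic_int_division(1)[OF f(1), of "pcompose f (monom 1 p)"] by (simp add: r_def)
  qed
qed

text \<open>Add to k the number m times the product of the primes up to A that do not divide k. A
  prime up to A then divides exactly one of the two summands: if it divides k, it divides neither m
  nor the product. This avoids primes in arithmetic progressions.\<close>

lemma coprime_residue_large_prime_factors:
  fixes m k A :: nat
  assumes m: "m > 0" and cop: "coprime k m"
  obtains k' where "k' > 0" "k' mod m = k mod m" "\<And>p. prime p \<Longrightarrow> p dvd k' \<Longrightarrow> p > A"
proof -
  define Q where "Q = {p. prime p \<and> p \<le> A \<and> \<not> p dvd k}"
  have Q: "finite Q" unfolding Q_def by (rule finite_subset[of _ "{..A}"]) auto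
  define k' where "k' = k + m * \<Prod>Q"
  have pos: "\<Prod>Q > 0" by (auto simp: Q_def prime_gt_0_nat intro!: prod_pos)
  show thesis
  proof (rule that[of k'])
    show "k' > 0" using m pos by (simp add: k'_def)
    show "k' mod m = k mod m" by (simp add: k'_def)
    fix p assume p: "prime p" "p dvd k'"
    show "p > A"
    proof (rule ccontr)
      assume le: "\<not> p > A"
      show False
      proof (cases "p dvd k")
        case True
        hence "p dvd m * \<Prod>Q" using p by (simp add: k'_def dvd_add_right_iff)
        moreover have "\<not> p dvd m"
          using True cop p(1) by (metis coprime_common_divisor_nat not_prime_1 prime_nat_iff)
        ultimately have "p dvd \<Prod>Q" using p(1) by (simp add: prime_dvd_mult_iff)
        then obtain q where "q \<in> Q" "p dvd q" using p(1) Q by (auto simp: prime_dvd_prod_iff)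
        hence "p = q" using p(1) by (auto simp: Q_def primes_dvd_imp_eq)
        thus False using \<open>q \<in> Q\<close> True by (simp add: Q_def)
      next
        case False
        hence "p \<in> Q" using p le by (simp add: Q_def)
        hence "p dvd m * \<Prod>Q" using Q by (auto intro!: dvd_mult dvd_prodI)
        hence "p dvd k" using p(2) by (simp add: k'_def dvd_add_left_iff)
        thus False using False by simp
      qed
    qed
  qed
qed

text \<open>Replace k by a number in the same class modulo m all of whose prime factors exceed the
  bound for the substitutions X -> X^p, and apply these one prime at a time. The root changes on the
  way, so the induction is for every root \<open>y\<close> of \<open>f\<close>.\<close>

lemma min_poly_root_coprime_power:
  fixes z :: complex
  assumes m: "m > 0" "z ^ m = 1"
    and f: "lead_coeff f = 1" "ipoly f z = 0" "\<And>g. ipoly g z = 0 \<Longrightarrow> f dvd g"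
    and k: "coprime k m"
  shows "ipoly f (z ^ k) = 0"
proof -
  obtain A where A: "\<And>p. prime p \<Longrightarrow> p > A \<Longrightarrow> f dvd pcompose f (monom 1 p)"
    using min_poly_dvd_power_substitution[OF m f] by blast
  obtain k' where k': "k' > 0" "k' mod m = k mod m" "\<And>p. prime p \<Longrightarrow> p dvd k' \<Longrightarrow> p > A"
    using coprime_residue_large_prime_factors[OF m(1) k] by blast
  have "ipoly f (y ^ n) = 0" if "n > 0" "\<And>p. prime p \<Longrightarrow> p dvd n \<Longrightarrow> p > A" "ipoly f y = 0" for n y
    using that
  proof (induction n arbitrary: y rule: less_induct)
    case (less n)
    show ?case
    proof (cases "n = 1")
      case False
      then obtain p where p: "prime p" "p dvd n" using prime_factor_nat by blast
      then obtain n' where n': "n = p * n'" by (elim dvdE)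
      obtain s where "pcompose f (monom 1 p) = f * s"
        using A[OF p(1) less.prems(2)[OF p]] by (elim dvdE)
      hence "ipoly (pcompose f (monom 1 p)) y = ipoly (f * s) y" by simp
      hence "ipoly f (y ^ p) = 0" using less.prems by simp
      moreover have "n' > 0" using n' less.prems(1) by (cases n') auto
      moreover have "n' < n" using n' mult_strict_right_mono[OF prime_gt_1_nat[OF p(1)] \<open>n' > 0\<close>]
        by simp
      ultimately have "ipoly f ((y ^ p) ^ n') = 0"
        using less.prems(2) n' by (intro less.IH[OF \<open>n' < n\<close> \<open>n' > 0\<close>]) auto
      thus ?thesis by (simp add: n' power_mult)
    qed (use less.prems in simp)
  qed
  hence "ipoly f (z ^ k') = 0" using k' f by blast
  moreover have "z ^ k' = z ^ k"
    using m k'(2) by (metis mod_mult_div_eq mult.commute mult_1 power_add power_mult power_one)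
  ultimately show ?thesis by simp
qed

section \<open>Powers of \<zeta> and the degree of the cyclotomic field\<close>

lemma zeta_power: "zeta m ^ k = cis (2 * pi * real k / real m)"
  by (simp add: zeta_def Complex.DeMoivre mult.commute)

lemma zeta_power_self [simp]: "m > 0 \<Longrightarrow> zeta m ^ m = 1"
  by (simp add: zeta_power)

lemma zeta_nonzero [simp]: "zeta m \<noteq> 0"
  by (simp add: zeta_def)

lemma norm_zeta_power [simp]: "norm (zeta m ^ k) = 1"
  by (simp add: zeta_power)

lemma zeta_power_mod: "zeta m ^ (k mod m) = zeta m ^ k" if "m > 0"
  using that
    by (metis mod_mult_div_eq mult.right_neutral power_add power_mult power_one zeta_power_self)

lemma zeta_power_inj: "inj_on (\<lambda>k. zeta m ^ k) {..<m}" if "m > 0"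
  using Complex.bij_betw_roots_unity[OF that] unfolding zeta_power bij_betw_def by simp

lemma zeta_power_eq_iff: "zeta m ^ j = zeta m ^ k \<longleftrightarrow> j mod m = k mod m" if m: "m > 0"
proof
  assume "zeta m ^ j = zeta m ^ k"
  hence "zeta m ^ (j mod m) = zeta m ^ (k mod m)" by (simp add: zeta_power_mod m)
  thus "j mod m = k mod m" using inj_onD[OF zeta_power_inj[OF m]] m by simp
next
  assume "j mod m = k mod m"
  thus "zeta m ^ j = zeta m ^ k" by (metis zeta_power_mod m)
qed

lemma root_of_unity_zeta_power:
  assumes "m > 0" "z ^ m = 1"
  obtains k where "k < m" "z = zeta m ^ k"
  using Complex.bij_betw_roots_unity[OF assms(1)] assms(2) unfolding zeta_power bij_betw_def
    by blast

lemma cnj_zeta_power: "cnj (zeta m ^ k) = zeta m ^ (m - k)" if "k \<le> m" "m > 0"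
proof -
  have "zeta m ^ k * cnj (zeta m ^ k) = 1" by (simp add: zeta_power cis_cnj cis_mult)
  moreover have "zeta m ^ k * zeta m ^ (m - k) = 1" using that by (simp flip: power_add)
  ultimately show ?thesis by (metis mult_left_cancel zeta_nonzero power_not_zero)
qed

text \<open>Every rational relation satisfied by \<zeta> survives the substitution of \<zeta>^k;
  this is what makes the embeddings of the field well defined.\<close>

lemma rpoly_zeta_coprime_power:
  assumes m: "m > 0" and "rpoly p (zeta m) = 0" and k: "coprime k m"
  shows "rpoly p (zeta m ^ k) = 0"
proof -
  obtain N g where Ng: "N > (0::int)" "\<And>x. of_int N * rpoly p x = ipoly g x"
    using rat_poly_clear_denominators by blast
  obtain f where f: "lead_coeff f = 1" "ipoly f (zeta m) = 0" "\<And>g. ipoly g (zeta m) = 0 \<Longrightarrow> f dvd g"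
    using root_of_unity_min_poly[OF m zeta_power_self[OF m]] by blast
  have "ipoly g (zeta m) = 0" using assms(2) Ng(2)[of "zeta m"] by simp
  then obtain s where "g = f * s" using f(3) by (blast elim: dvdE)
  moreover have "ipoly f (zeta m ^ k) = 0"
    by (rule min_poly_root_coprime_power[OF m zeta_power_self[OF m] f k])
  ultimately have "of_int N * rpoly p (zeta m ^ k) = 0" using Ng(2) by simp
  thus ?thesis using Ng(1) by simp
qed

text \<open>As a divisor of X^m - 1, \<open>f\<close> is squarefree over the complex numbers, so its
  degree is the number of its roots, and every root is a primitive m-th root of unity.\<close>

lemma min_poly_zeta_degree_le:
  assumes m: "m > 0" and f: "lead_coeff f = 1" "ipoly f (zeta m) = 0" "\<And>g. ipoly g (zeta m) = 0
      \<Longrightarrow> f dvd g"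
  shows "degree f \<le> totient m"
proof -
  define h where "h k = monom (1::int) k - 1" for k :: nat
  have hz: "ipoly (h k) z = z ^ k - 1" for k z by (simp add: h_def)
  have f0: "f \<noteq> 0" using f by auto
  have root: "\<exists>k\<in>totatives m. x = zeta m ^ k" if x: "ipoly f x = 0" for x
  proof -
    obtain s where s: "h m = f * s" using f(3)[of "h m"] m by (auto simp: hz elim: dvdE)
    have "ipoly (h m) x = 0" by (simp add: s x)
    hence xm: "x ^ m = 1" by (simp add: hz)
    then obtain k where k: "k < m" "x = zeta m ^ k" using root_of_unity_zeta_power m by blast
    have "coprime k m"
    proof (rule ccontr)
      \<comment> \<open>Then x^m' = 1 for a proper divisor m' of m. The minimal polynomial
        \<open>fx\<close> of \<open>x\<close> divides \<open>f\<close>; the cofactor cannot vanish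
        at \<zeta> for reasons of degree, so \<open>fx\<close> does, whence \<open>f\<close> divides
        \<open>fx\<close> and X^m' - 1. This contradicts the order of \<zeta>.\<close>
      assume nc: "\<not> coprime k m"
      define g where "g = gcd k m"
      have g: "g dvd k" "g dvd m" "g > 1" using nc m
        by (auto simp: g_def coprime_iff_gcd_eq_1 nat_neq_iff)
      define m' where "m' = m div g"
      have m': "m' > 0" "m' < m" "m = m' * g" using g m
        by (auto simp: m'_def div_less_dividend elim!: dvdE)
      have "x ^ m' = 1"
      proof -
        obtain c where c: "k = g * c" using g by (elim dvdE)
        have "x ^ m' = zeta m ^ (m * c)" by (simp add: k(2) c m'(3) mult_ac flip: power_mult)
        thus ?thesis using m by (simp add: power_mult)
      qed
      obtain fx where fx: "lead_coeff fx = 1" "ipoly fx x = 0" "\<And>g. ipoly g x = 0 \<Longrightarrow> fx dvd g"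
        using root_of_unity_min_poly[OF m xm] by blast
      obtain u where u: "f = fx * u" using fx(3)[OF x] by (elim dvdE)
      have "fx dvd h m'" using fx(3)[of "h m'"] \<open>x ^ m' = 1\<close> by (simp add: hz)
      moreover have "ipoly fx (zeta m) * ipoly u (zeta m) = 0" using f(2) u by simp
      moreover have "ipoly u (zeta m) \<noteq> 0"
      proof
        assume "ipoly u (zeta m) = 0"
        hence "f dvd u" by (rule f(3))
        moreover have "u \<noteq> 0" "fx \<noteq> 0" using u f0 by auto
        moreover have "degree fx > 0"
        proof (rule ccontr)
          assume "\<not> degree fx > 0"
          then obtain c where "fx = [:c:]" by (auto elim: degree_eq_zeroE)
          thus False using fx by simp
        qed
        ultimately show False using dvd_imp_degree_le[of f u] by (simp add: u degree_mult_eq)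
      qed
      ultimately have "f dvd fx" using f(3) by simp
      hence "f dvd h m'" using \<open>fx dvd h m'\<close> by (rule dvd_trans)
      then obtain w where "h m' = f * w" by (elim dvdE)
      hence "ipoly (h m') (zeta m) = 0" using f by simp
      hence "zeta m ^ m' = zeta m ^ 0" by (simp add: hz)
      thus False using m m' by (simp add: zeta_power_eq_iff del: power_0)
    qed
    \<comment> \<open>\<open>totatives m\<close> lies in 1..m, so the exponent 0, which is coprime
      to m only for m = 1, has to be written as m.\<close>
    moreover have "k mod m = (if k = 0 then m else k) mod m" by simp
    ultimately show ?thesis
      using k m zeta_power_eq_iff[OF m, of k "if k = 0 then m else k"]
      by (intro bexI[of _ "if k = 0 then m else k"]) (auto simp: in_totatives_iff)
  qed
  define F where "F = (map_poly of_int f :: complex poly)"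
  have F0: "F \<noteq> 0" using f0 by (simp add: F_def map_poly_eq_0_iff)
  have dF: "degree F = degree f" by (simp add: F_def degree_map_poly)
  have "rsquarefree F"
    unfolding rsquarefree_roots
  proof (intro allI notI)
    fix a assume a: "poly F a = 0 \<and> poly (pderiv F) a = 0"
    obtain s where s: "h m = f * s" using f(3)[of "h m"] m by (auto simp: hz elim: dvdE)
    define S where "S = (map_poly of_int s :: complex poly)"
    have hm: "monom 1 m - 1 = F * S"
      by (rule poly_eq_poly_eq_iff[THEN iffD1], rule ext)
        (metis F_def S_def hz ipoly_mult poly_1 poly_diff poly_monom poly_mult s mult_1)
    have "poly (monom 1 m - 1) a = 0" "poly (pderiv (monom 1 m - 1)) a = 0"
      unfolding hm using a by (simp_all add: pderiv_mult)
    hence "a ^ m = 1" "of_nat m * a ^ (m - 1) = 0"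
      by (simp_all add: poly_monom pderiv_monom pderiv_diff)
    thus False using m by (cases "a = 0") (auto simp: power_0_left)
  qed
  hence "F = smult (lead_coeff F) (\<Prod>z|poly F z = 0. [:-z, 1:])"
    by (rule complex_poly_decompose_rsquarefree[symmetric])
  hence "degree F = degree (\<Prod>z|poly F z = 0. [:-z, 1:])"
    using F0 by (metis degree_smult_eq leading_coeff_0_iff)
  also have "\<dots> = card {z. poly F z = 0}"
    by (subst degree_prod_eq_sum_degree) auto
  also have "\<dots> \<le> card ((\<lambda>k. zeta m ^ k) ` totatives m)"
    using root by (intro card_mono) (auto simp: F_def)
  also have "\<dots> \<le> totient m"
    unfolding totient_def by (rule card_image_le) simp
  finally show ?thesis by (simp add: dF)
qed

lemma cyc_field_coordinates:
  assumes m: "m > 0" and x: "x \<in> cyc_field m"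
  obtains c :: "nat \<Rightarrow> rat" where "x = (\<Sum>i<totient m. of_rat (c i) * zeta m ^ i)"
proof -
  obtain p where p: "x = rpoly p (zeta m)" using x by (auto simp: cyc_field_def)
  obtain N g where Ng: "N > (0::int)" "\<And>x. of_int N * rpoly p x = ipoly g x"
    using rat_poly_clear_denominators by blast
  obtain f where f: "lead_coeff f = 1" "ipoly f (zeta m) = 0" "\<And>g. ipoly g (zeta m) = 0 \<Longrightarrow> f dvd g"
    using root_of_unity_min_poly[OF m zeta_power_self[OF m]] by blast
  define r where "r = pseudo_mod g f"
  obtain s where "g - r = f * s" using monic_int_division(1)[OF f(1), of g]
    by (auto simp: r_def elim: dvdE)
  hence "ipoly (g - r) (zeta m) = 0" using f by simp
  hence g: "ipoly g (zeta m) = ipoly r (zeta m)" by simp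
  have r: "r = 0 \<or> degree r < totient m"
    using monic_int_division(2)[OF f(1), of g] min_poly_zeta_degree_le[OF m f] unfolding r_def
      by linarith
  have "ipoly r (zeta m) = (\<Sum>i\<le>degree r. of_int (coeff r i) * zeta m ^ i)"
    by (simp add: poly_altdef coeff_map_poly degree_map_poly)
  also have "\<dots> = (\<Sum>i<totient m. of_int (coeff r i) * zeta m ^ i)"
  proof (cases "r = 0")
    case False
    thus ?thesis using r by (intro sum.mono_neutral_left) (auto simp: coeff_eq_0)
  qed simp
  finally have "of_int N * x = (\<Sum>i<totient m. of_int (coeff r i) * zeta m ^ i)"
    using Ng(2)[of "zeta m"] g p by simp
  hence "x = (\<Sum>i<totient m. of_int (coeff r i) * zeta m ^ i) / of_int N"
    using Ng(1) by (simp add: field_simps)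
  also have "\<dots> = (\<Sum>i<totient m. of_rat (of_int (coeff r i) / of_int N) * zeta m ^ i)"
    by (simp add: sum_divide_distrib of_rat_divide)
  finally show thesis by (rule that)
qed

section \<open>The embeddings of the cyclotomic field\<close>

text \<open>The choice of the polynomial does not matter if \<open>k\<close> is coprime to \<open>m\<close>, see \<open>emb_rpoly\<close> below.\<close>

definition cyc_emb :: "nat \<Rightarrow> nat \<Rightarrow> complex \<Rightarrow> complex" where
  "cyc_emb m k x = rpoly (SOME p. x = rpoly p (zeta m)) (zeta m ^ k)"

text \<open>For m > 1 all totatives are less than m, so k -> m - k, which is complex conjugation on
  the powers of \<zeta>, maps \<open>T\<close> to itself.\<close>

locale cyclotomic =
  fixes m :: nat
  assumes m_gt_1: "m > 1"
begin

abbreviation "K \<equiv> cyc_field m"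
abbreviation "T \<equiv> totatives m"
abbreviation "d \<equiv> totient m"
abbreviation "\<zeta> \<equiv> zeta m"
abbreviation "\<sigma> k \<equiv> cyc_emb m k"

lemma m_pos: "m > 0" using m_gt_1 by simp

lemma T_coprime: "k \<in> T \<Longrightarrow> coprime k m"
  by (simp add: in_totatives_iff)

lemma T_reflect: "m - k \<in> T" if "k \<in> T"
proof -
  have k: "k < m" "coprime k m" using that m_gt_1 totatives_less by (auto simp: in_totatives_iff)
  have "coprime (m - k) m"
  proof (rule coprimeI)
    fix c assume c: "c dvd m - k" "c dvd m"
    have "c dvd m - (m - k)" by (rule dvd_diff_nat[OF c(2,1)])
    hence "c dvd k" using k by simp
    thus "is_unit c" using k c by (metis coprime_common_divisor)
  qed
  thus ?thesis using k by (simp add: in_totatives_iff)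
qed

lemma card_T: "card T = d"
  by (simp add: totient_def)

lemma d_pos: "d > 0" using m_pos by simp

lemma emb_rpoly: "\<sigma> k (rpoly p \<zeta>) = rpoly p (\<zeta> ^ k)" if "coprime k m"
proof -
  define q where "q = (SOME q. rpoly p \<zeta> = rpoly q \<zeta>)"
  have "rpoly p \<zeta> = rpoly q \<zeta>" unfolding q_def by (rule someI[where x=p]) simp
  hence "rpoly (q - p) (\<zeta> ^ k) = 0"
    by (intro rpoly_zeta_coprime_power[OF m_pos _ that]) simp
  thus ?thesis by (simp add: cyc_emb_def q_def)
qed

lemma in_K_rpoly: assumes "x \<in> K" obtains p where "x = rpoly p \<zeta>"
  using assms by (auto simp: cyc_field_def)

lemma emb_add: "\<sigma> k (x + y) = \<sigma> k x + \<sigma> k y" if "coprime k m" "x \<in> K" "y \<in> K"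
  using that emb_rpoly[OF that(1)] by (metis in_K_rpoly rpoly_add)

lemma emb_mult: "\<sigma> k (x * y) = \<sigma> k x * \<sigma> k y" if "coprime k m" "x \<in> K" "y \<in> K"
  using that emb_rpoly[OF that(1)] by (metis in_K_rpoly rpoly_mult)

lemma emb_of_rat [simp]: "\<sigma> k (of_rat a) = of_rat a" if "coprime k m"
  using emb_rpoly[OF that, of "[:a:]"] by simp

lemma emb_of_int [simp]: "\<sigma> k (of_int a) = of_int a" if "coprime k m"
  using emb_of_rat[OF that, of "of_int a"] by simp

lemma emb_0 [simp]: "\<sigma> k 0 = 0" if "coprime k m"
  using emb_of_rat[OF that, of 0] by simp

lemma emb_1 [simp]: "\<sigma> k 1 = 1" if "coprime k m"
  using emb_of_rat[OF that, of 1] by simp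

lemma emb_zeta_power: "\<sigma> k (\<zeta> ^ i) = \<zeta> ^ (k * i)" if "coprime k m"
  using emb_rpoly[OF that, of "monom 1 i"] by (simp add: power_mult)

lemma emb_sum: "\<sigma> k (\<Sum>i\<in>A. f i) = (\<Sum>i\<in>A. \<sigma> k (f i))" if "coprime k m" "\<And>i. i \<in> A \<Longrightarrow> f i \<in> K"
  using that by (induction A rule: infinite_finite_induct) (simp_all add: emb_add cyc_field_sum)

lemma one_in_K [simp]: "1 \<in> K"
  using cyc_field_of_rat[of 1 m] by simp

lemma zero_in_K [simp]: "0 \<in> K"
  using cyc_field_of_rat[of 0 m] by simp

lemma of_int_in_K [simp]: "of_int a \<in> K"
  using cyc_field_of_rat[of "of_int a" m] by simp

lemma zeta_power_in_K [simp]: "\<zeta> ^ i \<in> K"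
  by (simp add: cyc_field_power cyc_field_zeta)

lemma emb_in_K: "\<sigma> k x \<in> K" if "coprime k m" "x \<in> K"
proof -
  obtain p where "x = rpoly p \<zeta>" using in_K_rpoly \<open>x \<in> K\<close> by blast
  hence "\<sigma> k x = rpoly (pcompose p (monom 1 k)) \<zeta>" using emb_rpoly[OF that(1)] by simp
  thus ?thesis by (metis poly_mem_cyc_field)
qed

lemma emb_emb: "\<sigma> j (\<sigma> k x) = \<sigma> (j * k) x" if "coprime j m" "coprime k m" "x \<in> K"
proof -
  obtain p where p: "x = rpoly p \<zeta>" using in_K_rpoly \<open>x \<in> K\<close> by blast
  hence e: "\<sigma> k x = rpoly (pcompose p (monom 1 k)) \<zeta>" using emb_rpoly[OF that(2)] by simp
  have "\<sigma> j (\<sigma> k x) = rpoly (pcompose p (monom 1 k)) (\<zeta> ^ j)"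
    unfolding e by (rule emb_rpoly[OF that(1)])
  also have "\<dots> = rpoly p ((\<zeta> ^ j) ^ k)" by simp
  finally have "\<sigma> j (\<sigma> k x) = rpoly p ((\<zeta> ^ j) ^ k)" .
  thus ?thesis using that emb_rpoly[of "j * k" p] p by (simp add: power_mult)
qed

lemma emb_mod: "\<sigma> (k mod m) x = \<sigma> k x"
  by (simp add: cyc_emb_def zeta_power_mod m_pos)

lemma emb_Suc_0 [simp]: "\<sigma> (Suc 0) x = x" if "x \<in> K"
  using emb_rpoly[of "Suc 0"] that by (metis coprime_1_left One_nat_def in_K_rpoly power_one_right)

lemma emb_reflect: "\<sigma> (m - k) x = cnj (\<sigma> k x)" if "k \<in> T" "x \<in> K"
proof -
  have k: "k \<le> m" "coprime k m" "coprime (m - k) m"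
    using that(1) T_reflect[OF that(1)] by (auto simp: in_totatives_iff)
  obtain p where "x = rpoly p \<zeta>" using in_K_rpoly \<open>x \<in> K\<close> by blast
  thus ?thesis using k
    by (simp add: emb_rpoly cnj_rpoly cnj_zeta_power m_pos flip: complex_cnj_power)
qed

lemma emb_cnj: "\<sigma> k (cnj x) = cnj (\<sigma> k x)" if "coprime k m" "x \<in> K"
proof -
  obtain p where p: "x = rpoly p \<zeta>" using in_K_rpoly \<open>x \<in> K\<close> by blast
  have c: "cnj \<zeta> = \<zeta> ^ (m - 1)" using cnj_zeta_power[of 1 m] m_gt_1 by simp
  have e: "cnj x = rpoly (pcompose p (monom 1 (m - 1))) \<zeta>" by (simp add: p cnj_rpoly c)
  have "\<sigma> k (cnj x) = rpoly (pcompose p (monom 1 (m - 1))) (\<zeta> ^ k)"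
    unfolding e by (rule emb_rpoly[OF that(1)])
  also have "\<dots> = rpoly p ((\<zeta> ^ k) ^ (m - 1))" by simp
  also have "(\<zeta> ^ k) ^ (m - 1) = cnj (\<zeta> ^ k)"
    by (simp add: c flip: power_mult) (simp add: mult.commute)
  finally show ?thesis by (simp add: p emb_rpoly that cnj_rpoly)
qed

text \<open>The embedding with the inverse exponent modulo m undoes
  \<open>\<sigma> k\<close>.\<close>

lemma emb_eq_0_iff: "\<sigma> k x = 0 \<longleftrightarrow> x = 0" if "k \<in> T" "x \<in> K"
proof
  assume "\<sigma> k x = 0"
  have k: "coprime k m" using T_coprime that by simp
  obtain j where j: "[k * j = 1] (mod m)" using cong_solve_coprime_nat[OF k] by auto
  hence "coprime j m" by (metis cong_imp_coprime cong_sym coprime_1_left coprime_mult_left_iff)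
  hence "\<sigma> j (\<sigma> k x) = \<sigma> (k * j) x" using emb_emb k that by (simp add: mult.commute)
  also have "\<dots> = \<sigma> 1 x" using j emb_mod[of "k * j" x] emb_mod[of 1 x] by (simp add: cong_def)
  also have "\<dots> = x" using that by simp
  finally show "x = 0" using \<open>\<sigma> k x = 0\<close> \<open>coprime j m\<close> by simp
qed (use T_coprime that in simp)

lemma reflect_bij: "bij_betw (\<lambda>k. m - k) T T"
proof (rule bij_betwI[where g = "\<lambda>k. m - k"])
  show "(\<lambda>k. m - k) \<in> T \<rightarrow> T" "(\<lambda>k. m - k) \<in> T \<rightarrow> T" using T_reflect by auto
qed (auto simp: in_totatives_iff)

lemma mult_bij: "bij_betw (\<lambda>k. j * k mod m) T T" if j: "coprime j m"
proof -
  have inj: "inj_on (\<lambda>k. j * k mod m) T"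
  proof (rule inj_onI)
    fix x y assume xy: "x \<in> T" "y \<in> T" "j * x mod m = j * y mod m"
    hence "[x = y] (mod m)" using j by (simp add: cong_def[symmetric] cong_mult_lcancel_nat)
    moreover have "x < m" "y < m" using xy m_gt_1 totatives_less by blast+
    ultimately show "x = y" by (simp add: cong_def)
  qed
  moreover have "(\<lambda>k. j * k mod m) ` T \<subseteq> T"
  proof safe
    fix x assume "x \<in> T"
    hence c: "coprime (j * x mod m) m" using j by (simp add: in_totatives_iff)
    hence "j * x mod m \<noteq> 0" using m_gt_1 by (intro notI) simp
    thus "j * x mod m \<in> T" using c m_pos by (simp add: in_totatives_iff less_imp_le)
  qed
  ultimately show ?thesis
    by (simp add: bij_betw_def endo_inj_surj)
qed

section \<open>Lagrange interpolation at the conjugates of \<open>\<zeta>\<close>\<close>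

lemma zeta_power_inj_T: "inj_on (\<lambda>k. \<zeta> ^ k) T"
  using zeta_power_inj[OF m_pos] totatives_less[OF _ m_gt_1] by (auto intro: inj_on_subset)

text \<open>The coefficients \<open>L k i\<close> form the inverse of the Vandermonde matrix of the
  conjugates of \<zeta>. Coordinates in the powers of \<zeta> and values at the conjugates thus
  determine each other by explicit formulas; the two orthogonality lemmas are the two products of
  these matrices.\<close>

definition lagrange :: "nat \<Rightarrow> complex poly" where
  "lagrange k = (\<Prod>j\<in>T - {k}. smult (1 / (\<zeta> ^ k - \<zeta> ^ j)) [:- (\<zeta> ^ j), 1:])"

abbreviation L :: "nat \<Rightarrow> nat \<Rightarrow> complex" where "L k i \<equiv> coeff (lagrange k) i"

lemma lagrange_eval: "poly (lagrange k) (\<zeta> ^ l) = (if k = l then 1 else 0)" if "k \<in> T" "l \<in> T"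
proof (cases "k = l")
  case True
  have "poly (smult (1 / (\<zeta> ^ l - \<zeta> ^ j)) [:- (\<zeta> ^ j), 1:]) (\<zeta> ^ l) = 1" if "j \<in> T - {l}" for j
  proof -
    have "\<zeta> ^ l \<noteq> \<zeta> ^ j" using that \<open>l \<in> T\<close> inj_onD[OF zeta_power_inj_T, of l j] by auto
    thus ?thesis by (simp flip: diff_divide_distrib)
  qed
  hence "poly (lagrange l) (\<zeta> ^ l) = 1"
    unfolding lagrange_def poly_prod by (intro prod.neutral ballI)
  thus ?thesis using True by simp
next
  case False
  thus ?thesis using that by (auto simp: lagrange_def poly_prod intro!: prod_zero bexI[of _ l])
qed

lemma lagrange_degree: "degree (lagrange k) < d" if "k \<in> T"
proof -
  have "degree (lagrange k) \<le> (\<Sum>j\<in>T - {k}. degree (smult (1 / (\<zeta> ^ k - \<zeta> ^ j)) [:- (\<zeta> ^ j), 1:]))"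
    unfolding lagrange_def by (rule order_trans[OF degree_prod_sum_le]) simp_all
  also have "\<dots> \<le> (\<Sum>j\<in>T - {k}. 1)" by (intro sum_mono) simp
  also have "\<dots> = d - 1" using that card_T by simp
  finally show ?thesis using d_pos by linarith
qed

lemma lagrange_orthogonal_rows: "(\<Sum>i<d. L k i * \<zeta> ^ (l * i)) = (if k = l then 1 else 0)"
  if "k \<in> T" "l \<in> T"
proof -
  have "poly (lagrange k) (\<zeta> ^ l) = (\<Sum>i\<le>degree (lagrange k). L k i * (\<zeta> ^ l) ^ i)"
    by (rule poly_altdef)
  also have "\<dots> = (\<Sum>i<d. L k i * (\<zeta> ^ l) ^ i)"
    using lagrange_degree[OF that(1)] by (intro sum.mono_neutral_left) (auto simp: coeff_eq_0)
  finally show ?thesis using lagrange_eval[OF that] by (simp add: power_mult)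
qed

text \<open>Interpolating the values of X^j at the d conjugates returns X^j itself, since both
  polynomials have degree less than d.\<close>

lemma lagrange_orthogonal_columns: "(\<Sum>k\<in>T. L k i * \<zeta> ^ (k * j)) = (if i = j then 1 else 0)"
  if "j < d"
proof -
  define p where "p = (\<Sum>k\<in>T. smult (\<zeta> ^ (k * j)) (lagrange k))"
  have "p = monom 1 j"
  proof (rule poly_eqI_degree[where A = "(\<lambda>k. \<zeta> ^ k) ` T"])
    have c: "card ((\<lambda>k. \<zeta> ^ k) ` T) = d" using card_image[OF zeta_power_inj_T] card_T by simp
    have "degree p \<le> d - 1"
      unfolding p_def
      using lagrange_degree d_pos
        by (intro degree_sum_le) (auto intro!: le_trans[OF degree_smult_le] simp: less_Suc_eq_le[symmetric])
    thus "degree p < card ((\<lambda>k. \<zeta> ^ k) ` T)" using c d_pos by linarith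
    show "degree (monom (1::complex) j) < card ((\<lambda>k. \<zeta> ^ k) ` T)" using c that
      by (simp add: degree_monom_eq)
    fix x assume "x \<in> (\<lambda>k. \<zeta> ^ k) ` T"
    then obtain l where l: "l \<in> T" "x = \<zeta> ^ l" by blast
    have "poly p x = (\<Sum>k\<in>T. \<zeta> ^ (k * j) * (if k = l then 1 else 0))"
      unfolding p_def poly_sum l(2) by (intro sum.cong) (auto simp: lagrange_eval l)
    also have "\<dots> = \<zeta> ^ (l * j)" using l by (simp add: sum.delta if_distrib cong: if_cong)
    finally show "poly p x = poly (monom 1 j) x" by (simp add: l poly_monom power_mult)
  qed
  hence "coeff p i = (if i = j then 1 else 0)" by auto
  thus ?thesis by (simp add: p_def coeff_sum mult.commute)
qed

text \<open>Complex coefficients are allowed because it is applied to differences such as a rational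
  number minus a field element, or a number minus its conjugate.\<close>

lemma vanishing_at_conjugates:
  fixes a :: "nat \<Rightarrow> complex"
  assumes "\<And>k. k \<in> T \<Longrightarrow> (\<Sum>i<d. a i * \<zeta> ^ (k * i)) = 0" and "j < d"
  shows "a j = 0"
proof -
  have "a j = (\<Sum>i<d. a i * (if j = i then 1 else 0))" using assms(2)
    by (simp add: if_distrib cong: if_cong)
  also have "\<dots> = (\<Sum>i<d. a i * (\<Sum>k\<in>T. L k j * \<zeta> ^ (k * i)))"
    by (intro sum.cong) (simp_all only: lagrange_orthogonal_columns lessThan_iff)
  also have "\<dots> = (\<Sum>k\<in>T. L k j * (\<Sum>i<d. a i * \<zeta> ^ (k * i)))"
    unfolding sum_distrib_left by (subst sum.swap) (simp add: mult_ac)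
  also have "\<dots> = 0" using assms(1) by simp
  finally show ?thesis .
qed

lemma K_coordinates:
  assumes "x \<in> K"
  obtains c :: "nat \<Rightarrow> rat" where "x = (\<Sum>i<d. of_rat (c i) * \<zeta> ^ i)"
    "\<And>k. coprime k m \<Longrightarrow> \<sigma> k x = (\<Sum>i<d. of_rat (c i) * \<zeta> ^ (k * i))"
proof -
  obtain c :: "nat \<Rightarrow> rat" where c: "x = (\<Sum>i<d. of_rat (c i) * \<zeta> ^ i)"
    using cyc_field_coordinates[OF m_pos assms] by blast
  show thesis
  proof (rule that[OF c])
    fix k assume k: "coprime k m"
    show "\<sigma> k x = (\<Sum>i<d. of_rat (c i) * \<zeta> ^ (k * i))"
      unfolding c using k
      by (simp add: emb_sum emb_mult emb_zeta_power cyc_field_mult cyc_field_of_rat)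
  qed
qed

section \<open>Norm and trace\<close>

definition cyc_norm :: "complex \<Rightarrow> complex" where
  "cyc_norm x = (\<Prod>k\<in>T. \<sigma> k x)"

lemma emb_fixed_imp_rat:
  assumes y: "y \<in> K" and inv: "\<And>k. k \<in> T \<Longrightarrow> \<sigma> k y = y"
  shows "y \<in> \<rat>"
proof -
  obtain c :: "nat \<Rightarrow> rat" where c: "\<And>k. coprime k m \<Longrightarrow> \<sigma> k y = (\<Sum>i<d. of_rat (c i) * \<zeta> ^ (k * i))"
    using K_coordinates[OF y] by metis
  \<comment> \<open>Subtracting \<open>y\<close> from the constant coefficient yields a polynomial
    whose value at the conjugate with exponent k is \<open>\<sigma> k y - y\<close>, that is 0; so
    \<open>y\<close> is the rational number \<open>c 0\<close>.\<close>
  define a where "a i = of_rat (c i) - (if i = 0 then y else 0)" for i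
  have "a 0 = 0"
  proof (rule vanishing_at_conjugates[OF _ d_pos])
    fix k assume k: "k \<in> T"
    have "(\<Sum>i<d. a i * \<zeta> ^ (k * i)) = \<sigma> k y - (\<Sum>i<d. (if i = 0 then y else 0) * \<zeta> ^ (k * i))"
      unfolding a_def using c[OF T_coprime[OF k]] by (simp add: left_diff_distrib sum_subtractf)
    also have "(\<Sum>i<d. (if i = 0 then y else 0) * \<zeta> ^ (k * i)) = (\<Sum>i<d. if i = 0 then y else 0)"
      by (intro sum.cong) auto
    also have "\<dots> = y" using d_pos by (simp add: sum.delta)
    finally show "(\<Sum>i<d. a i * \<zeta> ^ (k * i)) = 0" using inv k by simp
  qed
  hence "y = of_rat (c 0)" by (simp add: a_def)
  thus ?thesis by (metis Rats_of_rat)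
qed

lemma emb_prod: "\<sigma> k (\<Prod>i\<in>A. f i) = (\<Prod>i\<in>A. \<sigma> k (f i)) \<and> (\<Prod>i\<in>A. f i) \<in> K"
  if "coprime k m" "\<And>i. i \<in> A \<Longrightarrow> f i \<in> K"
  using that by (induction A rule: infinite_finite_induct) (simp_all add: emb_mult cyc_field_mult)

text \<open>Each embedding \<open>\<sigma> j\<close> permutes the factors of the norm, which is
  therefore fixed by all embeddings.\<close>

lemma cyc_norm_rat: "cyc_norm x \<in> \<rat>" and cyc_norm_in_K: "cyc_norm x \<in> K" if x: "x \<in> K"
proof -
  have E: "\<sigma> k x \<in> K" if "k \<in> T" for k using emb_in_K T_coprime that x by blast
  show K: "cyc_norm x \<in> K"
    unfolding cyc_norm_def using emb_prod[of 1 T "\<lambda>k. \<sigma> k x"] E by simp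
  show "cyc_norm x \<in> \<rat>"
  proof (rule emb_fixed_imp_rat[OF K])
    fix j assume j: "j \<in> T"
    have "\<sigma> j (cyc_norm x) = (\<Prod>k\<in>T. \<sigma> j (\<sigma> k x))"
      unfolding cyc_norm_def using emb_prod[of j T "\<lambda>k. \<sigma> k x"] E T_coprime[OF j] by simp
    also have "\<dots> = (\<Prod>k\<in>T. \<sigma> (j * k mod m) x)"
      by (intro prod.cong) (simp_all add: emb_emb T_coprime j x emb_mod)
    also have "\<dots> = cyc_norm x"
      unfolding cyc_norm_def by (rule prod.reindex_bij_betw[OF mult_bij[OF T_coprime[OF j]]])
    finally show "\<sigma> j (cyc_norm x) = cyc_norm x" .
  qed
qed

lemma cyc_norm_nonzero: "cyc_norm x \<noteq> 0" if "x \<in> K" "x \<noteq> 0"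
  using that by (simp add: cyc_norm_def emb_eq_0_iff)

lemma cyc_norm_cofactor:
  assumes x: "x \<in> K"
  obtains y where "y \<in> K" "cyc_norm x = x * y"
proof -
  have 1: "Suc 0 \<in> T" using m_pos by simp
  have "cyc_norm x = \<sigma> (Suc 0) x * (\<Prod>k\<in>T - {Suc 0}. \<sigma> k x)"
    unfolding cyc_norm_def using 1 by (simp add: prod.remove)
  moreover have "(\<Prod>k\<in>T - {Suc 0}. \<sigma> k x) \<in> K"
    using emb_prod[of 1 "T - {Suc 0}" "\<lambda>k. \<sigma> k x"] emb_in_K T_coprime x by auto
  ultimately show thesis using that x by simp
qed

text \<open>The coordinate functionals of the chosen basis \<open>B\<close> are combinations of the
  embeddings, with coefficients \<open>W b k\<close>, and these are inverse to the matrix of the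
  \<open>\<sigma> k b\<close>. In these terms multiplication by \<open>x\<close> becomes diagonal
  with entries \<open>\<sigma> k x\<close>.\<close>

lemma cyc_trace_eq_sum_emb: "of_rat (cyc_trace m x) = (\<Sum>k\<in>T. \<sigma> k x)" if x: "x \<in> K"
proof -
  define B where "B = (SOME B. rat_complex.independent B \<and> rat_complex.span B = K)"
  have "\<exists>B. rat_complex.independent B \<and> rat_complex.span B = K"
    using rat_complex.maximal_independent_subset[of K] cyc_field_subspace
    by (metis rat_complex.span_minimal subset_antisym)
  hence B: "rat_complex.independent B" "rat_complex.span B = K"
    unfolding B_def by (metis (mono_tags, lifting) someI_ex)+
  have BK: "b \<in> K" if "b \<in> B" for b using that B(2) rat_complex.span_base by blast
  have "K \<subseteq> rat_complex.span ((\<lambda>i. \<zeta> ^ i) ` {..<d})"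
  proof
    fix y assume "y \<in> K"
    then obtain c :: "nat \<Rightarrow> rat" where c: "y = (\<Sum>i<d. of_rat (c i) * \<zeta> ^ i)"
      using K_coordinates by metis
    show "y \<in> rat_complex.span ((\<lambda>i. \<zeta> ^ i) ` {..<d})"
      unfolding c
        by (intro rat_complex.span_sum rat_complex.span_scale[OF rat_complex.span_base]) simp
  qed
  hence fin: "finite B"
    using rat_complex.independent_span_bound[of "(\<lambda>i. \<zeta> ^ i) ` {..<d}" B] B rat_complex.span_superset[of B] by auto
  define r where "r y b = rat_complex.representation B y b" for y b
  have r_sum: "(\<Sum>b\<in>B. of_rat (r y b) * b) = y" if "y \<in> K" for y
    unfolding r_def using rat_complex.sum_representation_eq[OF B(1) _ fin] that B by simp
  have r_lin: "r (\<Sum>i<d. of_rat (c i) * \<zeta> ^ i) b = (\<Sum>i<d. c i * r (\<zeta> ^ i) b)" for c b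
    unfolding r_def using B
    by (subst rat_complex.representation_sum)
      (auto simp: rat_complex.representation_scale cyc_field_mult cyc_field_of_rat)
  \<comment> \<open>Inverting the Vandermonde matrix expresses the coordinates in the powers of
    \<zeta> by embeddings; \<open>r\<close> then passes from these powers to
    \<open>B\<close>.\<close>
  define W where "W b k = (\<Sum>i<d. L k i * of_rat (r (\<zeta> ^ i) b))" for b k
  have W: "(\<Sum>k\<in>T. W b k * \<sigma> k y) = of_rat (r y b)" if y: "y \<in> K" for y b
  proof -
    obtain c :: "nat \<Rightarrow> rat" where c: "y = (\<Sum>i<d. of_rat (c i) * \<zeta> ^ i)"
      "\<And>k. coprime k m \<Longrightarrow> \<sigma> k y = (\<Sum>i<d. of_rat (c i) * \<zeta> ^ (k * i))"
      using K_coordinates[OF y] by metis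
    have "(\<Sum>k\<in>T. W b k * \<sigma> k y) =
       (\<Sum>k\<in>T. \<Sum>i<d. \<Sum>j<d. of_rat (r (\<zeta> ^ i) b) * (of_rat (c j) * (L k i * \<zeta> ^ (k * j))))"
    proof (intro sum.cong refl)
      fix k assume "k \<in> T"
      hence "W b k * \<sigma> k y
          = (\<Sum>i<d. L k i * of_rat (r (\<zeta> ^ i) b)) * (\<Sum>j<d. of_rat (c j) * \<zeta> ^ (k * j))"
        by (simp only: W_def c(2) T_coprime)
      thus "W b k * \<sigma> k y
          = (\<Sum>i<d. \<Sum>j<d. of_rat (r (\<zeta> ^ i) b) * (of_rat (c j) * (L k i * \<zeta> ^ (k * j))))"
        by (simp only: sum_product) (simp add: mult_ac)
    qed
    also have "\<dots>
        = (\<Sum>i<d. \<Sum>k\<in>T. \<Sum>j<d. of_rat (r (\<zeta> ^ i) b) * (of_rat (c j) * (L k i * \<zeta> ^ (k * j))))"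
      by (rule sum.swap)
    also have "\<dots>
        = (\<Sum>i<d. \<Sum>j<d. \<Sum>k\<in>T. of_rat (r (\<zeta> ^ i) b) * (of_rat (c j) * (L k i * \<zeta> ^ (k * j))))"
      by (intro sum.cong refl sum.swap)
    also have "\<dots> = (\<Sum>i<d. \<Sum>j<d. of_rat (r (\<zeta> ^ i) b) * (of_rat (c j) * (if i = j then 1 else 0)))"
      by (intro sum.cong refl) (simp only: sum_distrib_left[symmetric] lagrange_orthogonal_columns lessThan_iff)
    also have "\<dots> = (\<Sum>i<d. of_rat (r (\<zeta> ^ i) b) * of_rat (c i))"
      by (intro sum.cong refl) (simp add: sum.delta if_distrib cong: if_cong)
    also have "\<dots> = of_rat (r y b)"
      by (subst c(1)) (simp add: r_lin of_rat_sum of_rat_mult mult.commute)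
    finally show ?thesis .
  qed
  \<comment> \<open>This is the identity matrix: by \<open>s1\<close> it preserves the rows
    \<zeta>^(l j) of the Vandermonde matrix, and multiplying by the inverse matrix gives the
    diagonal entries in \<open>s2\<close>.\<close>
  define s where "s k l = (\<Sum>b\<in>B. W b k * \<sigma> l b)" for k l
  have s1: "(\<Sum>k\<in>T. s k l * \<zeta> ^ (k * j)) = \<zeta> ^ (l * j)" if l: "l \<in> T" for l j
  proof -
    have "(\<Sum>k\<in>T. s k l * \<zeta> ^ (k * j)) = (\<Sum>k\<in>T. \<Sum>b\<in>B. \<sigma> l b * (W b k * \<sigma> k (\<zeta> ^ j)))"
      unfolding s_def sum_distrib_right
      by (intro sum.cong refl) (simp add: emb_zeta_power T_coprime mult_ac)
    also have "\<dots> = (\<Sum>b\<in>B. \<sigma> l b * (\<Sum>k\<in>T. W b k * \<sigma> k (\<zeta> ^ j)))"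
      by (subst sum.swap) (simp add: sum_distrib_left)
    also have "\<dots> = (\<Sum>b\<in>B. \<sigma> l (of_rat (r (\<zeta> ^ j) b) * b))"
      by (intro sum.cong refl) (simp add: W emb_mult T_coprime l BK cyc_field_of_rat mult.commute)
    also have "\<dots> = \<sigma> l (\<Sum>b\<in>B. of_rat (r (\<zeta> ^ j) b) * b)"
      by (rule emb_sum[symmetric]) (simp_all add: T_coprime l BK cyc_field_of_rat cyc_field_mult)
    also have "\<dots> = \<zeta> ^ (l * j)" by (simp add: r_sum emb_zeta_power T_coprime l)
    finally show ?thesis .
  qed
  have s2: "s k k = 1" if k: "k \<in> T" for k
  proof -
    have "s k k = (\<Sum>l\<in>T. s l k * (if k = l then 1 else 0))"
      using k by (simp add: if_distrib cong: if_cong)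
    also have "\<dots> = (\<Sum>l\<in>T. s l k * (\<Sum>i<d. L k i * \<zeta> ^ (l * i)))"
      by (intro sum.cong refl) (simp only: lagrange_orthogonal_rows k)
    also have "\<dots> = (\<Sum>i<d. L k i * (\<Sum>l\<in>T. s l k * \<zeta> ^ (l * i)))"
      unfolding sum_distrib_left by (subst sum.swap) (simp add: mult_ac)
    also have "\<dots> = 1" using lagrange_orthogonal_rows[OF k k] by (simp add: s1 k)
    finally show ?thesis .
  qed
  have "of_rat (cyc_trace m x) = (\<Sum>b\<in>B. of_rat (r (x * b) b) :: complex)"
    unfolding cyc_trace_def B_def[symmetric] Let_def r_def by (simp add: of_rat_sum)
  also have "\<dots> = (\<Sum>b\<in>B. \<Sum>k\<in>T. \<sigma> k x * (W b k * \<sigma> k b))"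
    by (intro sum.cong refl) (simp add: W[symmetric] emb_mult T_coprime x BK cyc_field_mult mult_ac)
  also have "\<dots> = (\<Sum>k\<in>T. \<sigma> k x * s k k)"
    unfolding s_def sum_distrib_left by (rule sum.swap)
  also have "\<dots> = (\<Sum>k\<in>T. \<sigma> k x)" by (simp add: s2)
  finally show ?thesis .
qed

section \<open>An isometry onto \<open>\<real>\<^bsup>2\<phi>(m)\<^esup>\<close>\<close>

text \<open>
  The sum of the real and imaginary part makes all embeddings real coordinates at once: in
  \<open>\<Sum>\<^sub>k har k x * har k y\<close> the mixed terms at \<open>k\<close> and \<open>m - k\<close> cancel.
\<close>

definition har :: "nat \<Rightarrow> complex \<Rightarrow> real" where
  "har k x = Re (\<sigma> k x) + Im (\<sigma> k x)"

definition conj_norm :: "complex \<Rightarrow> real" where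
  "conj_norm x = (\<Sum>k\<in>T. (norm (\<sigma> k x))\<^sup>2)"

lemma complex_of_rat_real: "complex_of_real (of_rat q) = of_rat q"
  by (cases q) (simp add: of_rat_rat)

lemma trace_form_Re: "of_rat (cyc_trace m (x * cnj y)) = (\<Sum>k\<in>T. Re (\<sigma> k x * cnj (\<sigma> k y)))"
  if "x \<in> K" "y \<in> K"
proof -
  have "complex_of_real (of_rat (cyc_trace m (x * cnj y))) = (\<Sum>k\<in>T. \<sigma> k (x * cnj y))"
    unfolding complex_of_rat_real using that
      by (intro cyc_trace_eq_sum_emb cyc_field_mult cyc_field_cnj m_pos)
  also have "\<dots> = (\<Sum>k\<in>T. \<sigma> k x * cnj (\<sigma> k y))"
    using that by (intro sum.cong refl) (simp add: emb_mult emb_cnj T_coprime cyc_field_cnj m_pos)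
  finally have "Re (complex_of_real (of_rat (cyc_trace m (x * cnj y))))
      = Re (\<Sum>k\<in>T. \<sigma> k x * cnj (\<sigma> k y))"
    by (rule arg_cong)
  thus ?thesis by simp
qed

lemma trace_form_har: "of_rat (cyc_trace m (x * cnj y)) = (\<Sum>k\<in>T. har k x * har k y)"
  if x: "x \<in> K" and y: "y \<in> K"
proof -
  define M where "M k = Re (\<sigma> k x) * Im (\<sigma> k y) + Im (\<sigma> k x) * Re (\<sigma> k y)" for k
  have "(\<Sum>k\<in>T. M k) = (\<Sum>k\<in>T. M (m - k))"
    by (rule sum.reindex_bij_betw[OF reflect_bij, symmetric])
  also have "\<dots> = - (\<Sum>k\<in>T. M k)"
    unfolding sum_negf[symmetric] by (intro sum.cong refl) (simp add: M_def emb_reflect x y)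
  finally have M: "(\<Sum>k\<in>T. M k) = 0" by simp
  have "(\<Sum>k\<in>T. har k x * har k y) = (\<Sum>k\<in>T. Re (\<sigma> k x * cnj (\<sigma> k y)) + M k)"
    by (intro sum.cong refl) (simp add: har_def M_def algebra_simps)
  thus ?thesis using M by (simp add: sum.distrib trace_form_Re[OF x y])
qed

lemma conj_norm_eq_har: "conj_norm x = (\<Sum>k\<in>T. (har k x)\<^sup>2)" if "x \<in> K"
proof -
  have "conj_norm x = (\<Sum>k\<in>T. Re (\<sigma> k x * cnj (\<sigma> k x)))"
    unfolding conj_norm_def by (intro sum.cong refl) (simp add: cmod_def power2_eq_square)
  thus ?thesis using trace_form_Re[OF that that] trace_form_har[OF that that]
    by (simp add: power2_eq_square)
qed

lemma har_add: "har k (x + y) = har k x + har k y" if "k \<in> T" "x \<in> K" "y \<in> K"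
  using that by (simp add: har_def emb_add T_coprime)

lemma har_scale: "har k (of_rat a * x) = of_rat a * har k x" if "k \<in> T" "x \<in> K"
proof -
  have "\<sigma> k (of_rat a * x) = complex_of_real (of_rat a) * \<sigma> k x"
    using that by (simp add: emb_mult T_coprime cyc_field_of_rat complex_of_rat_real)
  thus ?thesis by (simp add: har_def algebra_simps)
qed

text \<open>A tensor is 0 at functionals outside \<open>cyc_Hom m\<close>, so membership has to be
  checked before evaluating. The equation is asked for on \<open>K\<close> only, because functionals
  such as \<open>\<lambda>y. of_rat (cyc_trace m (x * cnj y))\<close> are compared with the
  \<open>har k\<close> only there.\<close>

lemma har_combination_Hom: "f \<in> cyc_Hom m" if "\<And>x. x \<in> K \<Longrightarrow> f x = (\<Sum>k\<in>T. a k * har k x)"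
  unfolding cyc_Hom_def
proof safe
  show "f (x + y) = f x + f y" if "x \<in> K" "y \<in> K" for x y
    using that by (simp add: \<open>\<And>x. x \<in> K \<Longrightarrow> f x = _\<close> cyc_field_add har_add algebra_simps sum.distrib)
  show "f (of_rat q * x) = of_rat q * f x" if "x \<in> K" for q x
    using that
      by (simp add: \<open>\<And>x. x \<in> K \<Longrightarrow> f x = _\<close> cyc_field_mult cyc_field_of_rat har_scale sum_distrib_left mult.left_commute)
qed

lemma har_Hom: "har k \<in> cyc_Hom m" if "k \<in> T"
  using that unfolding cyc_Hom_def by (simp add: har_add har_scale)

lemma Hom_sum: "f (\<Sum>i\<in>I. of_rat (q i) * w i) = (\<Sum>i\<in>I. of_rat (q i) * f (w i))"
  if f: "f \<in> cyc_Hom m" and w: "\<And>i. i \<in> I \<Longrightarrow> w i \<in> K"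
proof -
  have add: "f (x + y) = f x + f y" if "x \<in> K" "y \<in> K" for x y using f that
    by (simp add: cyc_Hom_def)
  have scale: "f (of_rat a * x) = of_rat a * f x" if "x \<in> K" for a x using f that
    by (simp add: cyc_Hom_def)
  have 0: "f 0 = 0" using scale[of 0 0] by simp
  show ?thesis using w
    by (induction I rule: infinite_finite_induct)
      (simp_all add: 0 add scale cyc_field_sum cyc_field_mult cyc_field_of_rat)
qed

text \<open>Dividing by \<open>x\<close> in \<open>K\<close> is possible since its norm is rational and a multiple of \<open>x\<close>.\<close>

lemma K_coordinates_multiple:
  assumes x: "x \<in> K" "x \<noteq> 0" and y: "y \<in> K"
  obtains c :: "nat \<Rightarrow> rat" where "y = (\<Sum>j<d. of_rat (c j) * (x * \<zeta> ^ j))"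
proof -
  obtain N where N: "cyc_norm x = of_rat N" using cyc_norm_rat[OF x(1)] by (auto elim: Rats_cases)
  obtain z where z: "z \<in> K" "cyc_norm x = x * z" using cyc_norm_cofactor[OF x(1)] by blast
  have N0: "(of_rat N :: complex) \<noteq> 0" using cyc_norm_nonzero[OF x] N by simp
  obtain c :: "nat \<Rightarrow> rat" where c: "z * y = (\<Sum>i<d. of_rat (c i) * \<zeta> ^ i)"
    using K_coordinates[OF cyc_field_mult[OF z(1) y]] by metis
  have "of_rat N * y = x * (z * y)" using N z by simp
  hence "y = x * (z * y) / of_rat N" using N0 by (simp add: field_simps)
  also have "\<dots> = (\<Sum>i<d. of_rat (c i / N) * (x * \<zeta> ^ i))"
    unfolding c by (simp add: sum_distrib_left sum_divide_distrib of_rat_divide mult_ac)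
  finally show thesis by (rule that)
qed

lemma KR_iff_multiple:
  assumes x: "x \<in> K" "x \<noteq> 0"
  shows "t \<in> cyc_KR m \<longleftrightarrow>
    (\<exists>A. t = (\<lambda>f. if f \<in> cyc_Hom m then (\<Sum>i<d. A i * f (x * \<zeta> ^ i)) else 0))"
proof
  assume "t \<in> cyc_KR m"
  then obtain S c where S: "finite S" "S \<subseteq> K" "t = (\<lambda>f. \<Sum>y\<in>S. pure_tensor m y (c y) f)"
    by (auto simp: cyc_KR_def)
  have "\<forall>y\<in>S. \<exists>q :: nat \<Rightarrow> rat. y = (\<Sum>j<d. of_rat (q j) * (x * \<zeta> ^ j))"
    using K_coordinates_multiple[OF x] S(2) by (metis subsetD)
  then obtain q :: "complex \<Rightarrow> nat \<Rightarrow> rat"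
    where q: "\<And>y. y \<in> S \<Longrightarrow> y = (\<Sum>j<d. of_rat (q y j) * (x * \<zeta> ^ j))"
    by metis
  define A where "A i = (\<Sum>y\<in>S. c y * of_rat (q y i))" for i
  have "t f = (\<Sum>i<d. A i * f (x * \<zeta> ^ i))" if f: "f \<in> cyc_Hom m" for f
  proof -
    have "t f = (\<Sum>y\<in>S. c y * f y)" using f by (simp add: S pure_tensor_def)
    also have "\<dots> = (\<Sum>y\<in>S. \<Sum>i<d. c y * of_rat (q y i) * f (x * \<zeta> ^ i))"
    proof (intro sum.cong refl)
      fix y assume y: "y \<in> S"
      have "f y = f (\<Sum>j<d. of_rat (q y j) * (x * \<zeta> ^ j))" using q[OF y] by simp
      also have "\<dots> = (\<Sum>j<d. of_rat (q y j) * f (x * \<zeta> ^ j))"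
        by (rule Hom_sum[OF f]) (simp add: cyc_field_mult x)
      finally show "c y * f y = (\<Sum>i<d. c y * of_rat (q y i) * f (x * \<zeta> ^ i))"
        by (simp add: sum_distrib_left mult_ac)
    qed
    also have "\<dots> = (\<Sum>i<d. A i * f (x * \<zeta> ^ i))"
      unfolding A_def sum_distrib_right by (rule sum.swap)
    finally show ?thesis .
  qed
  moreover have "t f = 0" if "f \<notin> cyc_Hom m" for f
    using that by (simp add: S pure_tensor_def)
  ultimately show "\<exists>A. t = (\<lambda>f. if f \<in> cyc_Hom m then (\<Sum>i<d. A i * f (x * \<zeta> ^ i)) else 0)"
    by (intro exI[of _ A]) auto
next
  assume "\<exists>A. t = (\<lambda>f. if f \<in> cyc_Hom m then (\<Sum>i<d. A i * f (x * \<zeta> ^ i)) else 0)"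
  then obtain A where A: "t = (\<lambda>f. if f \<in> cyc_Hom m then (\<Sum>i<d. A i * f (x * \<zeta> ^ i)) else 0)"
    by blast
  define g where "g i = x * \<zeta> ^ i" for i
  \<comment> \<open>Elements of \<open>cyc_KR\<close> are sums indexed by a set of field elements,
    so the vectors x \<zeta>^i must be distinct; they are because d <= m.\<close>
  have inj: "inj_on g {..<d}"
  proof -
    have "inj_on (\<lambda>i. \<zeta> ^ i) {..<d}"
      using zeta_power_inj[OF m_pos] totient_le[of m] by (auto intro: inj_on_subset)
    thus ?thesis using x by (auto simp: inj_on_def g_def)
  qed
  have "t = (\<lambda>f. \<Sum>y\<in>g ` {..<d}. pure_tensor m y (A (inv_into {..<d} g y)) f)"
  proof
    fix f
    have "(\<Sum>y\<in>g ` {..<d}. pure_tensor m y (A (inv_into {..<d} g y)) f) =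
       (\<Sum>i<d. pure_tensor m (g i) (A (inv_into {..<d} g (g i))) f)"
      by (simp add: sum.reindex[OF inj])
    also have "\<dots> = (\<Sum>i<d. pure_tensor m (g i) (A i) f)"
      by (intro sum.cong refl) (simp add: inv_into_f_f[OF inj])
    also have "\<dots> = t f" by (simp add: A pure_tensor_def g_def)
    finally show "t f = (\<Sum>y\<in>g ` {..<d}. pure_tensor m y (A (inv_into {..<d} g y)) f)" by simp
  qed
  moreover have "g ` {..<d} \<subseteq> K" using x by (auto simp: g_def cyc_field_mult)
  ultimately show "t \<in> cyc_KR m" unfolding cyc_KR_def
    by (intro CollectI exI[of _ "g ` {..<d}"] exI[of _ "\<lambda>y. A (inv_into {..<d} g y)"]) simp
qed

lemma KR_iff:
  "t \<in> cyc_KR m \<longleftrightarrow> (\<exists>A. t = (\<lambda>f. if f \<in> cyc_Hom m then (\<Sum>i<d. A i * f (\<zeta> ^ i)) else 0))"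
  by (rule KR_iff_multiple[of 1 t, unfolded mult_1]) simp_all

lemma KR_add: "(\<lambda>f. t f + u f) \<in> cyc_KR m" if tu: "t \<in> cyc_KR m" "u \<in> cyc_KR m"
proof -
  obtain A B where "t = (\<lambda>f. if f \<in> cyc_Hom m then (\<Sum>i<d. A i * f (\<zeta> ^ i)) else 0)"
    "u = (\<lambda>f. if f \<in> cyc_Hom m then (\<Sum>i<d. B i * f (\<zeta> ^ i)) else 0)"
    using tu unfolding KR_iff by blast
  thus ?thesis unfolding KR_iff
    by (intro exI[of _ "\<lambda>i. A i + B i"]) (auto simp: algebra_simps sum.distrib)
qed

lemma KR_scale: "(\<lambda>f. a * t f) \<in> cyc_KR m" if t: "t \<in> cyc_KR m"
proof -
  obtain A where "t = (\<lambda>f. if f \<in> cyc_Hom m then (\<Sum>i<d. A i * f (\<zeta> ^ i)) else 0)"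
    using t unfolding KR_iff by blast
  thus ?thesis unfolding KR_iff
    by (intro exI[of _ "\<lambda>i. a * A i"]) (auto simp: algebra_simps sum_distrib_left)
qed

lemma KR_pure_tensor: "pure_tensor m x r \<in> cyc_KR m" if "x \<in> K"
  using that by (auto simp: cyc_KR_def intro!: exI[of _ "{x}"] exI[of _ "\<lambda>_. r"])

lemma KR_linear:
  assumes t: "t \<in> cyc_KR m" and g: "\<And>k. k \<in> T \<Longrightarrow> g k \<in> cyc_Hom m" and f: "f \<in> cyc_Hom m"
    and fg: "\<And>x. x \<in> K \<Longrightarrow> f x = (\<Sum>k\<in>T. a k * g k x)"
  shows "t f = (\<Sum>k\<in>T. a k * t (g k))"
proof -
  obtain A where A: "t = (\<lambda>f. if f \<in> cyc_Hom m then (\<Sum>i<d. A i * f (\<zeta> ^ i)) else 0)"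
    using t unfolding KR_iff by blast
  have "t f = (\<Sum>i<d. \<Sum>k\<in>T. a k * (A i * g k (\<zeta> ^ i)))"
    using f by (simp add: A fg sum_distrib_left mult_ac)
  also have "\<dots> = (\<Sum>k\<in>T. a k * (\<Sum>i<d. A i * g k (\<zeta> ^ i)))"
    unfolding sum_distrib_left by (rule sum.swap)
  also have "\<dots> = (\<Sum>k\<in>T. a k * t (g k))" using g by (simp add: A)
  finally show ?thesis .
qed

lemma KR_inner_har: "KR_inner m t u = (\<Sum>k\<in>T. t (har k) * u (har k))"
  if t: "t \<in> cyc_KR m" and u: "u \<in> cyc_KR m"
proof -
  have 1: "u (\<lambda>y. of_rat (cyc_trace m (x * cnj y))) = (\<Sum>k\<in>T. u (har k) * har k x)" if x: "x \<in> K"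
    for x
  proof -
    have e: "real_of_rat (cyc_trace m (x * cnj y)) = (\<Sum>k\<in>T. har k x * har k y)" if "y \<in> K" for y
      by (rule trace_form_har[OF x that])
    show ?thesis
      using KR_linear[OF u har_Hom har_combination_Hom[OF e] e] by (simp add: mult.commute)
  qed
  show ?thesis
    unfolding KR_inner_def using KR_linear[OF t har_Hom har_combination_Hom[OF 1] 1]
      by (simp add: mult.commute)
qed

text \<open>The polynomial with the real coefficients \<open>A i - B i\<close> takes values
  \<open>P k\<close> with Re + Im = 0. At m - k the value is the conjugate, which gives Re - Im = 0,
  so the polynomial vanishes at all conjugates.\<close>

lemma KR_eqI: "t = u"
  if t: "t \<in> cyc_KR m" and u: "u \<in> cyc_KR m" and eq: "\<And>k. k \<in> T \<Longrightarrow> t (har k) = u (har k)"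
proof -
  obtain A where A: "t = (\<lambda>f. if f \<in> cyc_Hom m then (\<Sum>i<d. A i * f (\<zeta> ^ i)) else 0)"
    using t unfolding KR_iff by blast
  obtain B where B: "u = (\<lambda>f. if f \<in> cyc_Hom m then (\<Sum>i<d. B i * f (\<zeta> ^ i)) else 0)"
    using u unfolding KR_iff by blast
  define P where "P k = (\<Sum>i<d. complex_of_real (A i - B i) * \<zeta> ^ (k * i))" for k
  have h: "Re (P k) + Im (P k) = 0" if k: "k \<in> T" for k
  proof -
    have "(\<Sum>i<d. (A i - B i) * har k (\<zeta> ^ i)) = 0"
      using eq[OF k] har_Hom[OF k] by (simp add: A B left_diff_distrib sum_subtractf)
    also have "(\<Sum>i<d. (A i - B i) * har k (\<zeta> ^ i)) = Re (P k) + Im (P k)"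
      unfolding P_def har_def Re_sum Im_sum sum.distrib[symmetric]
      by (intro sum.cong refl) (simp add: emb_zeta_power T_coprime[OF k] distrib_left)
    finally show ?thesis .
  qed
  have refl: "P (m - k) = cnj (P k)" if k: "k \<in> T" for k
  proof -
    have "\<zeta> ^ ((m - k) * i) = cnj (\<zeta> ^ (k * i))" for i
      using cnj_zeta_power[of k m] k m_pos totatives_le by (simp add: power_mult)
    thus ?thesis by (simp add: P_def)
  qed
  have "P k = 0" if k: "k \<in> T" for k
    using h[OF k] h[OF T_reflect[OF k]] refl[OF k] by (simp add: complex_eq_iff)
  hence "complex_of_real (A i - B i) = 0" if "i < d" for i
    using vanishing_at_conjugates[OF _ that, of "\<lambda>i. complex_of_real (A i - B i)"]
      by (simp add: P_def)
  hence "A i = B i" if "i < d" for i using that by simp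
  thus ?thesis by (auto simp: A B)
qed

lemma KR_exists_har:
  fixes v :: "nat \<Rightarrow> real"
  obtains t where "t \<in> cyc_KR m" "\<And>k. k \<in> T \<Longrightarrow> t (har k) = v k"
proof -
  \<comment> \<open>The only values with Re + Im = \<open>v k\<close> that are compatible with
    conjugation, \<open>z (m - k) = cnj (z k)\<close>.\<close>
  define z where "z k = Complex ((v k + v (m - k)) / 2) ((v k - v (m - k)) / 2)" for k
  have zr: "z (m - k) = cnj (z k)" if "k \<in> T" for k
    using totatives_le[OF that] by (simp add: z_def complex_eq_iff field_simps)
  define a where "a i = (\<Sum>l\<in>T. z l * L l i)" for i
  have az: "(\<Sum>i<d. a i * \<zeta> ^ (k * i)) = z k" if k: "k \<in> T" for k
  proof -
    have "(\<Sum>i<d. a i * \<zeta> ^ (k * i)) = (\<Sum>i<d. \<Sum>l\<in>T. z l * (L l i * \<zeta> ^ (k * i)))"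
      unfolding a_def sum_distrib_right by (simp add: mult.assoc)
    also have "\<dots> = (\<Sum>l\<in>T. z l * (\<Sum>i<d. L l i * \<zeta> ^ (k * i)))"
      unfolding sum_distrib_left by (rule sum.swap)
    also have "\<dots> = (\<Sum>l\<in>T. z l * (if l = k then 1 else 0))"
      by (intro sum.cong refl) (simp only: lagrange_orthogonal_rows k)
    also have "\<dots> = z k" using k by (simp add: if_distrib cong: if_cong)
    finally show ?thesis .
  qed
  \<comment> \<open>By the symmetry of \<open>z\<close>, the conjugate coefficients solve the same
    interpolation problem, so the coefficients are real.\<close>
  have "a j - cnj (a j) = 0" if j: "j < d" for j
  proof (rule vanishing_at_conjugates[OF _ j])
    fix k assume k: "k \<in> T"
    have "\<zeta> ^ k = cnj (\<zeta> ^ (m - k))"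
      using cnj_zeta_power[of "m - k" m] totatives_le[OF k] m_pos by simp
    hence "\<zeta> ^ (k * i) = cnj (\<zeta> ^ ((m - k) * i))" for i
      by (simp only: power_mult complex_cnj_power)
    hence "(\<Sum>i<d. cnj (a i) * \<zeta> ^ (k * i)) = cnj (\<Sum>i<d. a i * \<zeta> ^ ((m - k) * i))" by simp
    also have "\<dots> = z k" using az[OF T_reflect[OF k]] zr[OF k] by simp
    finally show "(\<Sum>i<d. (a i - cnj (a i)) * \<zeta> ^ (k * i)) = 0"
      using az[OF k] by (simp add: left_diff_distrib sum_subtractf)
  qed
  hence real: "complex_of_real (Re (a i)) = a i" if "i < d" for i
    using that by (simp add: complex_eq_iff)
  define t where "t = (\<lambda>f. if f \<in> cyc_Hom m then (\<Sum>i<d. Re (a i) * f (\<zeta> ^ i)) else 0)"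
  show thesis
  proof (rule that)
    show "t \<in> cyc_KR m" unfolding KR_iff t_def by (rule exI[of _ "\<lambda>i. Re (a i)"]) simp
    fix k assume k: "k \<in> T"
    have "t (har k) = (\<Sum>i<d. Re (a i) * har k (\<zeta> ^ i))" using har_Hom[OF k] by (simp add: t_def)
    also have "\<dots>
        = Re (\<Sum>i<d. complex_of_real (Re (a i)) * \<zeta> ^ (k * i)) + Im (\<Sum>i<d. complex_of_real (Re (a i)) * \<zeta> ^ (k * i))"
      unfolding har_def by (simp add: emb_zeta_power T_coprime[OF k] algebra_simps sum.distrib)
    also have "(\<Sum>i<d. complex_of_real (Re (a i)) * \<zeta> ^ (k * i)) = z k"
      unfolding az[OF k, symmetric] by (intro sum.cong refl) (simp add: real)
    also have "Re (z k) + Im (z k) = v k" by (simp add: z_def field_simps)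
    finally show "t (har k) = v k" .
  qed
qed

lemma sum_lessThan_double: "(\<Sum>i<2 * k. g i) = (\<Sum>i<k. g i) + (\<Sum>i<k. g (k + i))"
  for g :: "nat \<Rightarrow> real"
proof -
  have "(\<Sum>i<2 * k. g i) = (\<Sum>i<k. g i) + (\<Sum>i=k..<2 * k. g i)"
    using sum.atLeastLessThan_concat[of 0 k "2 * k" g] by (simp add: atLeast0LessThan)
  also have "(\<Sum>i=k..<2 * k. g i) = (\<Sum>i=0..<k. g (i + k))"
    using sum.shift_bounds_nat_ivl[of g 0 k k] by (simp add: mult_2)
  finally show ?thesis by (simp add: atLeast0LessThan add.commute)
qed

text \<open>This gives the choice in \<open>E_to_Rn\<close> its meaning. The values at the
  functionals \<open>har k\<close>, for both components, are orthonormal coordinates.\<close>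

lemma E_isometry_exists: "\<exists>\<iota>. E_isometry m \<iota>"
proof -
  obtain e where e: "bij_betw e {..<d} T"
    using ex_bij_betw_nat_finite[of T] card_T by (auto simp: atLeast0LessThan)
  define \<iota> :: "tensor \<times> tensor \<Rightarrow> nat \<Rightarrow> real" where
    "\<iota> v = (\<lambda>i\<in>{..<2 * d}. if i < d then fst v (har (e i)) else snd v (har (e (i - d))))" for v
  have eT: "e i \<in> T" if "i < d" for i using e that by (auto simp: bij_betw_def)
  have "E_isometry m \<iota>"
    unfolding E_isometry_def
  proof (intro conjI ballI allI)
    show "bij_betw \<iota> (cyc_E m) (Rn (2 * d))"
    proof (intro bij_betw_imageI inj_onI equalityI subsetI)
      fix v w assume v: "v \<in> cyc_E m" and w: "w \<in> cyc_E m" and eq: "\<iota> v = \<iota> w"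
      have c: "\<iota> v i = \<iota> w i" for i by (simp add: eq)
      have "fst v (har k) = fst w (har k) \<and> snd v (har k) = snd w (har k)" if "k \<in> T" for k
      proof -
        obtain i where i: "i < d" "k = e i" using e \<open>k \<in> T\<close> by (auto simp: bij_betw_def)
        show ?thesis using c[of i] c[of "d + i"] i by (simp add: \<iota>_def)
      qed
      hence "fst v = fst w" "snd v = snd w"
        using v w by (auto simp: cyc_E_def intro!: KR_eqI)
      thus "v = w" by (simp add: prod_eq_iff)
    next
      fix y assume y: "y \<in> Rn (2 * d)"
      define e' where "e' = inv_into {..<d} e"
      have e': "e' (e i) = i" if "i < d" for i
        using e that by (simp add: e'_def bij_betw_def inv_into_f_f)
      obtain t where t: "t \<in> cyc_KR m" "\<And>k. k \<in> T \<Longrightarrow> t (har k) = y (e' k)"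
        using KR_exists_har[of "\<lambda>k. y (e' k)"] by blast
      obtain u where u: "u \<in> cyc_KR m" "\<And>k. k \<in> T \<Longrightarrow> u (har k) = y (d + e' k)"
        using KR_exists_har[of "\<lambda>k. y (d + e' k)"] by blast
      have "\<iota> (t, u) i = y i" if "i < 2 * d" for i
        using that by (auto simp: \<iota>_def t(2) u(2) eT e')
      moreover have "\<iota> (t, u) \<in> Rn (2 * d)" by (simp add: \<iota>_def Rn_def)
      ultimately have "\<iota> (t, u) = y"
        using y unfolding Rn_def by (intro PiE_ext[of _ "{..<2*d}" "\<lambda>_. UNIV"]) auto
      thus "y \<in> \<iota> ` cyc_E m" using t u by (auto simp: cyc_E_def)
    next
      fix y assume "y \<in> \<iota> ` cyc_E m"
      then obtain v where "y = \<iota> v" by blast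
      thus "y \<in> Rn (2 * d)" by (simp add: \<iota>_def Rn_def)
    qed
    fix v w assume vw: "v \<in> cyc_E m" "w \<in> cyc_E m"
    have "(\<Sum>i<2 * d. \<iota> v i * \<iota> w i) =
      (\<Sum>i<d. fst v (har (e i)) * fst w (har (e i))) + (\<Sum>i<d. snd v (har (e i)) * snd w (har (e i)))"
      by (simp add: sum_lessThan_double \<iota>_def)
    also have "\<dots> = (\<Sum>k\<in>T. fst v (har k) * fst w (har k)) + (\<Sum>k\<in>T. snd v (har k) * snd w (har k))"
      by (simp only: sum.reindex_bij_betw[OF e, of "\<lambda>k. fst v (har k) * fst w (har k)"]
          sum.reindex_bij_betw[OF e, of "\<lambda>k. snd v (har k) * snd w (har k)"])
    also have "\<dots> = E_inner m v w"
      using vw by (auto simp: E_inner_def cyc_E_def KR_inner_har)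
    finally show "(\<Sum>i<2 * d. \<iota> v i * \<iota> w i) = E_inner m v w" .
  next
    show "\<iota> (E_add v w) = (\<lambda>i\<in>{..<2 * d}. \<iota> v i + \<iota> w i)" for v w
      unfolding \<iota>_def E_add_def by (rule restrict_ext) simp
    show "\<iota> (E_scale a v) = (\<lambda>i\<in>{..<2 * d}. a * \<iota> v i)" for a v
      unfolding \<iota>_def E_scale_def by (rule restrict_ext) simp
  qed
  thus ?thesis by blast
qed

lemma E_to_Rn_isometry: "E_isometry m (E_to_Rn m)"
  unfolding E_to_Rn_def by (rule someI_ex[OF E_isometry_exists])

section \<open>The embedding of pairs of field elements into \<real>^n\<close>

abbreviation "n \<equiv> 2 * d"

definition \<Phi> :: "complex \<Rightarrow> complex \<Rightarrow> nat \<Rightarrow> real" where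
  "\<Phi> x y = E_to_Rn m (pure_tensor m x 1, pure_tensor m y 1)"

lemma iso_add: "E_to_Rn m (E_add v w) = add_Rn n (E_to_Rn m v) (E_to_Rn m w)"
  if "v \<in> cyc_E m" "w \<in> cyc_E m"
  using E_to_Rn_isometry that unfolding E_isometry_def by blast

lemma iso_scale: "E_to_Rn m (E_scale a v) = (\<lambda>i\<in>{..<n}. a * E_to_Rn m v i)" if "v \<in> cyc_E m"
  using E_to_Rn_isometry that unfolding E_isometry_def by blast

lemma iso_in_Rn: "E_to_Rn m v \<in> Rn n" if "v \<in> cyc_E m"
  using E_to_Rn_isometry that unfolding E_isometry_def bij_betw_def by blast

lemma E_pure_tensor: "(pure_tensor m x r, pure_tensor m y s) \<in> cyc_E m" if "x \<in> K" "y \<in> K"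
  using that by (simp add: cyc_E_def KR_pure_tensor)

lemma E_scale_mem: "E_scale a v \<in> cyc_E m" if "v \<in> cyc_E m"
  using that by (auto simp: E_scale_def cyc_E_def intro: KR_scale)

lemma pure_tensor_diff:
  "pure_tensor m (x - y) 1 = (\<lambda>f. pure_tensor m x 1 f + (-1) * pure_tensor m y 1 f)"
    if "x \<in> K" "y \<in> K"
proof
  fix f
  have "x - y = (\<Sum>i\<in>{0, 1::nat}. of_rat (if i = 0 then 1 else - 1) * (if i = 0 then x else y))"
    by (simp add: of_rat_minus)
  hence "f (x - y) = f x - f y" if "f \<in> cyc_Hom m"
    using Hom_sum[OF that, of "{0,1::nat}" "\<lambda>i. if i = 0 then x else y" "\<lambda>i. if i
        = 0 then 1 else - 1"] \<open>x \<in> K\<close> \<open>y \<in> K\<close>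
    by (simp add: of_rat_minus)
  thus "pure_tensor m (x - y) 1 f = pure_tensor m x 1 f + (-1) * pure_tensor m y 1 f"
    by (simp add: pure_tensor_def)
qed

lemma \<Phi>_diff: "\<Phi> (x - x') (y - y') = sub_Rn n (\<Phi> x y) (\<Phi> x' y')"
  if "x \<in> K" "x' \<in> K" "y \<in> K" "y' \<in> K"
proof -
  have E: "(pure_tensor m x 1, pure_tensor m y 1) \<in> cyc_E m"
    "(pure_tensor m x' 1, pure_tensor m y' 1) \<in> cyc_E m"
    using that by (auto intro: E_pure_tensor)
  have E': "E_scale (-1) (pure_tensor m x' 1, pure_tensor m y' 1) \<in> cyc_E m"
    by (rule E_scale_mem[OF E(2)])
  have "(pure_tensor m (x - x') 1, pure_tensor m (y - y') 1) =
    E_add (pure_tensor m x 1, pure_tensor m y 1) (E_scale (-1) (pure_tensor m x' 1, pure_tensor m y' 1))"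
    by (simp add: E_add_def E_scale_def pure_tensor_diff that)
  hence "\<Phi> (x - x') (y - y') = add_Rn n (\<Phi> x y) (\<lambda>i\<in>{..<n}. (-1) * \<Phi> x' y' i)"
    unfolding \<Phi>_def by (simp only: iso_add[OF E(1) E'] iso_scale[OF E(2)])
  thus ?thesis by (simp only:) (rule restrict_ext, simp)
qed

lemma \<Phi>_in_Rn: "\<Phi> x y \<in> Rn n" if "x \<in> K" "y \<in> K"
  unfolding \<Phi>_def using that by (intro iso_in_Rn E_pure_tensor)

lemma \<Phi>_norm: "(norm_Rn n (\<Phi> x y))\<^sup>2 = conj_norm x + conj_norm y" if "x \<in> K" "y \<in> K"
proof -
  have E: "(pure_tensor m x 1, pure_tensor m y 1) \<in> cyc_E m" using that by (rule E_pure_tensor)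
  have t: "of_rat (cyc_trace m (z * cnj z)) = conj_norm z" if "z \<in> K" for z
    using trace_form_har[OF that that] conj_norm_eq_har[OF that] by (simp add: power2_eq_square)
  have "(\<Sum>i<n. \<Phi> x y i * \<Phi> x y i)
      = E_inner m (pure_tensor m x 1, pure_tensor m y 1) (pure_tensor m x 1, pure_tensor m y 1)"
    using E_to_Rn_isometry E unfolding E_isometry_def \<Phi>_def by blast
  also have "\<dots> = conj_norm x + conj_norm y"
    using that m_pos by (simp add: E_inner_def KR_inner_pure_tensor t)
  finally show ?thesis unfolding norm_Rn_square by (simp add: power2_eq_square)
qed

lemma conj_norm_nonneg: "0 \<le> conj_norm x"
  by (simp add: conj_norm_def sum_nonneg)

lemma conj_norm_0 [simp]: "conj_norm 0 = 0"
  by (simp add: conj_norm_def T_coprime)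

lemma conj_norm_1 [simp]: "conj_norm 1 = real d"
  by (simp add: conj_norm_def T_coprime card_T)

lemma conj_norm_mult_zeta_power: "conj_norm (x * \<zeta> ^ i) = conj_norm x" if "x \<in> K"
  unfolding conj_norm_def
  by (intro sum.cong refl) (simp add: emb_mult emb_zeta_power T_coprime that norm_mult)

lemma conj_norm_pos: "conj_norm x > 0" if "x \<in> K" "x \<noteq> 0"
  unfolding conj_norm_def using that m_pos by (intro sum_pos) (auto simp: emb_eq_0_iff)

lemma \<Phi>_0: "\<Phi> 0 0 = zero_Rn n"
proof -
  have "norm_Rn n (\<Phi> 0 0) = 0" using \<Phi>_norm[of 0 0] by simp
  hence "\<Phi> 0 0 i = 0" if "i < n" for i
    using that unfolding norm_Rn_def by (subst (asm) L2_set_eq_0_iff) auto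
  thus ?thesis by (intro Rn_eqI[of _ n]) (auto simp: \<Phi>_in_Rn zero_Rn_def)
qed

lemma \<Phi>_eq_iff: "\<Phi> x y = \<Phi> x' y' \<longleftrightarrow> x = x' \<and> y = y'"
  if "x \<in> K" "y \<in> K" "x' \<in> K" "y' \<in> K"
proof
  have neg: "- z \<in> K" if "z \<in> K" for z using cyc_field_mult[OF of_int_in_K[of "-1"] that] by simp
  have K: "x - x' \<in> K" "y - y' \<in> K"
    using cyc_field_add[OF that(1) neg[OF that(3)]] cyc_field_add[OF that(2) neg[OF that(4)]]
      by simp_all
  assume "\<Phi> x y = \<Phi> x' y'"
  hence "\<Phi> (x - x') (y - y') = zero_Rn n"
    unfolding \<Phi>_diff[OF that(1,3,2,4)] by (simp add: zero_Rn_def)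
  hence "conj_norm (x - x') + conj_norm (y - y') = 0" using \<Phi>_norm[OF K] by simp
  thus "x = x' \<and> y = y'"
    using conj_norm_pos[OF K(1)] conj_norm_pos[OF K(2)] conj_norm_nonneg[of "x - x'"] conj_norm_nonneg[of "y - y'"]
    by fastforce
qed simp

lemma iso_sum:
  assumes "finite J" "\<And>j. j \<in> J \<Longrightarrow> v j \<in> cyc_E m"
  shows "(\<lambda>f. \<Sum>j\<in>J. c j * fst (v j) f, \<lambda>f. \<Sum>j\<in>J. c j * snd (v j) f) \<in> cyc_E m \<and>
    E_to_Rn m (\<lambda>f. \<Sum>j\<in>J. c j * fst (v j) f, \<lambda>f. \<Sum>j\<in>J. c j * snd (v j) f)
      = (\<lambda>i\<in>{..<n}. \<Sum>j\<in>J. c j * E_to_Rn m (v j) i)"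
  using assms
proof (induction J rule: finite_induct)
  case empty
  have z: "E_scale 0 (pure_tensor m 0 1, pure_tensor m 0 1) = (\<lambda>f. 0, \<lambda>f. 0)"
    by (simp add: E_scale_def)
  have "(\<lambda>f. 0, \<lambda>f. 0) \<in> cyc_E m"
    using KR_scale[OF KR_pure_tensor[OF zero_in_K], of 0 1] by (simp add: cyc_E_def)
  moreover have "E_to_Rn m (\<lambda>f. 0, \<lambda>f. 0) = (\<lambda>i\<in>{..<n}. 0)"
    using iso_scale[OF E_pure_tensor[OF zero_in_K zero_in_K, of 1 1], of 0] unfolding z by simp
  ultimately show ?case by simp
next
  case (insert b J)
  define s where "s = (\<lambda>f. \<Sum>j\<in>J. c j * fst (v j) f, \<lambda>f. \<Sum>j\<in>J. c j * snd (v j) f)"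
  have s: "s \<in> cyc_E m" "E_to_Rn m s = (\<lambda>i\<in>{..<n}. \<Sum>j\<in>J. c j * E_to_Rn m (v j) i)"
    using insert unfolding s_def by blast+
  have b: "v b \<in> cyc_E m" using insert by blast
  have sb: "E_scale (c b) (v b) \<in> cyc_E m"
    by (rule E_scale_mem[OF b])
  have eq: "(\<lambda>f. \<Sum>j\<in>insert b J. c j * fst (v j) f, \<lambda>f. \<Sum>j\<in>insert b J. c j * snd (v j) f)
    = E_add (E_scale (c b) (v b)) s"
    using insert.hyps by (simp add: E_add_def E_scale_def s_def)
  have "E_add (E_scale (c b) (v b)) s \<in> cyc_E m"
    using sb s(1) by (auto simp: E_add_def cyc_E_def KR_add)
  moreover have "E_to_Rn m (E_add (E_scale (c b) (v b)) s)
      = (\<lambda>i\<in>{..<n}. \<Sum>j\<in>insert b J. c j * E_to_Rn m (v j) i)"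
    unfolding iso_add[OF sb s(1)] iso_scale[OF b] s(2) using insert.hyps
    by (intro restrict_ext) simp
  ultimately show ?case unfolding eq by blast
qed

text \<open>Rounding the coordinates with respect to the \<open>n\<close> vectors \<open>(x\<zeta>\<^sup>j, 0)\<close> and \<open>(0, x\<zeta>\<^sup>j)\<close>, all of the same norm.\<close>

lemma close_multiple:
  assumes x: "x \<in> K" "x \<noteq> 0" and z: "z \<in> Rn n"
  obtains k l :: "nat \<Rightarrow> int" where
    "(norm_Rn n (sub_Rn n z (\<Phi> (x * (\<Sum>j<d. of_int (k j) * \<zeta> ^ j)) (x * (\<Sum>j<d. of_int (l j) * \<zeta> ^ j)))))\<^sup>2
      \<le> real d * conj_norm x / 2"
proof -
  have "z \<in> E_to_Rn m ` cyc_E m"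
    using E_to_Rn_isometry z unfolding E_isometry_def bij_betw_def by blast
  then obtain t u where tu: "z = E_to_Rn m (t, u)" "t \<in> cyc_KR m" "u \<in> cyc_KR m"
    by (auto simp: cyc_E_def)
  obtain A where A: "t = (\<lambda>f. if f \<in> cyc_Hom m then (\<Sum>i<d. A i * f (x * \<zeta> ^ i)) else 0)"
    using tu(2) KR_iff_multiple[OF x] by blast
  obtain B where B: "u = (\<lambda>f. if f \<in> cyc_Hom m then (\<Sum>i<d. B i * f (x * \<zeta> ^ i)) else 0)"
    using tu(3) KR_iff_multiple[OF x] by blast
  define w where "w j = (if j < d then (x * \<zeta> ^ j, 0) else (0, x * \<zeta> ^ (j - d)))" for j
  define v where "v j = (pure_tensor m (fst (w j)) 1, pure_tensor m (snd (w j)) 1)" for j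
  have wK: "fst (w j) \<in> K" "snd (w j) \<in> K" for j using x by (auto simp: w_def cyc_field_mult)
  have vE: "v j \<in> cyc_E m" for j unfolding v_def using wK by (intro E_pure_tensor)
  have e: "E_to_Rn m (v j) = \<Phi> (fst (w j)) (snd (w j))" for j by (simp add: v_def \<Phi>_def)
  have ne: "(\<Sum>i<n. (E_to_Rn m (v j) i)\<^sup>2) \<le> conj_norm x" if "j \<in> {..<n}" for j
    unfolding e norm_Rn_square[symmetric] \<Phi>_norm[OF wK] using x
    by (auto simp: w_def conj_norm_mult_zeta_power)
  have pt0: "pure_tensor m 0 1 f = 0" for f
    using Hom_sum[of f "{}::nat set"] by (simp add: pure_tensor_def)
  have comb: "(\<lambda>f. \<Sum>j<n. c j * fst (v j) f, \<lambda>f. \<Sum>j<n. c j * snd (v j) f) =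
     (\<lambda>f. if f \<in> cyc_Hom m then (\<Sum>i<d. c i * f (x * \<zeta> ^ i)) else 0,
      \<lambda>f. if f \<in> cyc_Hom m then (\<Sum>i<d. c (d + i) * f (x * \<zeta> ^ i)) else 0)" for c :: "nat \<Rightarrow> real"
    unfolding sum_lessThan_double by (auto simp: v_def w_def pt0) (auto simp: pure_tensor_def)
  define a where "a j = (if j < d then A j else B (j - d))" for j
  have "z = E_to_Rn m (\<lambda>f. \<Sum>j<n. a j * fst (v j) f, \<lambda>f. \<Sum>j<n. a j * snd (v j) f)"
  proof -
    have "t = (\<lambda>f. if f \<in> cyc_Hom m then (\<Sum>i<d. a i * f (x * \<zeta> ^ i)) else 0)"
      "u = (\<lambda>f. if f \<in> cyc_Hom m then (\<Sum>i<d. a (d + i) * f (x * \<zeta> ^ i)) else 0)"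
      unfolding A B by (auto simp: a_def)
    thus ?thesis unfolding tu(1) comb by simp
  qed
  hence za: "z = (\<lambda>i\<in>{..<n}. \<Sum>j<n. a j * E_to_Rn m (v j) i)"
    using conjunct2[OF iso_sum[OF finite_lessThan vE]] by simp
  \<comment> \<open>Rounding n = 2d coordinates along vectors of squared norm
    \<open>conj_norm x\<close> costs at most n / 4 times this norm, hence the factor d / 2.\<close>
  obtain k :: "nat \<Rightarrow> int" where k:
    "(\<Sum>i<n. (0 + (\<Sum>j<n. (a j - of_int (k j)) * E_to_Rn m (v j) i))\<^sup>2)
        \<le> (\<Sum>i<n. (0::real)\<^sup>2) + real (card {..<n}) * (conj_norm x / 4)"
    using rounding_error[where I = "{..<n}" and n = n and e = "\<lambda>j. E_to_Rn m (v j)" and E = "conj_norm x"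
        and w = "\<lambda>_. 0" and a = a, OF finite_lessThan ne] by blast
  define W where "W h = (\<Sum>j<d. of_int (h j) * \<zeta> ^ j)" for h :: "nat \<Rightarrow> int"
  have Wf: "f (x * W h) = (\<Sum>i<d. of_int (h i) * f (x * \<zeta> ^ i))" if "f \<in> cyc_Hom m" for f h
    using Hom_sum[OF that, of "{..<d}" "\<lambda>i. x * \<zeta> ^ i" "\<lambda>i. of_int (h i)"] x
    by (simp add: W_def cyc_field_mult sum_distrib_left mult_ac)
  have "\<Phi> (x * W k) (x * W (\<lambda>j. k (d + j))) =
     E_to_Rn m (\<lambda>f. \<Sum>j<n. of_int (k j) * fst (v j) f, \<lambda>f. \<Sum>j<n. of_int (k j) * snd (v j) f)"
    unfolding comb \<Phi>_def
      by (intro arg_cong[where f="E_to_Rn m"] prod_eqI ext) (simp_all add: pure_tensor_def Wf)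
  also have "\<dots> = (\<lambda>i\<in>{..<n}. \<Sum>j<n. of_int (k j) * E_to_Rn m (v j) i)"
    by (rule conjunct2[OF iso_sum[OF finite_lessThan vE]])
  finally have "(norm_Rn n (sub_Rn n z (\<Phi> (x * W k) (x * W (\<lambda>j. k (d + j))))))\<^sup>2 =
     (\<Sum>i<n. (\<Sum>j<n. (a j - of_int (k j)) * E_to_Rn m (v j) i)\<^sup>2)"
    unfolding norm_Rn_square za by (intro sum.cong refl) (simp add: left_diff_distrib sum_subtractf)
  also have "\<dots> \<le> real d * conj_norm x / 2" using k by (simp add: mult.commute)
  finally show thesis unfolding W_def by (rule that)
qed

end

section \<open>Algebraic integers modulo a prime ideal\<close>

text \<open>\<open>residue_pos\<close> expresses that the residue ring is finite, since
  \<open>card\<close> of an infinite set is 0.\<close>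

locale cyclotomic_prime = cyclotomic +
  fixes P :: "complex set" and p :: nat
  assumes primeideal: "primeideal P (cyc_int_ring m)"
    and p: "prime p" "lies_over P p"
    and residue_pos: "residue_card m P > 0"
begin

abbreviation "R \<equiv> cyc_int_ring m"
abbreviation "\<O> \<equiv> carrier (cyc_int_ring m)"
abbreviation "q \<equiv> residue_card m P"

interpretation R: primeideal P R by (rule primeideal)

lemma R_simps [simp]: "x \<otimes>\<^bsub>R\<^esub> y = x * y" "x \<oplus>\<^bsub>R\<^esub> y = x + y" "\<one>\<^bsub>R\<^esub> = 1" "\<zero>\<^bsub>R\<^esub> = 0"
  by (simp_all add: cyc_int_ring_def)

lemma O_iff: "x \<in> \<O> \<longleftrightarrow> x \<in> K \<and> algebraic_int x"
  by (simp add: cyc_int_ring_def)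

lemma O_K: "x \<in> \<O> \<Longrightarrow> x \<in> K"
  by (simp add: O_iff)

lemma O_add: "x + y \<in> \<O>" if "x \<in> \<O>" "y \<in> \<O>"
  using R.a_closed[OF that] by simp

lemma O_mult: "x * y \<in> \<O>" if "x \<in> \<O>" "y \<in> \<O>"
  using R.m_closed[OF that] by simp

lemma O_of_int [simp]: "of_int a \<in> \<O>"
  by (simp add: O_iff)

lemma O_0 [simp]: "0 \<in> \<O>" and O_1 [simp]: "1 \<in> \<O>"
  using O_of_int[of 0] O_of_int[of 1] by simp_all

lemma O_minus: "- x \<in> \<O>" if "x \<in> \<O>"
  using O_mult[OF O_of_int[of "-1"] that] by simp

lemma O_diff: "x - y \<in> \<O>" if "x \<in> \<O>" "y \<in> \<O>"
  using O_add[OF that(1) O_minus[OF that(2)]] by simp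

lemma O_sum: "(\<And>i. i \<in> I \<Longrightarrow> f i \<in> \<O>) \<Longrightarrow> (\<Sum>i\<in>I. f i) \<in> \<O>"
  by (induction I rule: infinite_finite_induct) (auto simp: O_add)

lemma O_prod: "(\<And>i. i \<in> I \<Longrightarrow> f i \<in> \<O>) \<Longrightarrow> (\<Prod>i\<in>I. f i) \<in> \<O>"
  by (induction I rule: infinite_finite_induct) (auto simp: O_mult)

lemma O_zeta_power [simp]: "\<zeta> ^ i \<in> \<O>"
proof -
  have "algebraic_int (\<zeta> ^ i)"
  proof (rule algebraic_int_root)
    show "poly (monom 1 m) (\<zeta> ^ i) = 1"
      using m_pos by (simp add: poly_monom mult.commute[of i] power_mult flip: power_mult[of _ i m])
  qed (use m_pos in \<open>auto simp: degree_monom_eq\<close>)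
  thus ?thesis by (simp add: O_iff)
qed

lemma emb_O: "\<sigma> k x \<in> \<O>" if "k \<in> T" "x \<in> \<O>"
proof -
  have k: "coprime k m" using that T_coprime by simp
  have x: "x \<in> K" using that O_K by simp
  obtain f where f: "ipoly f x = 0" "lead_coeff f = 1"
    using \<open>x \<in> \<O>\<close> by (auto simp: O_iff algebraic_int_altdef_ipoly)
  have "\<sigma> k (ipoly g x) = ipoly g (\<sigma> k x) \<and> ipoly g x \<in> K" for g
    by (induction g) (simp_all add: k x emb_add emb_mult cyc_field_add cyc_field_mult)
  hence "ipoly f (\<sigma> k x) = 0" using f(1) k by (metis emb_0)
  thus ?thesis using f emb_in_K[OF k x] by (auto simp: O_iff algebraic_int_altdef_ipoly)
qed

text \<open>The norm of a nonzero algebraic integer is a nonzero integer, and \<open>t \<ge> 1 + ln t\<close> at the conjugates.\<close>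

lemma conj_norm_ge: "conj_norm x \<ge> real d" if x: "x \<in> \<O>" "x \<noteq> 0"
proof -
  have xK: "x \<in> K" using x O_K by simp
  have "cyc_norm x \<in> \<O>" unfolding cyc_norm_def using emb_O x by (intro O_prod) simp
  hence "cyc_norm x \<in> \<int>"
    using cyc_norm_rat[OF xK] by (intro rational_algebraic_int_is_int) (simp_all add: O_iff)
  then obtain N where N: "cyc_norm x = of_int N" by (auto elim: Ints_cases)
  have "N \<noteq> 0" using cyc_norm_nonzero[OF xK x(2)] N by auto
  hence "norm (cyc_norm x) \<ge> 1" unfolding N by simp
  hence ge: "(\<Prod>k\<in>T. norm (\<sigma> k x)) \<ge> 1" by (simp add: cyc_norm_def prod_norm)
  have pos: "norm (\<sigma> k x) > 0" if "k \<in> T" for k using emb_eq_0_iff[OF that xK] x by simp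
  have "0 \<le> ln (\<Prod>k\<in>T. norm (\<sigma> k x))" using ge by simp
  also have "\<dots> = (\<Sum>k\<in>T. ln (norm (\<sigma> k x)))"
    by (rule ln_prod) (use pos in auto)
  finally have "real d \<le> (\<Sum>k\<in>T. 1 + 2 * ln (norm (\<sigma> k x)))"
    by (simp add: sum.distrib card_T flip: sum_distrib_left)
  also have "\<dots> \<le> conj_norm x"
    unfolding conj_norm_def
  proof (intro sum_mono)
    fix k assume "k \<in> T"
    hence "norm (\<sigma> k x) > 0" by (rule pos)
    hence "ln ((norm (\<sigma> k x))\<^sup>2) \<le> (norm (\<sigma> k x))\<^sup>2 - 1" "ln ((norm (\<sigma> k x))\<^sup>2)
        = 2 * ln (norm (\<sigma> k x))"
      using ln_le_minus_one[of "(norm (\<sigma> k x))\<^sup>2"] ln_realpow[of "norm (\<sigma> k x)" 2] by simp_all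
    thus "1 + 2 * ln (norm (\<sigma> k x)) \<le> (norm (\<sigma> k x))\<^sup>2" by linarith
  qed
  finally show ?thesis .
qed

lemma P_O: "x \<in> P \<Longrightarrow> x \<in> \<O>"
  using R.a_subset by auto

lemma P_mult: "x * y \<in> P" if "x \<in> P" "y \<in> \<O>"
  using R.I_r_closed[OF that] by simp

lemma P_add: "x + y \<in> P" if "x \<in> P" "y \<in> P"
  using additive_subgroup.a_closed[OF R.is_additive_subgroup] that by simp

lemma P_minus: "- x \<in> P" if "x \<in> P"
  using P_mult[OF that O_of_int[of "-1"]] by simp

lemma P_diff: "x - y \<in> P" if "x \<in> P" "y \<in> P"
  using P_add[OF that(1) P_minus[OF that(2)]] by simp

lemma P_0 [simp]: "0 \<in> P"
  using additive_subgroup.zero_closed[OF R.is_additive_subgroup] by simp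

lemma P_prime: "x \<in> P \<or> y \<in> P" if "x \<in> \<O>" "y \<in> \<O>" "x * y \<in> P"
  using R.I_prime that by simp

lemma one_notin_P: "1 \<notin> P"
proof
  assume "1 \<in> P"
  hence "\<O> \<subseteq> P" using P_mult[of 1] by auto
  thus False using R.I_notcarr P_O by blast
qed

lemma p_in_P: "of_nat p \<in> P"
proof -
  have "int p \<in> {z. of_int z \<in> P}" using p(2) unfolding lies_over_def by auto
  thus ?thesis by simp
qed

definition coset :: "complex \<Rightarrow> complex set" where
  "coset x = P +>\<^bsub>R\<^esub> x"

lemma coset_eq_iff: "coset x = coset y \<longleftrightarrow> x - y \<in> P" if "x \<in> \<O>" "y \<in> \<O>"
proof -
  have c: "coset z = {h + z | h. h \<in> P}" for z
    unfolding coset_def a_r_coset_def' by auto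
  show ?thesis
  proof
    assume "coset x = coset y"
    moreover have "x \<in> coset x" unfolding c by (auto intro!: exI[of _ 0])
    ultimately obtain h where "x = h + y" "h \<in> P" unfolding c by auto
    thus "x - y \<in> P" by simp
  next
    assume d: "x - y \<in> P"
    show "coset x = coset y"
      unfolding c
    proof safe
      fix h assume "h \<in> P"
      thus "\<exists>ha. h + x = ha + y \<and> ha \<in> P" using P_add[OF _ d]
        by (intro exI[of _ "h + (x - y)"]) simp
      show "\<exists>ha. h + y = ha + x \<and> ha \<in> P" using P_diff[OF \<open>h \<in> P\<close> d]
        by (intro exI[of _ "h - (x - y)"]) simp
    qed
  qed
qed

lemma carrier_quot: "carrier (R Quot P) = coset ` \<O>"
  unfolding FactRing_def A_RCOSETS_def' coset_def by auto

lemma quot_mult: "coset x \<otimes>\<^bsub>R Quot P\<^esub> coset y = coset (x * y)" if "x \<in> \<O>" "y \<in> \<O>"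
  using R.rcoset_mult_add[OF that] by (simp add: FactRing_def coset_def)

lemma representatives:
  obtains Y where "Y \<subseteq> \<O>" "finite Y" "card Y = q"
    "\<And>x y. x \<in> Y \<Longrightarrow> y \<in> Y \<Longrightarrow> x - y \<in> P \<Longrightarrow> x = y"
    "\<And>x. x \<in> \<O> \<Longrightarrow> \<exists>y\<in>Y. x - y \<in> P"
proof -
  have q: "q = card (coset ` \<O>)" by (simp add: residue_card_def carrier_quot)
  have fin: "finite (coset ` \<O>)" using residue_pos unfolding q by (rule card_ge_0_finite)
  define g where "g = inv_into \<O> coset"
  define Y where "Y = g ` (coset ` \<O>)"
  have g: "g c \<in> \<O>" "coset (g c) = c" if "c \<in> coset ` \<O>" for c
    using that by (auto simp: g_def inv_into_into f_inv_into_f)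
  have inj: "inj_on g (coset ` \<O>)" by (rule inj_on_inverseI[of _ coset]) (rule g(2))
  show thesis
  proof (rule that[of Y])
    show "Y \<subseteq> \<O>" using g by (auto simp: Y_def)
    show "finite Y" using fin by (simp add: Y_def)
    show "card Y = q" unfolding Y_def q by (rule card_image[OF inj])
    fix x y assume "x \<in> Y" "y \<in> Y" "x - y \<in> P"
    then obtain c c' where c: "x = g c" "y = g c'" "c \<in> coset ` \<O>" "c' \<in> coset ` \<O>" unfolding Y_def
      by blast
    hence "coset x = coset y" using g(1) \<open>x - y \<in> P\<close> by (simp add: coset_eq_iff)
    hence "c = c'" using c g(2) by metis
    thus "x = y" using c by simp
  next
    fix x assume x: "x \<in> \<O>"
    hence c: "coset x \<in> coset ` \<O>" by blast
    have "coset x = coset (g (coset x))" using g[OF c] by simp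
    hence "x - g (coset x) \<in> P" using coset_eq_iff x g[OF c] by blast
    thus "\<exists>y\<in>Y. x - y \<in> P" using c by (auto simp: Y_def)
  qed
qed

section \<open>The lattices of the lines through \<open>(1, y)\<close>\<close>

definition embed :: "(complex \<times> complex) set \<Rightarrow> (nat \<Rightarrow> real) set" where
  "embed S = (\<lambda>(x, y). \<Phi> x y) ` S"

text \<open>\<open>line_lattice y\<close> belongs to the line through \<open>(1, y)\<close>; the line through \<open>(0, 1)\<close> is not needed.\<close>

definition line_lattice :: "complex \<Rightarrow> (complex \<times> complex) set" where
  "line_lattice y = {(x1, x2). x1 \<in> \<O> \<and> x2 \<in> \<O> \<and> x2 - y * x1 \<in> P}"

text \<open>The multiples of (1, y) are exactly the pairs of residues whose second entry is y times
  the first, and (1, y) is not the zero pair since 1 is not in \<open>P\<close>.\<close>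

lemma line_lattice_code: "embed (line_lattice y) \<in> code_lattices m P" if y: "y \<in> \<O>"
proof -
  define C where "C = {(c \<otimes>\<^bsub>R Quot P\<^esub> coset 1, c \<otimes>\<^bsub>R Quot P\<^esub> coset y) | c. c \<in> carrier (R Quot P)}"
  have C: "C = {(coset x, coset (x * y)) | x. x \<in> \<O>}"
    unfolding C_def carrier_quot using quot_mult[OF _ y] quot_mult[OF _ O_1] by fastforce
  have "coset 1 \<noteq> \<zero>\<^bsub>R Quot P\<^esub>"
  proof
    assume "coset 1 = \<zero>\<^bsub>R Quot P\<^esub>"
    moreover have "\<zero>\<^bsub>R Quot P\<^esub> = coset 0" unfolding FactRing_def coset_def a_r_coset_def' by auto
    ultimately have "1 - 0 \<in> P" using coset_eq_iff[of 1 0] by simp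
    thus False using one_notin_P by simp
  qed
  hence "C \<in> F2_lines (R Quot P)"
    unfolding F2_lines_def C_def using y
    by (intro CollectI exI[of _ "coset 1"] exI[of _ "coset y"]) (auto simp: carrier_quot)
  moreover have "code_preimage m P C = line_lattice y"
  proof -
    have "(coset x1, coset x2) \<in> C \<longleftrightarrow> x2 - y * x1 \<in> P" if x: "x1 \<in> \<O>" "x2 \<in> \<O>" for x1 x2
    proof
      assume "(coset x1, coset x2) \<in> C"
      then obtain x where z: "x \<in> \<O>" "coset x1 = coset x" "coset x2 = coset (x * y)" unfolding C
        by blast
      hence "x1 - x \<in> P" "x2 - x * y \<in> P" using x y by (auto simp: coset_eq_iff O_mult)
      hence "(x2 - x * y) - (x1 - x) * y \<in> P" using P_diff[OF _ P_mult[OF _ y]] by blast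
      thus "x2 - y * x1 \<in> P" by (simp add: algebra_simps)
    next
      assume "x2 - y * x1 \<in> P"
      hence "coset x2 = coset (x1 * y)" using x y
        by (subst coset_eq_iff) (auto simp: O_mult mult.commute)
      thus "(coset x1, coset x2) \<in> C" unfolding C using x by blast
    qed
    thus ?thesis unfolding code_preimage_def line_lattice_def coset_def by auto
  qed
  ultimately show ?thesis
    unfolding code_lattices_def code_lattice_def embed_def \<Phi>_def
      by (metis (no_types, lifting) image_eqI)
qed

text \<open>One nonzero entry alone contributes at least d to the squared norm.\<close>

lemma discrete_embed:
  assumes S: "S \<subseteq> \<O> \<times> \<O>" "(0, 0) \<in> S"
    and diff: "\<And>x1 x2 y1 y2. (x1, x2) \<in> S \<Longrightarrow> (y1, y2) \<in> S \<Longrightarrow> (x1 - y1, x2 - y2) \<in> S"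
  shows "discrete_lattice n (embed S) (sqrt d)"
proof
  have SK: "x1 \<in> K" "x2 \<in> K" if "(x1, x2) \<in> S" for x1 x2 using S that O_K by auto
  show "embed S \<subseteq> Rn n" using SK by (auto simp: embed_def intro!: \<Phi>_in_Rn)
  show "zero_Rn n \<in> embed S" using S(2) \<Phi>_0 by (force simp: embed_def)
  show "sub_Rn n x y \<in> embed S" if xy: "x \<in> embed S" "y \<in> embed S" for x y
  proof -
    obtain x1 x2 y1 y2 where x: "x = \<Phi> x1 x2" "(x1, x2) \<in> S" and y: "y = \<Phi> y1 y2" "(y1, y2) \<in> S"
      using xy by (auto simp: embed_def)
    have "sub_Rn n x y = \<Phi> (x1 - y1) (x2 - y2)"
      unfolding x y using SK[OF x(2)] SK[OF y(2)] by (intro \<Phi>_diff[symmetric])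
    thus ?thesis using diff[OF x(2) y(2)] by (auto simp: embed_def)
  qed
  show "sqrt d > 0" using d_pos by simp
  show "sqrt d \<le> norm_Rn n x" if x: "x \<in> embed S" "x \<noteq> zero_Rn n" for x
  proof -
    obtain x1 x2 where x12: "x = \<Phi> x1 x2" "(x1, x2) \<in> S" using x by (auto simp: embed_def)
    have "x1 \<noteq> 0 \<or> x2 \<noteq> 0" using x(2) x12(1) \<Phi>_0 by auto
    moreover have "x1 \<in> \<O>" "x2 \<in> \<O>" using x12 S by auto
    ultimately have "real d \<le> conj_norm x1 + conj_norm x2"
      using conj_norm_ge conj_norm_nonneg by (smt (verit))
    also have "\<dots> = (norm_Rn n x)\<^sup>2" unfolding x12(1) using \<Phi>_norm SK[OF x12(2)] by simp
    finally show ?thesis by (rule real_le_lsqrt[OF norm_Rn_nonneg])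
  qed
qed

lemma discrete_O: "discrete_lattice n (embed (\<O> \<times> \<O>)) (sqrt d)"
  by (rule discrete_embed) (auto simp: O_diff)

lemma discrete_P: "discrete_lattice n (embed (P \<times> P)) (sqrt d)"
  by (rule discrete_embed) (auto simp: P_diff P_O)

lemma discrete_line: "discrete_lattice n (embed (line_lattice y)) (sqrt d)" if "y \<in> \<O>"
proof (rule discrete_embed)
  fix x1 x2 y1 y2 assume "(x1, x2) \<in> line_lattice y" "(y1, y2) \<in> line_lattice y"
  moreover have "(x2 - y2) - y * (x1 - y1) = (x2 - y * x1) - (y2 - y * y1)"
    by (simp add: algebra_simps)
  ultimately show "(x1 - y1, x2 - y2) \<in> line_lattice y"
    by (simp only: line_lattice_def mem_Collect_eq prod.case) (auto simp: O_diff P_diff)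
qed (auto simp: line_lattice_def)

text \<open>Rounding produces x (a, b) with a and b in \<int>[\<zeta>], which lies in
  \<open>S\<close> in both cases, for \<open>P\<close> by the ideal property. Since
  \<open>conj_norm 1 = real d\<close>, the case x = 1 yields the radius \<tau>.\<close>

lemma cball_covers:
  assumes S: "S = \<O> \<times> \<O> \<and> x = 1 \<or> S = P \<times> P \<and> x \<in> P" and x0: "x \<noteq> 0"
  shows "covers_Rn n (embed S) (cball_Rn n (sqrt (real d * conj_norm x / 2)))"
  unfolding covers_Rn_def
proof
  fix z assume z: "z \<in> Rn n"
  have xK: "x \<in> K" using S O_K P_O by auto
  obtain k l :: "nat \<Rightarrow> int" where kl:
    "(norm_Rn n (sub_Rn n z (\<Phi> (x * (\<Sum>j<d. of_int (k j) * \<zeta> ^ j)) (x * (\<Sum>j<d. of_int (l j) * \<zeta> ^ j)))))\<^sup>2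
      \<le> real d * conj_norm x / 2"
    using close_multiple[OF xK x0 z] by blast
  have \<O>: "(\<Sum>j<d. of_int (k j) * \<zeta> ^ j) \<in> \<O>" for k :: "nat \<Rightarrow> int"
    by (intro O_sum O_mult) auto
  have "(x * (\<Sum>j<d. of_int (k j) * \<zeta> ^ j), x * (\<Sum>j<d. of_int (l j) * \<zeta> ^ j)) \<in> S"
    using S \<O> P_mult by auto
  hence "\<Phi> (x * (\<Sum>j<d. of_int (k j) * \<zeta> ^ j)) (x * (\<Sum>j<d. of_int (l j) * \<zeta> ^ j)) \<in> embed S"
    by (force simp: embed_def)
  thus "\<exists>v\<in>embed S. sub_Rn n z v \<in> cball_Rn n (sqrt (real d * conj_norm x / 2))"
    using real_le_rsqrt[OF kl] by (intro bexI) (simp_all add: cball_Rn_def)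
qed

end

section \<open>Averaging over the lines\<close>

text \<open>\<open>D\<close> is the yardstick for all volumes: translates of it by representatives
  built from \<open>Y\<close> are compared with the sublattices, and its containment in a ball of
  radius \<tau> allows counting points by volume.\<close>

locale cyclotomic_code = cyclotomic_prime +
  fixes D :: "(nat \<Rightarrow> real) set" and Y :: "complex set"
  assumes D: "fundamental_region n (embed (\<O> \<times> \<O>)) D"
      "D \<subseteq> cball_Rn n (sqrt (real d * real d / 2))"
    and Y: "Y \<subseteq> \<O>" "finite Y" "card Y = q"
      "\<And>x y. x \<in> Y \<Longrightarrow> y \<in> Y \<Longrightarrow> x - y \<in> P \<Longrightarrow> x = y"
      "\<And>x. x \<in> \<O> \<Longrightarrow> \<exists>y\<in>Y. x - y \<in> P"
begin

abbreviation "M \<equiv> lborel_Rn n"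
abbreviation "V \<equiv> unit_ball_vol (real n)"

definition "vol = measure M D"
definition "\<tau> = sqrt (real d * real d / 2)"

lemma \<tau>_pos: "\<tau> > 0" using d_pos by (simp add: \<tau>_def)

lemma V_pos: "V > 0" by simp

lemma D_sets: "D \<in> sets M" using D by (simp add: fundamental_region_def)

lemma D_packs: "packs_Rn n (embed (\<O> \<times> \<O>)) D"
  by (rule discrete_lattice.fundamental_region_packs[OF discrete_O D(1)])

lemma D_covers: "covers_Rn n (embed (\<O> \<times> \<O>)) D"
  using D(1) unfolding fundamental_region_def covers_Rn_def by blast

lemma D_ball: "D \<subseteq> cball_Rn n \<tau>" using D(2) by (simp add: \<tau>_def)

lemma emeasure_D: "emeasure M D = ennreal vol"
proof -
  have "emeasure M D \<le> ennreal (V * \<tau> ^ n)"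
    using emeasure_mono[OF D_ball cball_Rn_sets] emeasure_cball_Rn[OF \<tau>_pos] by simp
  hence "emeasure M D \<noteq> \<infinity>" by (metis ennreal_neq_top infinity_ennreal_def top_unique)
  thus ?thesis unfolding vol_def by (simp add: emeasure_eq_ennreal_measure)
qed

lemma vol_le: "vol \<le> V * \<tau> ^ n"
proof -
  have "ennreal vol \<le> ennreal (V * \<tau> ^ n)"
    unfolding emeasure_D[symmetric]
    using emeasure_mono[OF D_ball cball_Rn_sets] emeasure_cball_Rn[OF \<tau>_pos] by simp
  thus ?thesis using \<tau>_pos V_pos by (subst (asm) ennreal_le_iff) (auto intro!: mult_nonneg_nonneg)
qed

text \<open>\<open>cball_packs\<close> wants a radius strictly below half of sqrt d; a quarter is a
  convenient choice.\<close>

lemma vol_ge: "V * (sqrt d / 4) ^ n \<le> vol"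
proof -
  interpret discrete_lattice n "embed (\<O> \<times> \<O>)" "sqrt d" by (rule discrete_O)
  have s: "sqrt d / 4 > 0" using d_pos by simp
  have "emeasure M (cball_Rn n (sqrt d / 4)) \<le> emeasure M D"
    using s by (intro emeasure_packs_le_fundamental_region[OF cball_Rn_sets cball_packs D(1)]) simp
  hence "ennreal (V * (sqrt d / 4) ^ n) \<le> ennreal vol"
    by (simp only: emeasure_cball_Rn[OF s] emeasure_D)
  thus ?thesis by (subst (asm) ennreal_le_iff) (simp_all add: vol_def)
qed

lemma vol_pos: "vol > 0"
proof -
  have "V * (sqrt d / 4) ^ n > 0" using V_pos d_pos by simp
  thus ?thesis using vol_ge by linarith
qed

lemma embed_mono: "S \<subseteq> S' \<Longrightarrow> embed S \<subseteq> embed S'"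
  unfolding embed_def by blast

lemma embed_diff_mem_iff:
  assumes "S \<subseteq> \<O> \<times> \<O>" "x1 \<in> \<O>" "x2 \<in> \<O>" "y1 \<in> \<O>" "y2 \<in> \<O>"
  shows "sub_Rn n (\<Phi> x1 x2) (\<Phi> y1 y2) \<in> embed S \<longleftrightarrow> (x1 - y1, x2 - y2) \<in> S"
proof -
  have "sub_Rn n (\<Phi> x1 x2) (\<Phi> y1 y2) = \<Phi> (x1 - y1) (x2 - y2)"
    using assms O_K by (intro \<Phi>_diff[symmetric]) auto
  moreover have "\<Phi> (x1 - y1) (x2 - y2) \<in> embed S \<longleftrightarrow> (x1 - y1, x2 - y2) \<in> S"
  proof
    assume "\<Phi> (x1 - y1) (x2 - y2) \<in> embed S"
    then obtain z1 z2 where z: "(z1, z2) \<in> S" "\<Phi> (x1 - y1) (x2 - y2) = \<Phi> z1 z2"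
      by (auto simp: embed_def)
    moreover have "z1 \<in> \<O>" "z2 \<in> \<O>" using z assms by auto
    ultimately show "(x1 - y1, x2 - y2) \<in> S"
      using assms O_K O_diff by (subst (asm) \<Phi>_eq_iff) auto
  qed (force simp: embed_def)
  ultimately show ?thesis by simp
qed

lemma card_embed: "card (embed S) = card S" if "S \<subseteq> \<O> \<times> \<O>"
  unfolding embed_def
proof (rule card_image, rule inj_onI, clarify)
  fix x1 x2 y1 y2 assume "(x1, x2) \<in> S" "(y1, y2) \<in> S" "\<Phi> x1 x2 = \<Phi> y1 y2"
  moreover from this have "x1 \<in> K" "x2 \<in> K" "y1 \<in> K" "y2 \<in> K" using that O_K by auto
  ultimately show "x1 = y1 \<and> x2 = y2" using \<Phi>_eq_iff by blast
qed

lemma emeasure_translates_D: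
  assumes "finite S" "S \<subseteq> \<O> \<times> \<O>"
  shows "emeasure M (\<Union>l\<in>embed S. {x \<in> Rn n. sub_Rn n x l \<in> D}) = ennreal (real (card S) * vol)"
    and "(\<Union>l\<in>embed S. {x \<in> Rn n. sub_Rn n x l \<in> D}) \<in> sets M"
proof -
  interpret discrete_lattice n "embed (\<O> \<times> \<O>)" "sqrt d" by (rule discrete_O)
  have fin: "finite (embed S)" using assms by (simp add: embed_def)
  have sub: "embed S \<subseteq> embed (\<O> \<times> \<O>)" by (rule embed_mono[OF assms(2)])
  have "emeasure M (\<Union>l\<in>embed S. {x \<in> Rn n. sub_Rn n x l \<in> D})
      = of_nat (card (embed S)) * emeasure M D"
    using sub sub_mem subset_Rn by (intro emeasure_finite_translates[OF D_sets D_packs fin]) blast+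
  also have "\<dots> = ennreal (real (card S) * vol)"
    using assms
      by (simp add: card_embed emeasure_D ennreal_mult vol_def ennreal_of_nat_eq_real_of_nat)
  finally show "emeasure M (\<Union>l\<in>embed S. {x \<in> Rn n. sub_Rn n x l \<in> D})
      = ennreal (real (card S) * vol)" .
  show "(\<Union>l\<in>embed S. {x \<in> Rn n. sub_Rn n x l \<in> D}) \<in> sets M"
    using fin D_sets translate_sets by (intro sets.finite_UN) auto
qed

text \<open>Comparing the covolume \<open>q\<^sup>2 vol\<close> of \<open>P\<^sup>2\<close> with the covering radius of its sublattice \<open>(x\<O>)\<^sup>2\<close>.\<close>

lemma vol_P_le:
  assumes x: "x \<in> P" "x \<noteq> 0"
  shows "(real q)\<^sup>2 * vol \<le> V * sqrt (real d * conj_norm x / 2) ^ n"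
proof -
  define r where "r = sqrt (real d * conj_norm x / 2)"
  \<comment> \<open>The q^2 translates of \<open>D\<close> by pairs from \<open>Y\<close>; these
    pairs are inequivalent modulo \<open>P \<times> P\<close>, so the union packs for that
    lattice.\<close>
  define U where "U = (\<Union>l\<in>embed (Y \<times> Y). {x \<in> Rn n. sub_Rn n x l \<in> D})"
  have YY: "finite (Y \<times> Y)" "Y \<times> Y \<subseteq> \<O> \<times> \<O>" "P \<times> P \<subseteq> \<O> \<times> \<O>" using Y P_O by auto
  have r: "r > 0" using conj_norm_pos[of x] x P_O O_K d_pos by (simp add: r_def)
  have "packs_Rn n (embed (P \<times> P)) U"
    unfolding U_def
  proof (rule finite_translates_pack[OF D_packs discrete_O embed_mono[OF YY(3)] embed_mono[OF YY(2)]])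
    fix l l' assume l: "l \<in> embed (Y \<times> Y)" "l' \<in> embed (Y \<times> Y)" "sub_Rn n l l' \<in> embed (P \<times> P)"
    then obtain y1 y2 z1 z2
      where e: "l = \<Phi> y1 y2" "l' = \<Phi> z1 z2" "y1 \<in> Y" "y2 \<in> Y" "z1 \<in> Y" "z2 \<in> Y"
      by (auto simp: embed_def)
    have "(y1 - z1, y2 - z2) \<in> P \<times> P"
      using l(3) embed_diff_mem_iff[OF YY(3), of y1 y2 z1 z2] e Y(1) by blast
    thus "l = l'" using e Y(4) by auto
  qed
  hence "emeasure M U \<le> emeasure M (cball_Rn n r)"
    using emeasure_translates_D(2)[OF YY(1,2)] cball_covers[of "P \<times> P" x] x unfolding U_def r_def
    by (intro discrete_lattice.emeasure_packs_le_covers[OF discrete_P _ _ cball_Rn_sets]) auto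
  hence "ennreal (real (card (Y \<times> Y)) * vol) \<le> ennreal (V * r ^ n)"
    unfolding U_def emeasure_translates_D(1)[OF YY(1,2)] emeasure_cball_Rn[OF r] .
  hence "real (card (Y \<times> Y)) * vol \<le> V * r ^ n"
    using r V_pos by (subst (asm) ennreal_le_iff) (auto intro!: mult_nonneg_nonneg)
  thus ?thesis using Y(3) by (simp add: card_cartesian_product power2_eq_square r_def)
qed

lemma line_lattice_subset: "line_lattice y \<subseteq> \<O> \<times> \<O>"
  by (auto simp: line_lattice_def)

text \<open>The pairs (0, z) with z in \<open>Y\<close> meet all classes: for (x1, x2) take z
  congruent to x2 - y x1. So q translates of \<open>D\<close> cover, which bounds the volume from
  above. It is positive because \<open>D\<close> still packs for the smaller lattice.\<close>

lemma line_lattice_volume: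
  assumes y: "y \<in> \<O>"
  shows "lattice_Vol n (embed (line_lattice y)) > 0"
    and "lattice_Vol n (embed (line_lattice y)) \<le> real q * vol"
proof -
  interpret discrete_lattice n "embed (line_lattice y)" "sqrt d" by (rule discrete_line[OF y])
  define S where "S = {0::complex} \<times> Y"
  have S: "finite S" "S \<subseteq> \<O> \<times> \<O>" "card S = q" using Y by (auto simp: S_def card_cartesian_product)
  define U where "U = (\<Union>l\<in>embed S. {x \<in> Rn n. sub_Rn n x l \<in> D})"
  have U: "U \<in> sets M" "emeasure M U = ennreal (real q * vol)"
    using emeasure_translates_D[OF S(1,2)] S(3) by (simp_all add: U_def)
  have "covers_Rn n (embed (line_lattice y)) U"
    unfolding U_def
  proof (rule finite_translates_cover[OF D_covers])
    fix l assume "l \<in> embed (\<O> \<times> \<O>)"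
    then obtain x1 x2 where l: "l = \<Phi> x1 x2" "x1 \<in> \<O>" "x2 \<in> \<O>" by (auto simp: embed_def)
    have "x2 - y * x1 \<in> \<O>" using l y by (intro O_diff O_mult)
    then obtain z where z: "z \<in> Y" "(x2 - y * x1) - z \<in> P" using Y(5) by blast
    have "(x1 - 0, x2 - z) \<in> line_lattice y"
      using l z Y(1) by (auto simp: line_lattice_def O_diff algebra_simps)
    hence "sub_Rn n l (\<Phi> 0 z) \<in> embed (line_lattice y)"
      using embed_diff_mem_iff[OF line_lattice_subset, of x1 x2 0 z] l z Y(1) by auto
    moreover have "\<Phi> 0 z \<in> embed S" using z by (force simp: embed_def S_def)
    ultimately show "\<exists>l'\<in>embed S. sub_Rn n l l' \<in> embed (line_lattice y)" by blast
  qed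
  then obtain E where E: "fundamental_region n (embed (line_lattice y)) E" "E \<subseteq> U"
    using fundamental_region_in_covering U(1) by blast
  have le: "emeasure M E \<le> ennreal (real q * vol)" using emeasure_mono[OF E(2) U(1)] U(2) by simp
  have "packs_Rn n (embed (line_lattice y)) D"
    using D_packs embed_mono[OF line_lattice_subset[of y]] unfolding packs_Rn_def by blast
  hence ge: "ennreal vol \<le> emeasure M E"
    using emeasure_packs_le_fundamental_region[OF D_sets _ E(1)] emeasure_D by simp
  have "emeasure M E \<noteq> \<infinity>" using le by (metis ennreal_neq_top infinity_ennreal_def top_unique)
  hence eE: "emeasure M E = ennreal (measure M E)" by (simp add: emeasure_eq_ennreal_measure)
  have "vol \<le> measure M E" using ge unfolding eE by (subst (asm) ennreal_le_iff) auto
  moreover have "measure M E \<le> real q * vol"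
    using le vol_pos unfolding eE by (subst (asm) ennreal_le_iff) auto
  moreover have "lattice_Vol n (embed (line_lattice y)) = measure M E"
    by (rule lattice_Vol_eq[OF E(1)])
  ultimately show "lattice_Vol n (embed (line_lattice y)) > 0"
    "lattice_Vol n (embed (line_lattice y)) \<le> real q * vol"
    using vol_pos by simp_all
qed

text \<open>
  A short vector of a line lattice brings the \<open>m\<close> short vectors \<open>\<zeta>\<^sup>i v\<close> with it, and a vector outside
  of \<open>P\<^sup>2\<close> lies in at most one line lattice.
\<close>

lemma exists_line_lattice_without_short_vectors:
  assumes r: "r > 0"
    and P_long: "\<And>v. v \<in> embed (P \<times> P) \<Longrightarrow> v \<noteq> zero_Rn n \<Longrightarrow> norm_Rn n v > r"
    and count: "V * (r + \<tau>) ^ n < real m * real q * vol"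
  shows "\<exists>y\<in>Y. \<forall>v\<in>embed (line_lattice y). v \<noteq> zero_Rn n \<longrightarrow> norm_Rn n v > r"
proof (rule ccontr)
  assume "\<not> ?thesis"
  hence "\<forall>y\<in>Y. \<exists>x1 x2. (x1, x2) \<in> line_lattice y \<and> \<Phi> x1 x2 \<noteq> zero_Rn n \<and> norm_Rn n (\<Phi> x1 x2) \<le> r"
    by (fastforce simp: embed_def)
  then obtain f g where fg: "\<And>y. y \<in> Y \<Longrightarrow> (f y, g y) \<in> line_lattice y"
    "\<And>y. y \<in> Y \<Longrightarrow> \<Phi> (f y) (g y) \<noteq> zero_Rn n" "\<And>y. y \<in> Y \<Longrightarrow> norm_Rn n (\<Phi> (f y) (g y)) \<le> r"
    by metis
  have O: "f y \<in> \<O>" "g y \<in> \<O>" "g y - y * f y \<in> P" if "y \<in> Y" for y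
    using fg(1)[OF that] by (auto simp: line_lattice_def)
  \<comment> \<open>If the first entry were in \<open>P\<close>, the second would be as well, and
    the short vector would contradict \<open>P_long\<close>.\<close>
  have fP: "f y \<notin> P" if y: "y \<in> Y" for y
  proof
    assume f: "f y \<in> P"
    have "g y = (g y - y * f y) + f y * y" by (simp add: algebra_simps)
    also have "\<dots> \<in> P" using O(3)[OF y] f Y(1) y by (intro P_add P_mult) auto
    finally have "\<Phi> (f y) (g y) \<in> embed (P \<times> P)" using f by (force simp: embed_def)
    thus False using P_long fg(2,3)[OF y] by force
  qed
  have f0: "f y \<noteq> 0" if "y \<in> Y" for y using fP[OF that] by auto
  define h where "h = (\<lambda>(i, y). (f y * \<zeta> ^ i, g y * \<zeta> ^ i))"
  define S where "S = h ` ({..<m} \<times> Y)"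
  \<comment> \<open>Powers of \<zeta> are units: the inverse of \<zeta>^i is \<zeta>^(m i - i), with
    a nonnegative exponent.\<close>
  have zinv: "x \<in> P" if x: "x * \<zeta> ^ i \<in> P" "x \<in> \<O>" for x i
  proof -
    have "x * \<zeta> ^ i * \<zeta> ^ (m * i - i) \<in> P" by (rule P_mult[OF x(1)]) simp
    also have "x * \<zeta> ^ i * \<zeta> ^ (m * i - i) = x * (\<zeta> ^ m) ^ i"
    proof -
      have "\<zeta> ^ i * \<zeta> ^ (m * i - i) = \<zeta> ^ (m * i)" using m_pos by (simp flip: power_add)
      thus ?thesis by (simp add: mult.assoc power_mult)
    qed
    finally show ?thesis using m_pos by simp
  qed
  have inj: "inj_on h ({..<m} \<times> Y)"
  proof (rule inj_onI, clarify)
    fix i j y z assume ij: "i < m" "j < m" and yz: "y \<in> Y" "z \<in> Y" and eq: "h (i, y) = h (j, z)"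
    have e: "f y * \<zeta> ^ i = f z * \<zeta> ^ j" "g y * \<zeta> ^ i = g z * \<zeta> ^ j" using eq by (auto simp: h_def)
    \<comment> \<open>If the vectors for (i, y) and (j, z) agree, eliminating the second entries
      leaves f(y) (y - z) \<zeta>^i in \<open>P\<close>. As \<open>P\<close> is prime and f(y) is
      not in it, y - z is, so y = z.\<close>
    have "(g z - z * f z) * \<zeta> ^ j - (g y - y * f y) * \<zeta> ^ i \<in> P"
      by (rule P_diff[OF P_mult[OF O(3)[OF yz(2)] O_zeta_power] P_mult[OF O(3)[OF yz(1)] O_zeta_power]])
    also have "(g z - z * f z) * \<zeta> ^ j - (g y - y * f y) * \<zeta> ^ i = (f y * (y - z)) * \<zeta> ^ i"
    proof -
      have "(g z - z * f z) * \<zeta> ^ j - (g y - y * f y) * \<zeta> ^ i =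
         (g z * \<zeta> ^ j - g y * \<zeta> ^ i) - z * (f z * \<zeta> ^ j) + y * (f y * \<zeta> ^ i)"
        by (simp add: algebra_simps)
      thus ?thesis unfolding e(2)[symmetric] e(1)[symmetric] by (simp add: algebra_simps)
    qed
    finally have in_P: "f y * (y - z) * \<zeta> ^ i \<in> P" .
    have in_O: "f y \<in> \<O>" "y - z \<in> \<O>" using O[OF yz(1)] yz Y(1) by (auto intro: O_diff)
    hence "f y * (y - z) \<in> P" by (intro zinv[OF in_P] O_mult)
    hence "y - z \<in> P" using P_prime[OF in_O] fP[OF yz(1)] by blast
    hence yz': "y = z" using Y(4) yz by blast
    hence "\<zeta> ^ i = \<zeta> ^ j" using e(1) f0 yz by simp
    hence "i = j" using inj_onD[OF zeta_power_inj[OF m_pos]] ij by simp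
    thus "i = j \<and> y = z" using yz' by simp
  qed
  have S: "finite S" "S \<subseteq> \<O> \<times> \<O>" "card S = m * q"
    using Y O card_image[OF inj] by (auto simp: S_def h_def card_cartesian_product intro!: O_mult)
  have ball: "embed S \<subseteq> cball_Rn n r"
  proof
    fix v assume "v \<in> embed S"
    then obtain i y where iy: "y \<in> Y" "v = \<Phi> (f y * \<zeta> ^ i) (g y * \<zeta> ^ i)"
      by (auto simp: embed_def S_def h_def)
    have K: "f y \<in> K" "g y \<in> K" using O iy O_K by auto
    have K': "f y * \<zeta> ^ i \<in> K" "g y * \<zeta> ^ i \<in> K" using K by (auto intro: cyc_field_mult)
    have "(norm_Rn n v)\<^sup>2 = (norm_Rn n (\<Phi> (f y) (g y)))\<^sup>2"
      unfolding iy(2) \<Phi>_norm[OF K] \<Phi>_norm[OF K'] by (simp add: conj_norm_mult_zeta_power K)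
    hence "norm_Rn n v = norm_Rn n (\<Phi> (f y) (g y))" by (simp add: power2_eq_iff_nonneg)
    thus "v \<in> cball_Rn n r" using fg(3)[OF iy(1)] \<Phi>_in_Rn[OF K'] by (simp add: cball_Rn_def iy(2))
  qed
  have "real (card (embed S)) * vol \<le> V * (r + \<tau>) ^ n"
    unfolding vol_def using S ball r \<tau>_pos
    by (intro discrete_lattice.count_in_cball[OF discrete_O D_sets D_packs D_ball])
      (auto simp: embed_def)
  moreover have "real (card (embed S)) = real m * real q" using card_embed[OF S(2)] S(3) by simp
  ultimately show False using count by simp
qed

text \<open>The minimum exceeds r and the volume is at most q vol; both changes raise the density
  above the stated value.\<close>

lemma line_lattice_density:
  assumes y: "y \<in> Y" and r: "r > 0"
    and long: "\<And>v. v \<in> embed (line_lattice y) \<Longrightarrow> v \<noteq> zero_Rn n \<Longrightarrow> norm_Rn n v > r"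
  shows "packing_density n (embed (line_lattice y)) > V * r ^ n / (2 ^ n * (real q * vol))"
proof -
  have yO: "y \<in> \<O>" using y Y(1) by auto
  interpret discrete_lattice n "embed (line_lattice y)" "sqrt d" by (rule discrete_line[OF yO])
  define \<mu> where "\<mu> = lattice_min n (embed (line_lattice y))"
  have pD: "measure M D > 0" using vol_pos by (simp add: vol_def)
  have "packs_Rn n (embed (line_lattice y)) D"
    using D_packs embed_mono[OF line_lattice_subset[of y]] unfolding packs_Rn_def by blast
  hence fin: "finite (embed (line_lattice y) \<inter> cball_Rn n \<rho>)" for \<rho>
  proof (cases "\<rho> + \<tau> > 0")
    case True
    thus ?thesis using finite_in_cball[OF D_sets _ D_ball pD True] \<open>packs_Rn n _ D\<close> by blast
  next
    case False
    have "x \<notin> cball_Rn n \<rho>" for x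
    proof
      assume "x \<in> cball_Rn n \<rho>"
      hence "norm_Rn n x \<le> \<rho>" by (simp add: cball_Rn_def)
      thus False using False \<tau>_pos norm_Rn_nonneg[of n x] by linarith
    qed
    thus ?thesis by (metis Int_iff all_not_in_conv finite.emptyI)
  qed
  \<comment> \<open>The vector (p, 0) shows that the lattice has a nonzero vector, so that its
    minimum exists.\<close>
  have "- (of_nat p * y) \<in> P" by (rule P_minus[OF P_mult[OF p_in_P yO]])
  hence "(of_nat p, 0) \<in> line_lattice y"
    using P_O[OF p_in_P] by (simp add: line_lattice_def mult.commute)
  hence v0: "\<Phi> (of_nat p) 0 \<in> embed (line_lattice y)" by (force simp: embed_def)
  have "\<Phi> (of_nat p) 0 \<noteq> zero_Rn n"
    unfolding \<Phi>_0[symmetric] using p_in_P P_O O_K p(1) prime_gt_0_nat by (subst \<Phi>_eq_iff) auto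
  hence \<mu>: "\<mu> > r" unfolding \<mu>_def by (rule lattice_min_gt[OF fin v0 _ long])
  define W where "W = lattice_Vol n (embed (line_lattice y))"
  have W: "W > 0" "W \<le> real q * vol" using line_lattice_volume[OF yO] by (simp_all add: W_def)
  have "V * r ^ n / (2 ^ n * (real q * vol)) \<le> V * r ^ n / (2 ^ n * W)"
    using W V_pos r residue_pos vol_pos
    by (intro divide_left_mono mult_left_mono mult_pos_pos) auto
  also have "\<dots> < V * \<mu> ^ n / (2 ^ n * W)"
    using W(1) V_pos r \<mu> d_pos
      by (intro divide_strict_right_mono mult_strict_left_mono power_strict_mono) auto
  also have "\<dots> = packing_density n (embed (line_lattice y))"
    using \<mu> r by (simp add: packing_density_def measure_cball_Rn \<mu>_def W_def)
  finally show ?thesis .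
qed

section \<open>The choice of the radius, and the conclusion\<close>

lemma dense_line_lattice:
  fixes \<epsilon> :: real
  defines "Q \<equiv> real q powr (1 / real d)"
  assumes \<epsilon>: "0 < \<epsilon>" "\<epsilon> < 1" and m: "(1 - \<epsilon>) * real m \<ge> 1"
    and Q1: "4 * (real d ^ 2 * real m) < Q" and Q2: "32 * (real d ^ 2 * real m)
        < (ln (1 - \<epsilon>))\<^sup>2 * Q"
  shows "\<exists>\<Lambda>\<in>code_lattices m P. packing_density n \<Lambda> > (1 - \<epsilon>) * real m / 2 ^ n"
proof -
  have q: "real q > 0" using residue_pos by simp
  have dp: "real d > 0" "d > 0" "n > 0" using d_pos by auto
  have Q: "Q > 0" using q by (simp add: Q_def)
  have Qd: "Q ^ d = real q"
    using q dp by (simp add: Q_def powr_powr flip: powr_realpow)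
  have sq: "sqrt t ^ n = t ^ d" if "t \<ge> 0" for t using that by (simp add: power_mult)
  define A where "A = (1 - \<epsilon>) * real m * (real q * vol) / V"
  have A: "A > 0" using \<epsilon> m_pos q vol_pos V_pos by (simp add: A_def)
  define r where "r = root n A"
  have r: "r > 0" "r ^ n = A" using A dp by (simp_all add: r_def)
  have Vr: "V * r ^ n = (1 - \<epsilon>) * real m * (real q * vol)"
    unfolding r(2) A_def times_divide_eq_right
    by (rule nonzero_mult_div_cancel_left) (use less_imp_neq[OF V_pos] in metis)
  have lower: "sqrt d / 4 * sqrt Q \<le> r"
  proof -
    have "(sqrt d / 4 * sqrt Q) ^ n = (sqrt d / 4) ^ n * real q"
      using Q by (simp only: power_mult_distrib sq Qd less_imp_le)
    also have "\<dots> \<le> (vol / V) * real q"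
      using vol_ge V_pos q by (intro mult_right_mono) (simp_all add: pos_le_divide_eq mult.commute)
    also have "\<dots> \<le> ((1 - \<epsilon>) * real m) * ((vol / V) * real q)"
    proof -
      have "0 \<le> vol / V * real q" using vol_pos V_pos q
        by (intro mult_nonneg_nonneg divide_nonneg_pos) auto
      thus ?thesis using mult_right_mono[OF m] by fastforce
    qed
    also have "\<dots> = A" by (simp add: A_def)
    finally show ?thesis using r dp Q power_mono_iff[of "sqrt d / 4 * sqrt Q" r n] by simp
  qed
  have upper: "r\<^sup>2 < Q\<^sup>2 / 8"
  proof -
    have "A = ((1 - \<epsilon>) * real m) * (real q * (vol / V))" by (simp add: A_def)
    \<comment> \<open>The factor (1 - \<epsilon>) m is bounded by m^d so that the whole right-hand
      side is a d-th power and the root can be taken.\<close>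
    also have "\<dots> \<le> real m ^ d * (real q * \<tau> ^ n)"
    proof (intro mult_mono)
      have "(1 - \<epsilon>) * real m \<le> 1 * real m" using \<epsilon> by (intro mult_right_mono) auto
      hence "(1 - \<epsilon>) * real m \<le> real m" by simp
      also have "\<dots> \<le> real m ^ d" using m_pos dp by (intro self_le_power) auto
      finally show "(1 - \<epsilon>) * real m \<le> real m ^ d" .
      show "vol / V \<le> \<tau> ^ n" using vol_le V_pos by (simp add: pos_divide_le_eq mult.commute)
    qed (use \<epsilon> q vol_pos V_pos \<tau>_pos in auto)
    also have "\<dots> = (real m * Q * \<tau>\<^sup>2) ^ d" by (simp add: power_mult_distrib Qd flip: power_mult)
    finally have "(r\<^sup>2) ^ d \<le> (real m * Q * \<tau>\<^sup>2) ^ d" using r(2) by (simp add: power_mult)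
    hence "r\<^sup>2 \<le> real m * Q * \<tau>\<^sup>2" using dp Q by (subst (asm) power_mono_iff) auto
    also have "\<dots> = Q * (4 * (real d ^ 2 * real m)) / 8"
      by (simp add: \<tau>_def power2_eq_square)
    also have "\<dots> < Q * Q / 8"
      by (rule divide_strict_right_mono[OF mult_strict_left_mono[OF Q1 Q]]) simp
    finally show ?thesis by (simp add: power2_eq_square)
  qed
  have P_long: "norm_Rn n v > r" if v: "v \<in> embed (P \<times> P)" "v \<noteq> zero_Rn n" for v
  proof -
    obtain x1 x2 where x: "v = \<Phi> x1 x2" "x1 \<in> P" "x2 \<in> P" using v(1) by (auto simp: embed_def)
    \<comment> \<open>The volume q^2 vol is at least q^2 V (sqrt d / 4)^n, while
      \<open>vol_P_le\<close> bounds it in terms of the norm of \<open>z\<close>. Taking d-th roots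
      leaves Q^2 d / 16 <= d \<open>conj_norm z\<close> / 2.\<close>
    have long: "conj_norm z \<ge> Q\<^sup>2 / 8" if z: "z \<in> P" "z \<noteq> 0" for z
    proof -
      have "(sqrt d / 4) ^ n = (real d / 16) ^ d" by (simp add: power_mult power_divide)
      moreover have "(Q\<^sup>2) ^ d = (real q)\<^sup>2"
        by (simp add: Qd[symmetric] mult.commute flip: power_mult)
      ultimately have "(Q\<^sup>2 * (real d / 16)) ^ d * V = (real q)\<^sup>2 * (V * (sqrt d / 4) ^ n)"
        unfolding power_mult_distrib by simp
      also have "\<dots> \<le> (real q)\<^sup>2 * vol" using vol_ge by (intro mult_left_mono) auto
      also have "\<dots> \<le> V * sqrt (real d * conj_norm z / 2) ^ n" by (rule vol_P_le[OF z])
      also have "\<dots> = (real d * conj_norm z / 2) ^ d * V"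
        using conj_norm_nonneg[of z] by (subst sq) auto
      finally have "(Q\<^sup>2 * (real d / 16)) ^ d \<le> (real d * conj_norm z / 2) ^ d" using V_pos by simp
      hence "Q\<^sup>2 * (real d / 16) \<le> real d * conj_norm z / 2"
        using dp conj_norm_nonneg[of z] by (subst (asm) power_mono_iff) auto
      hence "real d * (Q\<^sup>2 / 8) \<le> real d * conj_norm z" by (simp add: mult_ac)
      thus ?thesis using dp by simp
    qed
    have "x1 \<noteq> 0 \<or> x2 \<noteq> 0" using v(2) x(1) \<Phi>_0 by auto
    hence "Q\<^sup>2 / 8 \<le> conj_norm x1 + conj_norm x2"
      using long[OF x(2)] long[OF x(3)] conj_norm_nonneg[of x1] conj_norm_nonneg[of x2] by linarith
    also have "\<dots> = (norm_Rn n v)\<^sup>2" unfolding x(1) using \<Phi>_norm P_O O_K x by simp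
    finally have "r\<^sup>2 < (norm_Rn n v)\<^sup>2" using upper by linarith
    thus ?thesis by (rule power_less_imp_less_base) simp
  qed
  have count: "V * (r + \<tau>) ^ n < real m * real q * vol"
  proof -
    \<comment> \<open>Enlarging the radius by \<tau> multiplies the volume of the ball by (1 +
      \<tau> / r)^n <= exp s, so s < - ln (1 - \<epsilon>) is enough. With n = 2d and \<tau>^2 = d^2
      / 2, the square of s is 2 d^4 / r^2.\<close>
    define s where "s = real n * (\<tau> / r)"
    have s: "s \<ge> 0" using r \<tau>_pos by (simp add: s_def)
    have "real d * Q / 16 = (sqrt d / 4 * sqrt Q)\<^sup>2" using Q
      by (simp add: power_mult_distrib power_divide)
    also have "\<dots> \<le> r\<^sup>2" using lower Q by (intro power_mono) auto
    finally have r2: "real d * Q / 16 \<le> r\<^sup>2" .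
    have "s\<^sup>2 = 2 * real d ^ 4 / r\<^sup>2"
      by (simp add: s_def \<tau>_def power_mult_distrib power_divide power2_eq_square power4_eq_xxxx)
    also have "\<dots> \<le> 2 * real d ^ 4 / (real d * Q / 16)"
      using r2 dp Q r by (intro divide_left_mono) auto
    also have "\<dots> = 32 * (real d ^ 2 * real d) / Q" using dp Q
      by (simp add: field_simps power2_eq_square power4_eq_xxxx)
    also have "\<dots> \<le> 32 * (real d ^ 2 * real m) / Q"
      using Q totient_le[of m] by (intro divide_right_mono mult_left_mono) auto
    also have "\<dots> < (ln (1 - \<epsilon>))\<^sup>2" using Q2 Q by (simp add: pos_divide_less_eq)
    also have "\<dots> = (- ln (1 - \<epsilon>))\<^sup>2" by simp
    finally have "s < - ln (1 - \<epsilon>)"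
      by (rule power_less_imp_less_base) (use \<epsilon> in simp)
    hence "exp s < exp (- ln (1 - \<epsilon>))" by simp
    also have "\<dots> = 1 / (1 - \<epsilon>)" using \<epsilon> by (simp add: exp_minus inverse_eq_divide)
    finally have e: "exp s < 1 / (1 - \<epsilon>)" .
    have "r + \<tau> = r * (1 + \<tau> / r)" using r by (simp add: field_simps)
    hence "(r + \<tau>) ^ n = r ^ n * (1 + \<tau> / r) ^ n" by (simp only: power_mult_distrib)
    also have "\<dots> \<le> r ^ n * exp (\<tau> / r) ^ n"
      using r \<tau>_pos by (intro mult_left_mono power_mono exp_ge_add_one_self) auto
    also have "exp (\<tau> / r) ^ n = exp s" unfolding s_def by (rule exp_of_nat_mult[symmetric])
    also have "r ^ n * exp s < r ^ n * (1 / (1 - \<epsilon>))" using e r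
      by (intro mult_strict_left_mono) auto
    finally have lt: "(r + \<tau>) ^ n < r ^ n * (1 / (1 - \<epsilon>))" .
    have "V * (r + \<tau>) ^ n < V * (r ^ n * (1 / (1 - \<epsilon>)))"
      by (rule mult_strict_left_mono[OF lt V_pos])
    also have "\<dots> = (V * r ^ n) / (1 - \<epsilon>)" by simp
    also have "\<dots> = real m * real q * vol" unfolding Vr using \<epsilon> by simp
    finally show ?thesis .
  qed
  obtain y where y: "y \<in> Y" "\<forall>v\<in>embed (line_lattice y). v \<noteq> zero_Rn n \<longrightarrow> norm_Rn n v > r"
    using exists_line_lattice_without_short_vectors[OF r(1) P_long count] by blast
  have "packing_density n (embed (line_lattice y)) > V * r ^ n / (2 ^ n * (real q * vol))"
    using y(2) by (intro line_lattice_density[OF y(1) r(1)]) blast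
  also have "V * r ^ n / (2 ^ n * (real q * vol)) = (1 - \<epsilon>) * real m / 2 ^ n"
    unfolding Vr using q vol_pos by simp
  finally show ?thesis using line_lattice_code[of y] y(1) Y(1) by blast
qed

end

lemma (in cyclotomic_prime) cyclotomic_code_exists: "\<exists>D Y. cyclotomic_code m P p D Y"
proof -
  obtain Y where Y: "Y \<subseteq> \<O>" "finite Y" "card Y = q"
    "\<And>x y. x \<in> Y \<Longrightarrow> y \<in> Y \<Longrightarrow> x - y \<in> P \<Longrightarrow> x = y"
    "\<And>x. x \<in> \<O> \<Longrightarrow> \<exists>y\<in>Y. x - y \<in> P"
    using representatives by blast
  have "covers_Rn n (embed (\<O> \<times> \<O>)) (cball_Rn n (sqrt (real d * real d / 2)))"
    using cball_covers[of "\<O> \<times> \<O>" 1] by simp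
  then obtain D
    where "fundamental_region n (embed (\<O> \<times> \<O>)) D" "D \<subseteq> cball_Rn n (sqrt (real d * real d / 2))"
    using discrete_lattice.fundamental_region_in_covering[OF discrete_O cball_Rn_sets] by blast
  hence "cyclotomic_code m P p D Y"
    using Y by unfold_locales
  thus ?thesis by blast
qed

theorem theorem2:
  fixes P :: "nat \<Rightarrow> complex set" and \<epsilon> :: real
  assumes "\<And>m. m > 0 \<Longrightarrow> primeideal (P m) (cyc_int_ring m)"
    and "\<And>m. m > 0 \<Longrightarrow> \<exists>p::nat. prime p \<and> \<not> p dvd m \<and> lies_over (P m) p"
    and "(\<lambda>m. real (totient m) ^ 2 * real m)
           \<in> o(\<lambda>m. real (residue_card m (P m)) powr (1 / real (totient m)))"
    and "0 < \<epsilon>" and "\<epsilon> < 1"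
  shows "\<forall>\<^sub>F m in sequentially. \<exists>\<Lambda>\<in>code_lattices m (P m).
           packing_density (2 * totient m) \<Lambda> > (1 - \<epsilon>) * real m / 2 ^ (2 * totient m)"
proof -
  \<comment> \<open>Half of the thresholds 1/4 and ln(1 - \<epsilon>)^2 / 32 of
    \<open>dense_line_lattice\<close>, so that the weak inequality from the Landau symbol gives the
    strict ones.\<close>
  define c where "c = min (1 / 8) ((ln (1 - \<epsilon>))\<^sup>2 / 64)"
  have c: "c > 0" "c \<le> 1 / 8" "c \<le> (ln (1 - \<epsilon>))\<^sup>2 / 64" using assms(4,5) by (auto simp: c_def)
  have "\<forall>\<^sub>F m in sequentially. norm (real (totient m) ^ 2 * real m)
      \<le> c * norm (real (residue_card m (P m)) powr (1 / real (totient m)))"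
    by (rule landau_o.smallD[OF assms(3) c(1)])
  moreover have "\<forall>\<^sub>F m in sequentially. m \<ge> nat \<lceil>1 / (1 - \<epsilon>)\<rceil>" "\<forall>\<^sub>F m :: nat in sequentially. m > 1"
    by (rule eventually_ge_at_top, rule eventually_gt_at_top)
  ultimately show ?thesis
  proof eventually_elim
    case (elim m)
    define Q where "Q = real (residue_card m (P m)) powr (1 / real (totient m))"
    define F where "F = real (totient m) ^ 2 * real m"
    have F: "F > 0" using elim by (simp add: F_def)
    have FQ: "F \<le> c * Q" using elim F by (simp add: F_def Q_def)
    hence "c * Q > 0" using F by linarith
    hence Q: "Q > 0" using c by (simp add: zero_less_mult_iff)
    \<comment> \<open>If the residue ring were infinite, \<open>residue_card\<close> would be 0 and
      with it Q, since \<open>0 powr a\<close> is 0. The growth hypothesis thus supplies finiteness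
      for large m.\<close>
    hence q: "residue_card m (P m) > 0" by (cases "residue_card m (P m)") (simp_all add: Q_def)
    obtain p where p: "prime p" "lies_over (P m) p" using assms(2)[of m] elim by auto
    interpret cyclotomic_prime m "P m" p
      by (intro cyclotomic_prime.intro cyclotomic.intro cyclotomic_prime_axioms.intro)
        (use elim assms(1)[of m] p q in auto)
    obtain D Y where "cyclotomic_code m (P m) p D Y" using cyclotomic_code_exists by blast
    then interpret cyclotomic_code m "P m" p D Y .
    have "c * Q \<le> 1 / 8 * Q" "c * Q \<le> (ln (1 - \<epsilon>))\<^sup>2 / 64 * Q"
      using c Q by (auto intro!: mult_right_mono)
    moreover have "(ln (1 - \<epsilon>))\<^sup>2 * Q > 0" using assms(4,5) Q by simp
    ultimately have "4 * F < Q" "32 * F < (ln (1 - \<epsilon>))\<^sup>2 * Q" using FQ Q by linarith+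
    moreover have "(1 - \<epsilon>) * real m \<ge> 1"
    proof -
      have "1 / (1 - \<epsilon>) \<le> real m" using elim by linarith
      thus ?thesis using assms(5) by (simp add: pos_divide_le_eq mult.commute)
    qed
    ultimately show ?case
      using dense_line_lattice[OF assms(4,5)] by (simp add: F_def Q_def)
  qed
qed

end
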